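(* Let $\pmb k$ be an algebraically closed field and let $B,d,g_1,g_2,g_3,\Psi,\mathcal C,\varphi,d_1,d_2$ be as in the context. Assume that $p=[0:0:1]$ is a singular point on the curve $\mathcal C$ of multiplicity $d_j$, for $j$ equal to $1$ or $2$. Assume further that $$\varphi=\begin{bmatrix}P_1&Q_1\\P_2&Q_2\\0&Q_3\end{bmatrix},$$ where the $P_i$ and the $Q_i$ are homogeneous forms from $B$ with $\deg P_i=d-d_j$ and $\deg Q_i=d_j$. Then a point $P=(p,[a:b])\in\mathbb P^2\times\mathbb P^1$ lies on the blowup of $\mathcal C$ at $p$ if and only if $\gcd(Q_3,aP_1+bP_2)$ is not a constant. In this case, the multiplicity of $P$ on the blowup is the degree of $\gcd(Q_3,aP_1+bP_2)$.
   Context: Setting: $B=\pmb k[x,y]$ is the standard graded polynomial ring, $g_1,g_2,g_3$ are homogeneous forms of degree $d$ in $B$, $I=(g_1,g_2,g_3)B$, $\Psi:\mathbb P^1\to\mathbb P^2$ is the morphism $[g_1:g_2:g_3]$, and $\mathcal C$ is the image of $\Psi$. Assume: $I$ is minimally generated by $g_1,g_2,g_3$; $I$ has height two; and $\Psi:\mathbb P^1\to\mathcal C$ is a birational morphism. $\varphi$ is a homogeneous Hilbert-Burch matrix for $[g_1,g_2,g_3]$, that is, a $3\times2$ matrix with homogeneous entries whose columns form a basis of the module of relations on $[g_1,g_2,g_3]$ (equivalently, $g_1,g_2,g_3$ are, up to a common unit, the signed maximal minors of $\varphi$); the two column degrees of $\varphi$ are $d_1\le d_2$, with $d_1+d_2=d$.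 The blowup of $\mathcal C$ at $p=[0:0:1]$ is viewed inside $\mathbb P^2\times\mathbb P^1$ in the usual way: it is the closure of the set of pairs $([T_1:T_2:T_3],[T_1:T_2])$ with $[T_1:T_2:T_3]\in\mathcal C\setminus\{p\}$. The multiplicity of a point on a curve is the multiplicity of the local ring of the curve at that point. *)

theory Defs
  imports
    "HOL-Analysis.Cartesian_Space"
    "HOL-Library.Extended_Nat"
    "HOL-Algebra.Ideal_Product"
    "HOL-Algebra.Ring_Divisibility"
    "HOL-Algebra.Algebraic_Closure_Type"
begin

section \<open>Dimension, length and multiplicity in commutative rings\<close>

definition prime_height :: "('a, 'b) ring_scheme \<Rightarrow> 'a set \<Rightarrow> enat" where
  "prime_height R P =
     Sup {enat n | n. \<exists>p :: nat \<Rightarrow> 'a set.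
       (\<forall>i\<le>n. primeideal (p i) R) \<and> (\<forall>i<n. p i \<subset> p (Suc i)) \<and> p n = P}"

definition ideal_height :: "('a, 'b) ring_scheme \<Rightarrow> 'a set \<Rightarrow> enat" where
  "ideal_height R I = Inf (prime_height R ` {P. primeideal P R \<and> I \<subseteq> P})"

definition krull_dim :: "('a, 'b) ring_scheme \<Rightarrow> enat" where
  "krull_dim R = Sup (prime_height R ` {P. primeideal P R})"

definition local_with_maximal :: "('a, 'b) ring_scheme \<Rightarrow> 'a set \<Rightarrow> bool" where
  "local_with_maximal R m \<longleftrightarrow> cring R \<and> (\<forall>M. maximalideal M R \<longleftrightarrow> M = m)"

primrec ideal_power :: "('a, 'b) ring_scheme \<Rightarrow> 'a set \<Rightarrow> nat \<Rightarrow> 'a set" where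
  "ideal_power R I 0 = carrier R"
| "ideal_power R I (Suc n) = ideal_power R I n \<cdot>\<^bsub>R\<^esub> I"

text \<open>The length of the \<open>R\<close>-module \<open>R/J\<close>; its submodules are the \<open>I/J\<close> for ideals \<open>I \<supseteq> J\<close>.\<close>

definition colength :: "('a, 'b) ring_scheme \<Rightarrow> 'a set \<Rightarrow> enat" where
  "colength R J =
     Sup {enat n | n. \<exists>I :: nat \<Rightarrow> 'a set.
       (\<forall>i\<le>n. ideal (I i) R \<and> J \<subseteq> I i) \<and> (\<forall>i<n. I i \<subset> I (Suc i))}"

text \<open>
  Hilbert--Samuel multiplicity: \<open>R\<close> is local of finite dimension \<open>r\<close>, with maximal ideal \<open>m\<close>,
  every \<open>R/m\<^sup>n\<close> has finite length, and \<open>r! length(R/m\<^sup>n) / n\<^sup>r\<close> tends to \<open>e\<close>.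
\<close>

definition has_multiplicity :: "('a, 'b) ring_scheme \<Rightarrow> nat \<Rightarrow> bool" where
  "has_multiplicity R e \<longleftrightarrow>
     (\<exists>m r l. local_with_maximal R m \<and> krull_dim R = enat r \<and>
        (\<forall>n. colength R (ideal_power R m n) = enat (l n)) \<and>
        (\<lambda>n. fact r * real (l n) / real n ^ r) \<longlonglongrightarrow> real e)"

definition regular_local_ring :: "('a, 'b) ring_scheme \<Rightarrow> bool" where
  "regular_local_ring R \<longleftrightarrow>
     noetherian_ring R \<and>
     (\<exists>m S. local_with_maximal R m \<and> finite S \<and> S \<subseteq> carrier R \<and>
        m = Idl\<^bsub>R\<^esub> S \<and> krull_dim R = enat (card S))"


section \<open>Projective space and its forms\<close>

definition proportional :: "'k::field ^ 'n::finite \<Rightarrow> 'k ^ 'n \<Rightarrow> bool" where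
  "proportional v w \<longleftrightarrow> v \<noteq> 0 \<and> w \<noteq> 0 \<and> (\<exists>c. c \<noteq> 0 \<and> w = c *s v)"

lemma part_equivp_proportional: "part_equivp (proportional :: 'k::field ^ 'n::finite \<Rightarrow> _)"
proof (rule part_equivpI)
  show "\<exists>x :: 'k ^ 'n. proportional x x"
    by (rule exI[of _ "1"]) (auto simp: proportional_def vec_eq_iff intro: exI[of _ 1])
  show "symp (proportional :: 'k ^ 'n \<Rightarrow> _)"
  proof (rule sympI)
    fix v w :: "'k ^ 'n"
    assume "proportional v w"
    then obtain c where "v \<noteq> 0" "w \<noteq> 0" "c \<noteq> 0" "w = c *s v"
      by (auto simp: proportional_def)
    then show "proportional w v"
      by (auto simp: proportional_def intro!: exI[of _ "inverse c"])
  qed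
  show "transp (proportional :: 'k ^ 'n \<Rightarrow> _)"
  proof (rule transpI)
    fix u v w :: "'k ^ 'n"
    assume "proportional u v" "proportional v w"
    then obtain c e where "u \<noteq> 0" "w \<noteq> 0" "c \<noteq> 0" "e \<noteq> 0" "v = c *s u" "w = e *s v"
      by (auto simp: proportional_def)
    then show "proportional u w"
      by (auto simp: proportional_def intro!: exI[of _ "e * c"])
  qed
qed

text \<open>
  \<open>('k, 'n) pspace\<close> is projective space of dimension \<open>CARD('n) - 1\<close>; \<open>proj v\<close> is the point with
  homogeneous coordinates \<open>v\<close> (meaningful for \<open>v \<noteq> 0\<close> only), and \<open>coords x\<close> is some nonzero
  coordinate vector of the point \<open>x\<close>.
\<close>

quotient_type (overloaded) ('k, 'n) pspace = "('k::field) ^ ('n::finite)" / partial: proportional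
  morphisms coords proj
  by (rule part_equivp_proportional)

text \<open>
  Forms in the coordinates, as polynomial functions; over an infinite field these are the same
  as polynomials. The index sets of the sums are finite.
\<close>

definition monomial_fun :: "('n::finite \<Rightarrow> nat) \<Rightarrow> 'k::field ^ 'n \<Rightarrow> 'k" where
  "monomial_fun \<alpha> v = (\<Prod>i\<in>UNIV. v $ i ^ \<alpha> i)"

definition form :: "nat \<Rightarrow> ('k::field ^ 'n::finite \<Rightarrow> 'k) \<Rightarrow> bool" where
  "form m F \<longleftrightarrow> (\<exists>c. \<forall>v. F v = (\<Sum>\<alpha> | sum \<alpha> UNIV = m. c \<alpha> * monomial_fun \<alpha> v))"

definition biform ::
  "nat \<Rightarrow> nat \<Rightarrow> ('k::field ^ 'n::finite \<Rightarrow> 'k ^ 'm::finite \<Rightarrow> 'k) \<Rightarrow> bool" where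
  "biform m n F \<longleftrightarrow>
     (\<exists>c. \<forall>v w. F v w =
        (\<Sum>\<alpha> | sum \<alpha> UNIV = m. \<Sum>\<beta> | sum \<beta> UNIV = n.
           c \<alpha> \<beta> * monomial_fun \<alpha> v * monomial_fun \<beta> w))"

text \<open>
  The geometry of subsets of a projective space and of a product of two is treated uniformly: \<open>\<G>\<close> is the
  collection of the (bi)graded pieces of the (bi)homogeneous coordinate ring of the ambient space,
  each form being evaluated at the chosen coordinates of a point. Only zeros of forms and
  quotients of two forms from the same piece are used, and these do not depend on that choice.
\<close>

definition forms_on_pspace :: "(('k::field, 'n::finite) pspace \<Rightarrow> 'k) set set" where
  "forms_on_pspace = range (\<lambda>m. {\<lambda>x. F (coords x) | F. form m F})"

definition forms_on_product ::
  "(('k::field, 'n::finite) pspace \<times> ('k, 'm::finite) pspace \<Rightarrow> 'k) set set" where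
  "forms_on_product = range (\<lambda>(m, n). {\<lambda>(x, y). F (coords x) (coords y) | F. biform m n F})"

definition zariski_closure :: "('p \<Rightarrow> 'k::field) set set \<Rightarrow> 'p set \<Rightarrow> 'p set" where
  "zariski_closure \<G> Z = {x. \<forall>A\<in>\<G>. \<forall>F\<in>A. (\<forall>z\<in>Z. F z = 0) \<longrightarrow> F x = 0}"


section \<open>The local ring of a variety at a point\<close>

text \<open>
  Functions on the ambient space that agree, on a neighbourhood of \<open>P\<close> in \<open>V\<close>, with a quotient
  of two forms of the same degree. Sets \<open>{x \<in> V. G x \<noteq> 0}\<close> with \<open>G\<close> a form are a basis of the
  topology of \<open>V\<close>.
\<close>

definition regular_at :: "('p \<Rightarrow> 'k::field) set set \<Rightarrow> 'p set \<Rightarrow> 'p \<Rightarrow> ('p \<Rightarrow> 'k) ring" where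
  "regular_at \<G> V P =
     \<lparr>carrier = {f. \<exists>A\<in>\<G>. \<exists>F\<in>A. \<exists>G\<in>A. G P \<noteq> 0 \<and> (\<forall>x\<in>V. G x \<noteq> 0 \<longrightarrow> f x = F x / G x)},
      monoid.mult = (\<lambda>f h x. f x * h x), one = (\<lambda>x. 1),
      ring.zero = (\<lambda>x. 0), add = (\<lambda>f h x. f x + h x)\<rparr>"

definition locally_zero_at :: "('p \<Rightarrow> 'k::field) set set \<Rightarrow> 'p set \<Rightarrow> 'p \<Rightarrow> ('p \<Rightarrow> 'k) set" where
  "locally_zero_at \<G> V P = {f. \<exists>A\<in>\<G>. \<exists>G\<in>A. G P \<noteq> 0 \<and> (\<forall>x\<in>V. G x \<noteq> 0 \<longrightarrow> f x = 0)}"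

text \<open>The ring of germs at \<open>P\<close> of regular functions on \<open>V\<close>.\<close>

definition local_ring :: "('p \<Rightarrow> 'k::field) set set \<Rightarrow> 'p set \<Rightarrow> 'p \<Rightarrow> ('p \<Rightarrow> 'k) set ring" where
  "local_ring \<G> V P = regular_at \<G> V P Quot locally_zero_at \<G> V P"


section \<open>Forms in two variables and rational curves\<close>

text \<open>
  \<open>k[x,y]\<close> is \<open>'k poly poly\<close>: the inner variable is \<open>x\<close> and the outer one is \<open>y\<close>, so that
  \<open>coeff (coeff f i) j\<close> is the coefficient of \<open>x\<^sup>j y\<^sup>i\<close>. The zero polynomial is a form of every
  degree.
\<close>

definition binary_form :: "nat \<Rightarrow> 'k::field poly poly \<Rightarrow> bool" where
  "binary_form n f \<longleftrightarrow> (\<forall>i j. coeff (coeff f i) j \<noteq> 0 \<longrightarrow> i + j = n)"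

definition total_degree :: "'k::field poly poly \<Rightarrow> nat" where
  "total_degree f = Max (insert 0 {i + j | i j. coeff (coeff f i) j \<noteq> 0})"

definition eval2 :: "'k::field poly poly \<Rightarrow> 'k ^ 2 \<Rightarrow> 'k" where
  "eval2 f v = poly (poly f [:v $ 2:]) (v $ 1)"

definition is_gcd :: "'a::comm_ring_1 \<Rightarrow> 'a \<Rightarrow> 'a \<Rightarrow> bool" where
  "is_gcd D a b \<longleftrightarrow> D dvd a \<and> D dvd b \<and> (\<forall>E. E dvd a \<and> E dvd b \<longrightarrow> E dvd D)"

definition ideal_of :: "'a::comm_ring_1 set \<Rightarrow> 'a set" where
  "ideal_of S = Idl\<^bsub>ring_of_type_algebra\<^esub> S"

definition minimal_generators :: "'a::comm_ring_1 ^ 'n \<Rightarrow> bool" where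
  "minimal_generators g \<longleftrightarrow>
     (\<forall>i. ideal_of {g $ j | j. j \<noteq> i} \<noteq> ideal_of (range (($) g)))"

text \<open>Homogeneous columns, which form a basis of the module of relations on \<open>g\<close>.\<close>

definition hilbert_burch_matrix ::
  "'k::field poly poly ^ 3 \<Rightarrow> 'k poly poly ^ 2 ^ 3 \<Rightarrow> bool" where
  "hilbert_burch_matrix g \<phi> \<longleftrightarrow>
     (\<exists>e. \<forall>i j. binary_form (e j) (\<phi> $ i $ j)) \<and>
     bij_betw (\<lambda>c. \<phi> *v c) UNIV {r. (\<Sum>i\<in>UNIV. r $ i * g $ i) = 0}"

definition curve_map ::
  "'k::field poly poly ^ 3 \<Rightarrow> ('k, 2) pspace \<Rightarrow> ('k, 3) pspace" where
  "curve_map g q = proj (\<chi> i. eval2 (g $ i) (coords q))"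

definition curve :: "'k::field poly poly ^ 3 \<Rightarrow> ('k, 3) pspace set" where
  "curve g = range (curve_map g)"

text \<open>
  A morphism \<open>\<Psi>\<close> from a projective space onto its image is birational if it has a rational
  inverse \<open>x \<mapsto> [H(x)]\<close>, defined where the tuple \<open>H\<close> of forms does not vanish.
\<close>

definition birational_onto_image ::
  "(('k::field, 'n::finite) pspace \<Rightarrow> ('k, 'm::finite) pspace) \<Rightarrow> bool" where
  "birational_onto_image \<Psi> \<longleftrightarrow>
     (\<exists>e (H :: 'k ^ 'm \<Rightarrow> 'k ^ 'n). (\<forall>i. form e (\<lambda>v. H v $ i)) \<and>
        (\<exists>x\<in>range \<Psi>. H (coords x) \<noteq> 0) \<and>
        (\<forall>x\<in>range \<Psi>. H (coords x) \<noteq> 0 \<longrightarrow> \<Psi> (proj (H (coords x))) = x) \<and>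
        (\<forall>q. H (coords (\<Psi> q)) \<noteq> 0 \<longrightarrow> proj (H (coords (\<Psi> q))) = q))"

definition base_point :: "('k::field, 3) pspace" where
  "base_point = proj (vector [0, 0, 1])"

definition blowup_at_base_point ::
  "('k::field, 3) pspace set \<Rightarrow> (('k, 3) pspace \<times> ('k, 2) pspace) set" where
  "blowup_at_base_point C =
     zariski_closure forms_on_product
       {(proj T, proj (vector [T $ 1, T $ 2])) | T. T \<noteq> 0 \<and> proj T \<in> C - {base_point}}"

end

theory Submission
  imports Defs "HOL-Computational_Algebra.Polynomial_Factorial" "HOL-Library.Function_Algebras"
begin

text \<open>
  Put \<open>w = (P2, - P1)\<close> and \<open>r = a P1 + b P2\<close>. The first column of the matrix makes \<open>(g\<^sub>1, g\<^sub>2)\<close> a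
  multiple \<open>h w\<close>, and the second column together with the degrees makes \<open>h\<close> a constant multiple of
  \<open>Q3\<close>. As \<open>P1\<close> and \<open>P2\<close> have no common zero, \<open>q \<mapsto> (g(q), [w(q)])\<close> is a morphism from the
  projective line, and the blowup is the closure of its image. The parameters over \<open>(p, [a : b])\<close> are the
  common zeros of \<open>Q3\<close> and \<open>r\<close>, hence the zeros of \<open>D\<close>.

  In a chart of the parameter line whose point at infinity is in general position
  (\<open>curve_chart.blowup_chart_exists\<close>), a bihomogeneous form pulls back to a polynomial in one variable
  \<open>s\<close>. Quotients of pullbacks whose denominators come from forms that are nonzero at the point form a
  subring \<open>S\<close> of the field \<open>k(s)\<close>, which is isomorphic to the local ring of the blowup
  (\<open>germ_surj\<close>, \<open>kernel_germ\<close>). It lies in the ring \<open>O\<close> of fractions without a pole at a zero of \<open>D\<close>.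
  Three facts relate the two rings.

  \<^item> Modulo \<open>D\<close> the parametrization is a multiple of the point (\<open>hat_cong\<close>). So \<open>S\<close> is local with
    maximal ideal \<open>m = S \<inter> D O\<close> and residue field \<open>k\<close>. Moreover \<open>m O = D O\<close>, because \<open>h\<close> and \<open>r\<close>, of
    which \<open>D\<close> is a linear combination, are multiples of elements of \<open>m\<close>.
  \<^item> The parametrization is birational, so \<open>s\<close> is a quotient of forms on the curve, and some nonzero
    polynomial \<open>C\<close> times every polynomial of suitable degree is a pullback (\<open>conductor_exists\<close>).
  \<^item> Forms separate the point from all parameters that are not mapped to it (\<open>separation\<close>).

  If \<open>D\<close> is constant, then the last two facts yield a form that vanishes on the blowup but not at the
  point (\<open>P_notin_V\<close>). Otherwise the point is the image of a zero of \<open>D\<close>, and the two facts give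
  \<open>D\<^sup>n\<^sup>0 O \<subseteq> S\<close> for some \<open>n0\<close> (\<open>conductor_germs\<close>). With \<open>m O = D O\<close> this implies
  \<open>D\<^sup>n\<^sup>0\<^sup>+\<^sup>n O \<subseteq> m\<^sup>n \<subseteq> D\<^sup>n O\<close>. The length of \<open>S / m\<^sup>n\<close> is therefore \<open>n * degree D\<close> up to a bounded
  error, and since \<open>S\<close> has dimension one, its multiplicity is the degree of \<open>D\<close>
  (\<open>germ_ring.has_multiplicity_degree\<close>).
\<close>

no_notation fps_nth (infixl \<open>$\<close> 75)

section \<open>Polynomials without common zeros\<close>

lemma bezout_family:
  fixes f :: "'i::finite \<Rightarrow> 'k::alg_closed_field poly"
  assumes no_zero: "\<And>s. \<exists>i. poly (f i) s \<noteq> 0"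
  shows "\<exists>a. (\<Sum>i\<in>UNIV. a i * f i) = 1"
proof -
  define I where "I = {p. \<exists>a. p = (\<Sum>i\<in>UNIV. a i * f i)}"
  have memb: "f i \<in> I" for i
  proof -
    have "f i = (\<Sum>j\<in>UNIV. (if j = i then 1 else 0) * f j)"
      by (simp add: if_distrib[of "\<lambda>x. x * _"] cong: if_cong)
    then show ?thesis unfolding I_def
      by (intro CollectI exI[of _ "\<lambda>j. if j = i then 1 else 0"])
  qed
  have lin: "x - y * p \<in> I" if x: "x \<in> I" and p: "p \<in> I" for x y p
  proof -
    obtain a b where "x = (\<Sum>i\<in>UNIV. a i * f i)" "p = (\<Sum>i\<in>UNIV. b i * f i)"
      using x p unfolding I_def by blast
    then have "x - y * p = (\<Sum>i\<in>UNIV. (a i - y * b i) * f i)"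
      by (simp add: left_diff_distrib sum_subtractf sum_distrib_left mult.assoc)
    then show ?thesis unfolding I_def
      by (intro CollectI exI[of _ "\<lambda>i. a i - y * b i"])
  qed
  obtain i0 where "f i0 \<noteq> 0" using no_zero[of 0] by force
  then have "\<exists>p. p \<in> I \<and> p \<noteq> 0" using memb by blast
  then obtain p where p: "p \<in> I" "p \<noteq> 0" and least: "\<And>q. q \<in> I \<Longrightarrow> q \<noteq> 0 \<Longrightarrow> degree p \<le> degree q"
    using ex_has_least_nat[of "\<lambda>p. p \<in> I \<and> p \<noteq> 0" _ degree] by blast
  have dvd: "p dvd f i" for i
  proof -
    have "f i mod p \<in> I"
      using lin[OF memb[of i] p(1), of "f i div p"] by (simp add: minus_div_mult_eq_mod)
    then have "f i mod p = 0"
      using least degree_mod_less[OF p(2), of "f i"] by fastforce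
    then show ?thesis by (simp add: mod_eq_0_iff_dvd)
  qed
  have "degree p = 0"
  proof (rule ccontr)
    assume "degree p \<noteq> 0"
    then obtain s where "poly p s = 0" using alg_closed_imp_poly_has_root[of p] by blast
    then have "poly (f i) s = 0" for i using dvd[of i] by (auto elim!: dvdE)
    then show False using no_zero by blast
  qed
  then obtain c where c: "p = [:c:]" by (rule degree_eq_zeroE)
  obtain a where "p = (\<Sum>i\<in>UNIV. a i * f i)" using p(1) unfolding I_def by blast
  then have "(\<Sum>i\<in>UNIV. ([:inverse c:] * a i) * f i) = [:inverse c:] * [:c:]"
    unfolding c by (simp add: sum_distrib_left mult.assoc del: mult_pCons_left)
  also have "\<dots> = 1" using c p(2) by simp
  finally show ?thesis by (rule exI[of _ "\<lambda>i. [:inverse c:] * a i"])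
qed

lemma bezout_pair:
  fixes p q :: "'k::alg_closed_field poly"
  assumes "\<And>s. poly p s \<noteq> 0 \<or> poly q s \<noteq> 0"
  shows "\<exists>a b. a * p + b * q = 1"
proof -
  have "\<exists>a. (\<Sum>i\<in>UNIV. a i * (if i then p else q)) = 1"
    by (rule bezout_family) (use assms in \<open>auto split: if_splits\<close>)
  then obtain a :: "bool \<Rightarrow> 'k poly" where "a True * p + a False * q = 1"
    by (auto simp: UNIV_bool add.commute)
  then show ?thesis by blast
qed

text \<open>
  Reducing all coefficients but one modulo a member of full degree leaves no room for
  cancellation, so that the coefficients satisfy the degree bound that one expects of forms.
\<close>

lemma bezout_degree:
  fixes f :: "'i::finite \<Rightarrow> 'k::alg_closed_field poly"
  assumes no_zero: "\<And>s. \<exists>i. poly (f i) s \<noteq> 0"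
    and deg: "\<And>i. degree (f i) \<le> d" and full: "degree (f i0) = d"
    and h: "degree h \<le> d + M" and M: "d \<le> M + 1"
  shows "\<exists>a. h = (\<Sum>i\<in>UNIV. a i * f i) \<and> (\<forall>i. degree (a i) \<le> M)"
proof (cases "f i0 = 0")
  case True
  then have d: "d = 0" using full by simp
  obtain i where i: "f i \<noteq> 0" using no_zero[of 0] by force
  obtain c where c: "f i = [:c:]" using deg[of i] d by (auto elim: degree_eq_zeroE)
  have "h = (\<Sum>j\<in>UNIV. (if j = i then smult (inverse c) h else 0) * f j)"
    using i by (simp add: if_distrib[of "\<lambda>x. x * _"] c cong: if_cong)
  then show ?thesis using h d
    by (intro exI[of _ "\<lambda>j. if j = i then smult (inverse c) h else 0"]) auto
next
  case f0: False
  obtain a where a: "(\<Sum>i\<in>UNIV. a i * f i) = 1" using bezout_family[OF no_zero] by blast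
  define b where "b i = (h * a i) mod f i0" for i
  have small: "degree (b i) \<le> M \<and> degree (b i * f i) \<le> d + M" for i
  proof (cases "b i = 0")
    case False
    then have "degree (b i) < d"
      using degree_mod_less[OF f0, of "h * a i"] full by (auto simp: b_def)
    then have "degree (b i) \<le> M" using M by simp
    then show ?thesis using degree_mult_le[of "b i" "f i"] deg[of i] by linarith
  qed simp
  define r where "r = h - (\<Sum>i\<in>UNIV - {i0}. b i * f i)"
  have "f i0 dvd r"
  proof -
    have "h = (\<Sum>i\<in>UNIV. (h * a i) * f i)"
      using a by (metis (no_types, lifting) mult.assoc mult.right_neutral sum.cong sum_distrib_left)
    also have "\<dots> = h * a i0 * f i0 + (\<Sum>i\<in>UNIV - {i0}. (h * a i) * f i)"
      by (simp add: sum.remove)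
    finally have "r = h * a i0 * f i0 + (\<Sum>i\<in>UNIV - {i0}. (h * a i - b i) * f i)"
      unfolding r_def by (simp add: left_diff_distrib sum_subtractf)
    moreover have "f i0 dvd h * a i - b i" for i
      unfolding b_def by (simp add: minus_mod_eq_div_mult)
    ultimately show ?thesis by (auto intro!: dvd_add dvd_sum)
  qed
  then obtain t where t: "r = t * f i0" by (metis dvdE mult.commute)
  have "degree (\<Sum>i\<in>UNIV - {i0}. b i * f i) \<le> d + M"
    by (rule degree_sum_le) (use small in auto)
  then have "degree r \<le> d + M" unfolding r_def using h by (intro degree_diff_le) auto
  then have "degree t \<le> M"
    using full f0 degree_mult_eq[of t "f i0"] unfolding t by (cases "t = 0") auto
  moreover have "h = (\<Sum>i\<in>UNIV. (if i = i0 then t else b i) * f i)"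
  proof -
    have "(\<Sum>i\<in>UNIV. (if i = i0 then t else b i) * f i)
        = t * f i0 + (\<Sum>i\<in>UNIV - {i0}. b i * f i)"
      by (simp add: sum.remove[of _ i0])
    then show ?thesis using t unfolding r_def by (simp add: algebra_simps)
  qed
  ultimately show ?thesis using small
    by (intro exI[of _ "\<lambda>i. if i = i0 then t else b i"]) auto
qed


section \<open>Subrings of a commutative ring and their ideals\<close>

definition ring_on :: "'a::comm_ring_1 set \<Rightarrow> 'a ring" where
  "ring_on S = \<lparr>carrier = S, monoid.mult = (*), one = 1, ring.zero = 0, add = (+)\<rparr>"

lemma ring_on_simps [simp]:
  "carrier (ring_on S) = S" "monoid.mult (ring_on S) x y = x * y" "one (ring_on S) = 1"
  "ring.zero (ring_on S) = 0" "add (ring_on S) x y = x + y"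
  by (simp_all add: ring_on_def)

locale unital_subring =
  fixes S :: "'a::comm_ring_1 set"
  assumes one_mem: "1 \<in> S"
    and diff_mem: "x \<in> S \<Longrightarrow> y \<in> S \<Longrightarrow> x - y \<in> S"
    and mult_mem: "x \<in> S \<Longrightarrow> y \<in> S \<Longrightarrow> x * y \<in> S"
begin

lemma zero_mem: "0 \<in> S"
  using diff_mem[OF one_mem one_mem] by simp

lemma uminus_mem: "x \<in> S \<Longrightarrow> - x \<in> S"
  using diff_mem[OF zero_mem] by fastforce

lemma add_mem: "x \<in> S \<Longrightarrow> y \<in> S \<Longrightarrow> x + y \<in> S"
  using diff_mem[of x "- y"] uminus_mem by simp

lemma power_mem: "x \<in> S \<Longrightarrow> x ^ n \<in> S"
  by (induction n) (auto intro: one_mem mult_mem)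

lemma cring_ring_on: "cring (ring_on S)"
proof (rule cringI)
  show "abelian_group (ring_on S)"
  proof (rule abelian_groupI)
    fix x assume "x \<in> carrier (ring_on S)"
    then show "\<exists>y\<in>carrier (ring_on S). y \<oplus>\<^bsub>ring_on S\<^esub> x = \<zero>\<^bsub>ring_on S\<^esub>"
      by (intro bexI[of _ "- x"]) (auto intro: uminus_mem)
  qed (auto intro: add_mem zero_mem simp: algebra_simps)
  show "comm_monoid (ring_on S)"
    by (rule comm_monoidI) (auto intro: mult_mem one_mem simp: algebra_simps)
qed (simp add: distrib_right)

lemma ideal_ring_on_iff:
  "ideal I (ring_on S) \<longleftrightarrow>
     I \<subseteq> S \<and> 0 \<in> I \<and> (\<forall>x\<in>I. \<forall>y\<in>I. x + y \<in> I) \<and> (\<forall>x\<in>I. \<forall>a\<in>S. a * x \<in> I)" (is "_ \<longleftrightarrow> ?r")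
proof
  assume I: "ideal I (ring_on S)"
  then have sub: "I \<subseteq> S" using ideal.Icarr by fastforce
  moreover have "0 \<in> I"
    using additive_subgroup.zero_closed[OF ideal.axioms(1)[OF I]] by simp
  moreover have "\<forall>x\<in>I. \<forall>y\<in>I. x + y \<in> I"
    using additive_subgroup.a_closed[OF ideal.axioms(1)[OF I]] by simp
  moreover have "\<forall>x\<in>I. \<forall>a\<in>S. a * x \<in> I"
    using ideal.I_l_closed[OF I] by simp
  ultimately show ?r by blast
next
  assume r: ?r
  interpret cring "ring_on S" by (rule cring_ring_on)
  have neg: "- x \<in> I" if "x \<in> I" for x
    using r that uminus_mem[OF one_mem] by (metis mult_minus1)
  show "ideal I (ring_on S)"
  proof (rule idealI)
    show "subgroup I (add_monoid (ring_on S))"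
    proof (rule add.subgroupI)
      fix x assume x: "x \<in> I"
      then have "x \<in> S" using r by blast
      then have "\<ominus>\<^bsub>ring_on S\<^esub> x = - x"
        by (intro minus_equality) (auto intro: uminus_mem)
      then show "\<ominus>\<^bsub>ring_on S\<^esub> x \<in> I" using neg x by simp
    qed (use r in auto)
  next
    fix a x assume ax: "a \<in> I" "x \<in> carrier (ring_on S)"
    then show "x \<otimes>\<^bsub>ring_on S\<^esub> a \<in> I" using r by simp
    then show "a \<otimes>\<^bsub>ring_on S\<^esub> x \<in> I" by (simp add: mult.commute)
  qed (rule ring_axioms)
qed

lemma primeideal_ring_on_iff:
  "primeideal I (ring_on S) \<longleftrightarrow>
     ideal I (ring_on S) \<and> I \<noteq> S \<and> (\<forall>x\<in>S. \<forall>y\<in>S. x * y \<in> I \<longrightarrow> x \<in> I \<or> y \<in> I)"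
proof
  assume I: "primeideal I (ring_on S)"
  show "ideal I (ring_on S) \<and> I \<noteq> S \<and> (\<forall>x\<in>S. \<forall>y\<in>S. x * y \<in> I \<longrightarrow> x \<in> I \<or> y \<in> I)"
    using primeideal.axioms(1)[OF I] primeideal.I_notcarr[OF I] primeideal.I_prime[OF I] by auto
next
  assume "ideal I (ring_on S) \<and> I \<noteq> S \<and> (\<forall>x\<in>S. \<forall>y\<in>S. x * y \<in> I \<longrightarrow> x \<in> I \<or> y \<in> I)"
  then show "primeideal I (ring_on S)"
    by (intro primeidealI cring_ring_on) auto
qed

lemma ideal_one_imp_eq: "ideal I (ring_on S) \<Longrightarrow> 1 \<in> I \<Longrightarrow> I = S"
  unfolding ideal_ring_on_iff using mult.right_neutral by (metis subsetI subset_antisym)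

end


section \<open>The semilocal ring at the zeros of a polynomial\<close>

text \<open>
  Rational functions in one variable without a pole at a zero of \<open>D\<close>: for a nonconstant \<open>D\<close> a
  semilocal principal ideal domain, in which \<open>vanishing D n\<close> is the ideal generated by \<open>D\<^sup>n\<close>.
\<close>

definition localization :: "'k::alg_closed_field poly \<Rightarrow> 'k poly fract set" where
  "localization D = {to_fract f / to_fract g | f g. \<forall>s. poly D s = 0 \<longrightarrow> poly g s \<noteq> 0}"

definition vanishing :: "'k::alg_closed_field poly \<Rightarrow> nat \<Rightarrow> 'k poly fract set" where
  "vanishing D n = {to_fract (D ^ n) * x | x. x \<in> localization D}"

locale nonconstant =
  fixes D :: "'k::alg_closed_field poly"
  assumes degree_D: "0 < degree D"
begin

lemma D_nonzero: "D \<noteq> 0"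
  using degree_D by auto

lemma unit_bezout:
  assumes "\<forall>s. poly D s = 0 \<longrightarrow> poly g s \<noteq> 0"
  shows "g \<noteq> 0" "\<exists>a b. a * g + b * D ^ n = 1"
proof -
  obtain s where "poly D s = 0" using degree_D alg_closed_imp_poly_has_root by blast
  then show "g \<noteq> 0" using assms by auto
  show "\<exists>a b. a * g + b * D ^ n = 1"
    by (rule bezout_pair) (use assms in auto)
qed

sublocale O: unital_subring "localization D"
proof
  show "1 \<in> localization D"
    unfolding localization_def by (intro CollectI exI[of _ 1]) auto
next
  fix x y assume "x \<in> localization D" "y \<in> localization D"
  then obtain f g f' g' where *: "x = to_fract f / to_fract g" "y = to_fract f' / to_fract g'"
    "\<forall>s. poly D s = 0 \<longrightarrow> poly g s \<noteq> 0" "\<forall>s. poly D s = 0 \<longrightarrow> poly g' s \<noteq> 0"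
    unfolding localization_def by blast
  have nz: "g \<noteq> 0" "g' \<noteq> 0" using unit_bezout(1) *(3,4) by auto
  have "x - y = to_fract (f * g' - f' * g) / to_fract (g * g')"
    using nz unfolding *(1,2) by (simp add: field_simps)
  moreover have "x * y = to_fract (f * f') / to_fract (g * g')"
    unfolding *(1,2) by simp
  moreover have "\<forall>s. poly D s = 0 \<longrightarrow> poly (g * g') s \<noteq> 0" using *(3,4) by simp
  ultimately show "x - y \<in> localization D" "x * y \<in> localization D"
    unfolding localization_def by blast+
qed

lemma poly_mem_localization: "to_fract p \<in> localization D"
  unfolding localization_def by (intro CollectI exI[of _ p] exI[of _ 1]) auto

lemma vanishing_0: "vanishing D 0 = localization D"
  unfolding vanishing_def by simp

lemma vanishing_add: "x \<in> vanishing D n \<Longrightarrow> y \<in> vanishing D n \<Longrightarrow> x + y \<in> vanishing D n"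
  unfolding vanishing_def by (auto simp: distrib_left[symmetric] intro!: O.add_mem)

lemma vanishing_zero: "0 \<in> vanishing D n"
  unfolding vanishing_def using O.zero_mem by force

lemma vanishing_mult: "x \<in> vanishing D m \<Longrightarrow> y \<in> vanishing D n \<Longrightarrow> x * y \<in> vanishing D (m + n)"
proof -
  assume "x \<in> vanishing D m" "y \<in> vanishing D n"
  then obtain x' y' where "x = to_fract (D ^ m) * x'" "y = to_fract (D ^ n) * y'"
      "x' \<in> localization D" "y' \<in> localization D"
    unfolding vanishing_def by blast
  then have "x * y = to_fract (D ^ (m + n)) * (x' * y')" "x' * y' \<in> localization D"
    by (auto simp: power_add algebra_simps intro: O.mult_mem)
  then show ?thesis unfolding vanishing_def by blast
qed

lemma vanishing_mult_O: "x \<in> localization D \<Longrightarrow> y \<in> vanishing D n \<Longrightarrow> x * y \<in> vanishing D n"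
  using vanishing_mult[of x 0 y n] by (simp add: vanishing_0)

lemma poly_mem_vanishing_iff: "to_fract p \<in> vanishing D n \<longleftrightarrow> D ^ n dvd p"
proof
  assume "to_fract p \<in> vanishing D n"
  then obtain f g where fg: "to_fract p = to_fract (D ^ n) * (to_fract f / to_fract g)"
    "\<forall>s. poly D s = 0 \<longrightarrow> poly g s \<noteq> 0"
    unfolding vanishing_def localization_def by blast
  obtain a b where ab: "a * g + b * D ^ n = 1" using unit_bezout(2)[OF fg(2)] by blast
  have "to_fract (p * g) = to_fract (D ^ n * f)"
    using fg(1) unit_bezout(1)[OF fg(2)] by (simp add: field_simps)
  then have "p * g = D ^ n * f" by (simp only: to_fract_eq_iff)
  moreover have "p = a * (p * g) + b * p * D ^ n" using ab
    by (metis distrib_left mult.commute mult.left_commute mult.right_neutral)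
  ultimately have "p = D ^ n * (a * f + b * p)" by (simp add: algebra_simps)
  then show "D ^ n dvd p" by (metis dvd_triv_left)
qed (auto simp: vanishing_def elim!: dvdE intro: poly_mem_localization)

lemma vanishing_antimono: "m \<le> n \<Longrightarrow> vanishing D n \<subseteq> vanishing D m"
proof
  fix x assume "m \<le> n" "x \<in> vanishing D n"
  then obtain y where y: "x = to_fract (D ^ n) * y" "y \<in> localization D"
    unfolding vanishing_def by blast
  have "D ^ n = D ^ m * D ^ (n - m)" using \<open>m \<le> n\<close> by (simp flip: power_add)
  then have "x = to_fract (D ^ m) * (to_fract (D ^ (n - m)) * y)"
    using y(1) by (simp add: mult.assoc)
  then show "x \<in> vanishing D m" unfolding vanishing_def
    using O.mult_mem[OF poly_mem_localization y(2)] by blast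
qed



lemma division_with_remainder:
  assumes "x \<in> localization D"
  shows "\<exists>p. (p = 0 \<or> degree p < n * degree D) \<and> x - to_fract p \<in> vanishing D n"
proof -
  obtain f g where fg: "x = to_fract f / to_fract g" "\<forall>s. poly D s = 0 \<longrightarrow> poly g s \<noteq> 0"
    using assms unfolding localization_def by blast
  obtain a b where ab: "a * g + b * D ^ n = 1" using unit_bezout(2)[OF fg(2)] by blast
  define p where "p = (f * a) mod D ^ n"
  have dp: "p = 0 \<or> degree p < n * degree D"
    unfolding p_def using degree_mod_less[of "D ^ n" "f * a"] D_nonzero by (auto simp: degree_power_eq)
  have "f = f * (a * g + b * D ^ n)" using ab by simp
  also have "\<dots> = f * a * g + f * b * D ^ n" by (simp add: algebra_simps)
  finally have f: "f = \<dots>" .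
  have "f - p * g = (f * a - p) * g + f * b * D ^ n"
    by (subst f) (simp add: algebra_simps)
  also have "f * a - p = D ^ n * ((f * a) div D ^ n)"
    unfolding p_def by (simp add: minus_mod_eq_mult_div)
  finally have *: "f - p * g = D ^ n * ((f * a) div D ^ n * g + f * b)" by (simp add: algebra_simps)
  have "x - to_fract p = to_fract (f - p * g) / to_fract g"
    using unit_bezout(1)[OF fg(2)] unfolding fg(1) by (simp add: field_simps)
  also have "\<dots> = to_fract (D ^ n) * (to_fract ((f * a) div D ^ n * g + f * b) / to_fract g)"
    unfolding * by (simp only: to_fract_mult times_divide_eq_right)
  finally have "x - to_fract p \<in> vanishing D n"
    unfolding vanishing_def localization_def using fg(2) by blast
  then show ?thesis using dp by blast
qed

text \<open>
  Each zero that \<open>f\<close> shares with \<open>D\<close> costs one factor \<open>D\<close>; what is left of \<open>f\<close> is a unit.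
\<close>

lemma vanishing_subset_multiples:
  assumes "f \<noteq> 0"
  shows "\<exists>n. \<exists>y\<in>localization D. to_fract (D ^ n) = to_fract f * y"
  using assms
proof (induction "degree f" arbitrary: f rule: less_induct)
  case less
  show ?case
  proof (cases "\<forall>s. poly D s = 0 \<longrightarrow> poly f s \<noteq> 0")
    case True
    then have "1 / to_fract f \<in> localization D"
      unfolding localization_def by (intro CollectI exI[of _ 1] exI[of _ f]) auto
    then show ?thesis using less.prems
      by (intro exI[of _ 0] bexI[of _ "1 / to_fract f"]) auto
  next
    case False
    then obtain s where "poly D s = 0" "poly f s = 0" by blast
    then obtain f' D' where *: "f = [:- s, 1:] * f'" "D = [:- s, 1:] * D'"
      unfolding poly_eq_0_iff_dvd by (metis dvdE)
    have "f' \<noteq> 0" using less.prems *(1) by auto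
    then have "degree f' < degree f" unfolding *(1) by (subst degree_mult_eq) auto
    then obtain n y where y: "y \<in> localization D" "to_fract (D ^ n) = to_fract f' * y"
      using less.hyps \<open>f' \<noteq> 0\<close> by blast
    have "to_fract (D ^ Suc n) = to_fract D * to_fract (D ^ n)" by simp
    also have "\<dots> = to_fract f * (to_fract D' * y)"
      unfolding y(2) by (subst *(2), subst *(1)) (simp only: to_fract_mult ac_simps)
    finally show ?thesis using O.mult_mem[OF poly_mem_localization y(1)] by blast
  qed
qed

lemma localization_mult_mem_vanishing:
  assumes "x \<in> localization D" "x \<noteq> 0"
  shows "\<exists>n. \<exists>y\<in>localization D. to_fract (D ^ n) = x * y"
proof -
  obtain f g where fg: "x = to_fract f / to_fract g" "\<forall>s. poly D s = 0 \<longrightarrow> poly g s \<noteq> 0"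
    using assms(1) unfolding localization_def by blast
  then have nz: "f \<noteq> 0" "g \<noteq> 0" using assms(2) by auto
  obtain n y where y: "y \<in> localization D" "to_fract (D ^ n) = to_fract f * y"
    using vanishing_subset_multiples[OF nz(1)] by blast
  have "to_fract (D ^ n) = x * (to_fract g * y)" using y(2) nz(2) unfolding fg(1) by simp
  then show ?thesis using O.mult_mem[OF poly_mem_localization y(1)] by blast
qed

subsection \<open>Counting dimensions by degrees\<close>

text \<open>
  A subspace of the space of polynomials of degree less than \<open>M\<close> has as many different degrees of
  nonzero members as its dimension says. Subspaces between \<open>vanishing D N\<close> and the whole ring are
  determined by their polynomials of degree less than \<open>N * degree D\<close>; counting the degrees of these
  replaces linear algebra below.
\<close>

definition degrees :: "nat \<Rightarrow> 'k poly fract set \<Rightarrow> nat set" where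
  "degrees N A = {degree p | p. p \<noteq> 0 \<and> degree p < N * degree D \<and> to_fract p \<in> A}"

definition subspace :: "'k poly fract set \<Rightarrow> bool" where
  "subspace A \<longleftrightarrow> (\<forall>x\<in>A. \<forall>y\<in>A. x + y \<in> A) \<and> (\<forall>x\<in>A. \<forall>c. to_fract [:c:] * x \<in> A)"

lemma subspace_diff:
  assumes "subspace A" "x \<in> A" "y \<in> A" shows "x - y \<in> A"
proof -
  have "to_fract [:- 1:] * y \<in> A" using assms unfolding subspace_def by blast
  moreover have "to_fract [:- 1:] * y = - y"
    using to_fract_uminus[of "1 :: 'k poly"] by (metis minus_pCons minus_zero mult_minus1 one_pCons to_fract_1)
  ultimately show ?thesis using assms unfolding subspace_def by (metis diff_conv_add_uminus)
qed

lemma degrees_mono: "A \<subseteq> B \<Longrightarrow> degrees N A \<subseteq> degrees N B"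
  unfolding degrees_def by blast

lemma finite_degrees: "finite (degrees N A)" and card_degrees_le: "card (degrees N A) \<le> N * degree D"
proof -
  have sub: "degrees N A \<subseteq> {..<N * degree D}" unfolding degrees_def by auto
  show "finite (degrees N A)" by (rule finite_subset[OF sub]) simp
  show "card (degrees N A) \<le> N * degree D" using card_mono[OF _ sub] by simp
qed

lemma card_degrees_vanishing:
  assumes "n \<le> N" shows "card (degrees N (vanishing D n)) = (N - n) * degree D"
proof -
  have "degrees N (vanishing D n) = {n * degree D..<N * degree D}"
  proof (intro equalityI subsetI)
    fix i assume "i \<in> degrees N (vanishing D n)"
    then obtain p where p: "i = degree p" "p \<noteq> 0" "degree p < N * degree D" "D ^ n dvd p"
      unfolding degrees_def poly_mem_vanishing_iff by blast
    then show "i \<in> {n * degree D..<N * degree D}"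
      using dvd_imp_degree_le[OF p(4,2)] by (simp add: degree_power_eq D_nonzero)
  next
    fix i assume i: "i \<in> {n * degree D..<N * degree D}"
    define p where "p = monom 1 (i - n * degree D) * D ^ n"
    have "degree p = i" "p \<noteq> 0"
      using i unfolding p_def by (auto simp: degree_mult_eq D_nonzero degree_power_eq degree_monom_eq)
    then show "i \<in> degrees N (vanishing D n)"
      using i unfolding degrees_def poly_mem_vanishing_iff
      by (intro CollectI exI[of _ p]) (simp add: p_def)
  qed
  then show ?thesis by (simp add: diff_mult_distrib)
qed

text \<open>
  An element of \<open>B\<close> is reduced to zero by subtracting elements of \<open>A\<close> with the same leading term.
\<close>

lemma subspace_eq_if_degrees_eq:
  assumes A: "subspace A" "vanishing D N \<subseteq> A" and B: "subspace B" "B \<subseteq> localization D"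
    and "A \<subseteq> B" and eq: "degrees N A = degrees N B"
  shows "A = B"
proof
  have poly: "to_fract p \<in> B \<Longrightarrow> p = 0 \<or> degree p < N * degree D \<Longrightarrow> to_fract p \<in> A" for p
  proof (induction "degree p" arbitrary: p rule: less_induct)
    case less
    show ?case
    proof (cases "p = 0")
      case True
      then show ?thesis using A(2) vanishing_zero by auto
    next
      case False
      then have "degree p \<in> degrees N B" using less.prems unfolding degrees_def by blast
      then have "degree p \<in> degrees N A" using eq by simp
      then obtain q where q: "q \<noteq> 0" "degree q = degree p" "to_fract q \<in> A"
        unfolding degrees_def mem_Collect_eq by metis
      define c where "c = lead_coeff p / lead_coeff q"
      define r where "r = p - [:c:] * q"
      have cq: "to_fract ([:c:] * q) \<in> A"
        using A(1) q(3) unfolding subspace_def to_fract_mult by blast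
      have "coeff r (degree p) = 0" unfolding r_def c_def using q(1) by (simp flip: q(2))
      moreover have "degree r \<le> degree p" unfolding r_def using q(2)
        by (intro degree_diff_le) auto
      ultimately have r: "r = 0 \<or> degree r < degree p"
        by (metis leading_coeff_0_iff order_le_less)
      have "to_fract r \<in> B"
        unfolding r_def to_fract_diff using less.prems(1) cq \<open>A \<subseteq> B\<close> by (intro subspace_diff[OF B(1)]) auto
      then have "to_fract r \<in> A"
        using r less.hyps[of r] less.prems(2) False A(2) vanishing_zero by (cases "r = 0") auto
      moreover have "p = r + [:c:] * q" unfolding r_def by simp
      ultimately show ?thesis using cq A(1) unfolding subspace_def by (metis to_fract_add)
    qed
  qed
  show "B \<subseteq> A"
  proof
    fix x assume x: "x \<in> B"
    then obtain p where p: "p = 0 \<or> degree p < N * degree D" "x - to_fract p \<in> vanishing D N"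
      using division_with_remainder[of x N] B(2) by blast
    then have v: "x - to_fract p \<in> A" using A(2) by blast
    have "to_fract p = x - (x - to_fract p)" by simp
    moreover have "x - (x - to_fract p) \<in> B"
      by (rule subspace_diff[OF B(1) x]) (use v \<open>A \<subseteq> B\<close> in blast)
    ultimately have "to_fract p \<in> A" using poly p(1) by metis
    moreover have "x = to_fract p + (x - to_fract p)" by simp
    ultimately show "x \<in> A" using A(1) v unfolding subspace_def by metis
  qed
qed (rule \<open>A \<subseteq> B\<close>)

text \<open>
  Two members of \<open>A + k y\<close> outside \<open>A\<close>, scaled so that both involve \<open>y\<close> itself, differ by a member of
  \<open>A\<close>; if their degrees differ, then the larger one is already a degree in \<open>A\<close>.
\<close>

lemma card_degrees_adjoin:
  assumes A: "subspace A"
  shows "card (degrees N {x + to_fract [:c:] * y | x c. x \<in> A}) \<le> card (degrees N A) + 1"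
proof -
  let ?B = "{x + to_fract [:c:] * y | x c. x \<in> A}"
  have "\<exists>i. degrees N ?B \<subseteq> insert i (degrees N A)"
  proof (rule ccontr)
    assume no: "\<not> ?thesis"
    then obtain i where i: "i \<in> degrees N ?B" "i \<notin> degrees N A" by blast
    then obtain j where j: "j \<in> degrees N ?B" "j \<notin> degrees N A" "j \<noteq> i" using no by blast
    have norm: "\<exists>p. degree p = i \<and> p \<noteq> 0 \<and> i < N * degree D \<and> (\<exists>x\<in>A. to_fract p = x + y)"
      if i: "i \<in> degrees N ?B" "i \<notin> degrees N A" for i
    proof -
      obtain p x c where p: "i = degree p" "p \<noteq> 0" "degree p < N * degree D" "x \<in> A"
          "to_fract p = x + to_fract [:c:] * y"
        using i(1) unfolding degrees_def by blast
      have c: "c \<noteq> 0"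
      proof
        assume "c = 0"
        then have "to_fract p \<in> A" using p(4,5) by simp
        then show False using p i(2) unfolding degrees_def by blast
      qed
      have "to_fract ([:inverse c:] * p) = to_fract [:inverse c:] * x + to_fract ([:inverse c:] * [:c:]) * y"
        unfolding to_fract_mult p(5) by (simp add: algebra_simps)
      also have "[:inverse c:] * [:c:] = 1" using c by simp
      finally have "to_fract (smult (inverse c) p) = to_fract [:inverse c:] * x + y" by simp
      then show ?thesis using p c A unfolding subspace_def
        by (intro exI[of _ "smult (inverse c) p"]) auto
    qed
    obtain p x q x' where p: "degree p = i" "p \<noteq> 0" "i < N * degree D" "x \<in> A" "to_fract p = x + y"
      and q: "degree q = j" "q \<noteq> 0" "j < N * degree D" "x' \<in> A" "to_fract q = x' + y"
      using norm[OF i] norm[OF j(1,2)] by blast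
    have "to_fract (p - q) = x - x'" using p(5) q(5) by simp
    then have mem: "to_fract (p - q) \<in> A" using subspace_diff[OF A p(4) q(4)] by simp
    have "degree (p - q) = max i j" 
    proof (cases "i < j")
      case True
      then show ?thesis using degree_add_eq_right[of p "- q"] p(1) q(1) by simp
    next
      case False
      then show ?thesis using degree_add_eq_left[of "- q" p] p(1) q(1) j(3) by simp
    qed
    moreover have "p - q \<noteq> 0" using p(1) q(1) j(3) by auto
    ultimately have "max i j \<in> degrees N A" using mem p(3) q(3) unfolding degrees_def
      by (intro CollectI exI[of _ "p - q"]) (simp add: max_def)
    then show False using i(2) j(2) by (auto simp: max_def split: if_splits)
  qed
  then obtain i where "degrees N ?B \<subseteq> insert i (degrees N A)" by blast
  then have "card (degrees N ?B) \<le> card (insert i (degrees N A))"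
    by (intro card_mono) (auto simp: finite_degrees)
  also have "\<dots> \<le> card (degrees N A) + 1" using finite_degrees by (simp add: card_insert_if)
  finally show ?thesis .
qed

end


section \<open>Multiplicity of a one-dimensional ring with semilocal normalization\<close>

lemma tendsto_slope:
  fixes l :: "nat \<Rightarrow> nat"
  assumes lower: "\<And>n. n * e \<le> l n + c" and upper: "\<And>n. l n \<le> n * e + c"
  shows "(\<lambda>n. real (l n) / real n) \<longlonglongrightarrow> real e"
proof (rule real_tendsto_sandwich)
  have bound: "x - z / k \<le> y / k \<and> y / k \<le> x + z / k"
    if "k > 0" "k * x \<le> y + z" "y \<le> k * x + z" for k x y z :: real
  proof -
    have "x - z / k = (k * x - z) / k" "x + z / k = (k * x + z) / k"
      using that(1) by (simp_all add: diff_divide_distrib add_divide_distrib)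
    moreover have "(k * x - z) / k \<le> y / k" "y / k \<le> (k * x + z) / k"
      by (rule divide_right_mono; use that in linarith)+
    ultimately show ?thesis by simp
  qed
  have "real e - real c / real n \<le> real (l n) / real n \<and> real (l n) / real n \<le> real e + real c / real n"
    if "1 \<le> n" for n
  proof (rule bound)
    show "0 < real n" using that by simp
    show "real n * real e \<le> real (l n) + real c" "real (l n) \<le> real n * real e + real c"
      using lower[of n] upper[of n] by (simp_all flip: of_nat_mult of_nat_add)
  qed
  then show "\<forall>\<^sub>F n in sequentially. real e - real c / real n \<le> real (l n) / real n"
    "\<forall>\<^sub>F n in sequentially. real (l n) / real n \<le> real e + real c / real n"
    unfolding eventually_sequentially by blast+
  have "(\<lambda>n. real c / real n) \<longlonglongrightarrow> 0" by (rule lim_const_over_n)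
  from tendsto_diff[OF tendsto_const this, of "real e"] tendsto_add[OF tendsto_const this, of "real e"]
  show "(\<lambda>n. real e - real c / real n) \<longlonglongrightarrow> real e"
    "(\<lambda>n. real e + real c / real n) \<longlonglongrightarrow> real e"
    by simp_all
qed

text \<open>
  The axioms describe the local ring \<open>S\<close> of a point on a rational curve inside its normalization,
  which is the localization at the zeros of \<open>D\<close>, the points above it. The maximal ideal consists of the
  elements divisible by \<open>D\<close> and generates the ideal \<open>(D)\<close> upstairs (\<open>generate\<close>: a module over the
  localization that contains the maximal ideal contains \<open>D\<close>); \<open>n0\<close> bounds the conductor.
\<close>

locale germ_ring = nonconstant D + unital_subring S
  for D :: "'k::alg_closed_field poly" and S :: "'k poly fract set" +
  fixes n0 :: nat
  assumes const: "to_fract [:c:] \<in> S"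
    and subset: "S \<subseteq> localization D"
    and unit: "x \<in> S \<Longrightarrow> x \<notin> vanishing D 1 \<Longrightarrow> inverse x \<in> S"
    and residue: "x \<in> S \<Longrightarrow> \<exists>c. x - to_fract [:c:] \<in> vanishing D 1"
    and conductor: "vanishing D n0 \<subseteq> S"
    and generate: "S \<inter> vanishing D 1 \<subseteq> A \<Longrightarrow> (\<And>x y. x \<in> A \<Longrightarrow> y \<in> A \<Longrightarrow> x + y \<in> A) \<Longrightarrow>
      (\<And>x y. x \<in> A \<Longrightarrow> y \<in> localization D \<Longrightarrow> y * x \<in> A) \<Longrightarrow> to_fract D \<in> A"
begin

abbreviation "R \<equiv> ring_on S"
abbreviation "m \<equiv> S \<inter> vanishing D 1"

lemma ideal_memD:
  assumes "ideal I R"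
  shows "x \<in> I \<Longrightarrow> x \<in> S" "0 \<in> I" "x \<in> I \<Longrightarrow> y \<in> I \<Longrightarrow> x + y \<in> I" "x \<in> I \<Longrightarrow> a \<in> S \<Longrightarrow> a * x \<in> I"
  using assms unfolding ideal_ring_on_iff by auto

lemma ideal_m: "ideal m R"
  unfolding ideal_ring_on_iff
  using zero_mem vanishing_zero vanishing_add add_mem mult_mem vanishing_mult_O subset by auto

lemma one_notin_vanishing: "1 \<notin> vanishing D 1"
proof
  assume "1 \<in> vanishing D 1"
  then have "D dvd 1" using poly_mem_vanishing_iff[of 1 1] by simp
  then show False using degree_D by (auto dest: dvd_imp_degree_le)
qed

lemma proper_ideal_subset:
  assumes I: "ideal I R" "I \<noteq> S" shows "I \<subseteq> m"
proof
  fix x assume x: "x \<in> I"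
  have xS: "x \<in> S" using x by (rule ideal_memD(1)[OF I(1)])
  show "x \<in> m"
  proof (rule ccontr)
    assume "x \<notin> m"
    then have "x \<notin> vanishing D 1" using xS by blast
    then have "inverse x \<in> S" "x \<noteq> 0" using unit[OF xS] vanishing_zero by auto
    then have "inverse x * x \<in> I" "inverse x * x = 1"
      using ideal_memD(4)[OF I(1) x, of "inverse x"] by simp_all
    then show False using ideal_one_imp_eq[OF I(1)] I(2) by simp
  qed
qed

lemma local_with_maximal_m: "local_with_maximal R m"
proof -
  have "maximalideal M R \<longleftrightarrow> M = m" for M
  proof
    assume M: "maximalideal M R"
    then have "M \<subseteq> m" using proper_ideal_subset[OF maximalideal.axioms(1)[OF M]]
        maximalideal.I_notcarr[OF M] by auto
    then show "M = m"
      using maximalideal.I_maximal[OF M ideal_m] one_notin_vanishing one_mem by auto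
  next
    have "maximalideal m R"
    proof (rule maximalidealI)
      show "carrier R \<noteq> m" using one_notin_vanishing one_mem by auto
      fix J assume "ideal J R" "m \<subseteq> J" "J \<subseteq> carrier R"
      then show "J = m \<or> J = carrier R" using proper_ideal_subset[of J] by auto
    qed (rule ideal_m)
    then show "M = m \<Longrightarrow> maximalideal M R" by simp
  qed
  then show ?thesis unfolding local_with_maximal_def using cring_ring_on by blast
qed

text \<open>
  If \<open>x y = D\<^sup>n\<close> upstairs, then multiplying \<open>y\<close> by an element of the conductor brings it down to \<open>S\<close>.
\<close>

lemma nonzero_ideal_contains_vanishing:
  assumes I: "ideal I R" "x \<in> I" "x \<noteq> 0" shows "\<exists>N. vanishing D N \<subseteq> I"
proof -
  have "x \<in> localization D" using ideal_memD(1)[OF I(1,2)] subset by blast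
  then obtain n y where y: "y \<in> localization D" "to_fract (D ^ n) = x * y"
    using localization_mult_mem_vanishing I(3) by blast
  have "vanishing D (n + n0) \<subseteq> I"
  proof
    fix z assume "z \<in> vanishing D (n + n0)"
    then obtain u where u: "u \<in> localization D" "z = to_fract (D ^ (n + n0)) * u"
      unfolding vanishing_def by blast
    have "z = to_fract (D ^ n) * (to_fract (D ^ n0) * u)" unfolding u(2) by (simp add: power_add)
    also have "\<dots> = (y * (to_fract (D ^ n0) * u)) * x" unfolding y(2) by (simp add: ac_simps)
    finally have z: "z = (y * (to_fract (D ^ n0) * u)) * x" .
    have "to_fract (D ^ n0) * u \<in> vanishing D n0" using u(1) unfolding vanishing_def by blast
    then have "y * (to_fract (D ^ n0) * u) \<in> S" using vanishing_mult_O[OF y(1)] conductor by blast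
    then show "z \<in> I" unfolding z by (rule ideal_memD(4)[OF I(1,2)])
  qed
  then show ?thesis by blast
qed

lemma nonzero_prime_eq:
  assumes I: "primeideal I R" "x \<in> I" "x \<noteq> 0" shows "I = m"
proof
  have id: "ideal I R" "I \<noteq> S" and prime: "\<And>a b. a \<in> S \<Longrightarrow> b \<in> S \<Longrightarrow> a * b \<in> I \<Longrightarrow> a \<in> I \<or> b \<in> I"
    using I(1) unfolding primeideal_ring_on_iff by blast+
  show "I \<subseteq> m" by (rule proper_ideal_subset[OF id])
  obtain N where N: "vanishing D N \<subseteq> I" using nonzero_ideal_contains_vanishing[OF id(1) I(2,3)] by blast
  show "m \<subseteq> I"
  proof
    fix y assume y: "y \<in> m"
    have "y ^ n \<in> vanishing D n" for n
    proof (induction n)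
      case 0
      then show ?case using O.one_mem by (simp add: vanishing_0)
    next
      case (Suc n)
      then show ?case using vanishing_mult[of y 1 "y ^ n" n] y by simp
    qed
    moreover have "y ^ n \<in> I \<Longrightarrow> y \<in> I" for n
    proof (induction n)
      case 0
      then show ?case using ideal_one_imp_eq[OF id(1)] id(2) by simp
    next
      case (Suc n)
      then show ?case using prime[of y "y ^ n"] y power_mem by auto
    qed
    ultimately show "y \<in> I" using N by blast
  qed
qed

lemma vanishing_nonzero: "\<exists>x\<in>vanishing D n. x \<noteq> 0"
proof
  show "to_fract (D ^ n) \<in> vanishing D n" by (simp only: poly_mem_vanishing_iff dvd_refl)
  show "to_fract (D ^ n) \<noteq> 0" using D_nonzero by (simp only: to_fract_eq_0_iff power_not_zero not_False_eq_True)
qed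

lemma krull_dim_eq: "krull_dim R = enat 1"
proof -
  have zero: "primeideal {0} R"
  proof -
    have "ideal {0} R" unfolding ideal_ring_on_iff using zero_mem by auto
    moreover have "{0} \<noteq> S" using one_mem by auto
    ultimately show ?thesis unfolding primeideal_ring_on_iff by simp
  qed
  have mprime: "primeideal m R"
    using local_with_maximal_m cring.maximalideal_prime unfolding local_with_maximal_def by blast
  have m_nz: "{0} \<subset> m"
  proof -
    obtain x where x: "x \<in> vanishing D (n0 + 1)" "x \<noteq> 0" using vanishing_nonzero by blast
    then have "x \<in> m" using vanishing_antimono[of n0 "n0 + 1"] vanishing_antimono[of 1 "n0 + 1"] conductor by auto
    then show ?thesis using x(2) zero_mem vanishing_zero by blast
  qed
  have upper: "prime_height R P \<le> enat 1" for P
    unfolding prime_height_def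
  proof (rule Sup_least, clarify)
    fix n and p :: "nat \<Rightarrow> 'k poly fract set"
    assume p: "\<forall>i\<le>n. primeideal (p i) R" "\<forall>i<n. p i \<subset> p (Suc i)"
    show "enat n \<le> enat 1"
    proof (rule ccontr)
      assume "\<not> ?thesis"
      then have n: "n \<ge> 2" by simp
      have z: "0 \<in> p 0" using p(1) ideal_memD(2) unfolding primeideal_ring_on_iff by blast
      have "p 0 \<subset> p 1" "p 1 \<subset> p 2" using p(2) n by (auto simp: numeral_2_eq_2)
      then obtain x y where "x \<in> p 1" "x \<notin> p 0" "y \<in> p 2" "y \<notin> p 1" by blast
      then have "x \<noteq> 0" "y \<noteq> 0" using z \<open>p 0 \<subset> p 1\<close> by auto
      then have "p 1 = m" "p 2 = m"
        using nonzero_prime_eq[of "p 1" x] nonzero_prime_eq[of "p 2" y] p(1) n \<open>x \<in> p 1\<close> \<open>y \<in> p 2\<close> by auto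
      then show False using \<open>p 1 \<subset> p 2\<close> by simp
    qed
  qed
  have "enat 1 \<le> prime_height R m"
    unfolding prime_height_def
  proof (rule Sup_upper, rule CollectI, intro exI conjI)
    let ?p = "\<lambda>i::nat. if i = 0 then {0} else m"
    show "\<forall>i\<le>1. primeideal (?p i) R" using zero mprime by simp
    show "\<forall>i<1. ?p i \<subset> ?p (Suc i)" using m_nz by simp
  qed simp_all
  then have lower: "enat 1 \<le> krull_dim R"
    unfolding krull_dim_def by (rule Sup_upper2[rotated]) (use mprime in blast)
  have "krull_dim R \<le> enat 1"
    unfolding krull_dim_def by (rule Sup_least) (use upper in blast)
  then show ?thesis using lower by (rule antisym)
qed

lemma ideal_power_m: "ideal (ideal_power R m n) R"
proof (induction n)
  case 0
  have "ideal (carrier R) R" by (rule ring.oneideal[OF cring.axioms(1)[OF cring_ring_on]])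
  then show ?case unfolding ideal_power.simps .
next
  case (Suc n)
  then show ?case unfolding ideal_power.simps
    by (rule ring.ideal_prod_is_ideal[OF cring.axioms(1)[OF cring_ring_on] _ ideal_m])
qed

lemma ideal_power_subset: "ideal_power R m n \<subseteq> vanishing D n"
proof (induction n)
  case 0
  then show ?case using subset by (simp add: vanishing_0)
next
  case (Suc n)
  have "x \<in> vanishing D (Suc n)" if "x \<in> ideal_power R m n \<cdot>\<^bsub>R\<^esub> m" for x
    using that
  proof (induction rule: ideal_prod.induct)
    case (prod i j)
    then show ?case using vanishing_mult[of i n j 1] Suc by auto
  next
    case (sum x y)
    then show ?case using vanishing_add by simp
  qed
  then show ?case by auto
qed

text \<open>
  The multipliers of \<open>vanishing D (n0 + n)\<close> into \<open>m\<^sup>n\<^sup>+\<^sup>1\<close> form a module over the localization which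
  contains \<open>m\<close>, hence contain \<open>D\<close>.
\<close>

lemma vanishing_subset_ideal_power: "vanishing D (n0 + n) \<subseteq> ideal_power R m n"
proof (induction n)
  case 0
  then show ?case using conductor by simp
next
  case (Suc n)
  let ?I = "ideal_power R m (Suc n)"
  have add: "x \<in> ?I \<Longrightarrow> y \<in> ?I \<Longrightarrow> x + y \<in> ?I" for x y
    by (rule ideal_memD(3)[OF ideal_power_m])
  define A where "A = {x. \<forall>z\<in>vanishing D (n0 + n). x * z \<in> ?I}"
  have "to_fract D \<in> A"
  proof (rule generate)
    show "m \<subseteq> A"
    proof
      fix x assume x: "x \<in> m"
      have "x * z \<in> ?I" if "z \<in> vanishing D (n0 + n)" for z
      proof -
        have "z \<in> ideal_power R m n" using that Suc by blast
        then have "z \<otimes>\<^bsub>R\<^esub> x \<in> ideal_power R m n \<cdot>\<^bsub>R\<^esub> m" using x by (intro ideal_prod.prod)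
        then show ?thesis by (simp add: mult.commute)
      qed
      then show "x \<in> A" unfolding A_def by blast
    qed
    show "x \<in> A \<Longrightarrow> y \<in> A \<Longrightarrow> x + y \<in> A" for x y
      unfolding A_def using add by (simp add: distrib_right)
    show "y * x \<in> A" if "x \<in> A" "y \<in> localization D" for x y
      unfolding A_def
    proof (rule CollectI, rule ballI)
      fix z assume "z \<in> vanishing D (n0 + n)"
      then have "y * z \<in> vanishing D (n0 + n)" using vanishing_mult_O that by blast
      then have "x * (y * z) \<in> ?I" using that(1) unfolding A_def by blast
      then show "y * x * z \<in> ?I" by (simp only: ac_simps)
    qed
  qed
  show ?case
  proof
    fix z assume "z \<in> vanishing D (n0 + Suc n)"
    then obtain u where u: "u \<in> localization D" "z = to_fract (D ^ (n0 + Suc n)) * u"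
      unfolding vanishing_def by blast
    have "to_fract (D ^ (n0 + n)) * u \<in> vanishing D (n0 + n)" using u(1) unfolding vanishing_def by blast
    moreover have "z = to_fract D * (to_fract (D ^ (n0 + n)) * u)"
      unfolding u(2) by (simp add: mult.assoc)
    ultimately show "z \<in> ?I" using \<open>to_fract D \<in> A\<close> unfolding A_def by blast
  qed
qed

lemma ideal_subspace: "ideal I R \<Longrightarrow> subspace I"
  unfolding subspace_def using const ideal_memD(3,4) by simp



lemma card_degrees_strict:
  assumes "ideal I R" "ideal J R" "I \<subset> J" "vanishing D N \<subseteq> I"
  shows "card (degrees N I) < card (degrees N J)"
proof (rule psubset_card_mono[OF finite_degrees])
  have J: "J \<subseteq> localization D" using ideal_memD(1)[OF assms(2)] subset by blast
  have "degrees N I \<noteq> degrees N J"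
    using subspace_eq_if_degrees_eq[OF ideal_subspace[OF assms(1)] assms(4) ideal_subspace[OF assms(2)] J] assms(3)
    by blast
  then show "degrees N I \<subset> degrees N J" using degrees_mono[of I J N] assms(3) by blast
qed

text \<open>
  The last power \<open>t\<close> for which \<open>S \<inter> vanishing D t\<close> leaves \<open>J\<close> supplies an element that the maximal
  ideal multiplies into \<open>J\<close>. Adjoining it to \<open>J\<close> raises the dimension by one only, because \<open>S\<close> is the
  sum of the constants and the maximal ideal; repeating this gives chains of maximal length.
\<close>

lemma exists_socle_element:
  assumes J: "ideal J R" "vanishing D N \<subseteq> J" "J \<noteq> S"
  shows "\<exists>f\<in>S - J. \<forall>x\<in>m. x * f \<in> J"
proof -
  define t where "t = (LEAST t. S \<inter> vanishing D t \<subseteq> J)"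
  have t: "S \<inter> vanishing D t \<subseteq> J"
    unfolding t_def by (rule LeastI[of _ N]) (use J(2) in blast)
  have "J \<subset> S" using J(3) ideal_memD(1)[OF J(1)] by blast
  have "t \<noteq> 0"
  proof
    assume "t = 0"
    then have "S \<subseteq> J" using t subset by (auto simp: vanishing_0)
    then show False using \<open>J \<subset> S\<close> by blast
  qed
  then obtain t' where t': "t = Suc t'" using not0_implies_Suc by blast
  then have "\<not> S \<inter> vanishing D t' \<subseteq> J" unfolding t_def
    using not_less_Least[of t' "\<lambda>t. S \<inter> vanishing D t \<subseteq> J"] by (metis lessI)
  then obtain f where f: "f \<in> S" "f \<in> vanishing D t'" "f \<notin> J" by blast
  have "x * f \<in> J" if "x \<in> m" for x
    using vanishing_mult[of x 1 f t'] f that t mult_mem unfolding t' by auto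
  then show ?thesis using f by blast
qed

lemma ideal_adjoin:
  assumes J: "ideal J R" and f: "f \<in> S" "\<And>x. x \<in> m \<Longrightarrow> x * f \<in> J"
  shows "ideal {x + to_fract [:c:] * f | x c. x \<in> J} R" (is "ideal ?J R")
proof -
  have J': "J \<subseteq> S" "0 \<in> J" "\<And>x y. x \<in> J \<Longrightarrow> y \<in> J \<Longrightarrow> x + y \<in> J"
    "\<And>x a. x \<in> J \<Longrightarrow> a \<in> S \<Longrightarrow> a * x \<in> J"
    using ideal_memD[OF J] by blast+
  have "?J \<subseteq> S" using J'(1) f(1) const by (auto intro!: add_mem mult_mem)
  moreover have "0 \<in> ?J" using J'(2) by (intro CollectI exI[of _ 0]) auto
  moreover have "x + y \<in> ?J" if xy: "x \<in> ?J" "y \<in> ?J" for x y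
  proof -
    obtain x' c y' c' where *: "x = x' + to_fract [:c:] * f" "y = y' + to_fract [:c':] * f" "x' \<in> J" "y' \<in> J"
      using xy by blast
    have "to_fract [:c + c':] = to_fract [:c:] + to_fract [:c':]" by (simp flip: to_fract_add)
    then have "x + y = (x' + y') + to_fract [:c + c':] * f" unfolding *(1,2) by (simp add: algebra_simps)
    then show ?thesis using J'(3)[OF *(3,4)] by blast
  qed
  moreover have "a * x \<in> ?J" if xy: "x \<in> ?J" "a \<in> S" for x a
  proof -
    obtain x' c where x: "x = x' + to_fract [:c:] * f" "x' \<in> J" using xy(1) by blast
    obtain c' where c': "a - to_fract [:c':] \<in> vanishing D 1" using residue[OF xy(2)] by blast
    define b where "b = a - to_fract [:c':]"
    have b: "b \<in> m" unfolding b_def using c' diff_mem[OF xy(2) const] by blast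
    have "to_fract [:c' * c:] = to_fract [:c':] * to_fract [:c:]" by (simp flip: to_fract_mult)
    moreover have "a = b + to_fract [:c':]" unfolding b_def by simp
    ultimately have "a * x = (a * x' + to_fract [:c:] * (b * f)) + to_fract [:c' * c:] * f"
      unfolding x(1) by (simp add: algebra_simps)
    moreover have "a * x' + to_fract [:c:] * (b * f) \<in> J"
      by (intro J'(3,4) x(2) xy(2) f(2)[OF b] const)
    ultimately show ?thesis by blast
  qed
  ultimately show ?thesis unfolding ideal_ring_on_iff by blast
qed

lemma exists_long_chain:
  assumes J: "ideal J R" "vanishing D N \<subseteq> J"
  shows "\<exists>n I. (\<forall>i\<le>n. ideal (I i) R \<and> J \<subseteq> I i) \<and> (\<forall>i<n. I i \<subset> I (Suc i)) \<and>
     card (degrees N S) \<le> n + card (degrees N J)"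
  using J
proof (induction "card (degrees N S) - card (degrees N J)" arbitrary: J rule: less_induct)
  case less
  show ?case
  proof (cases "J = S")
    case True
    then show ?thesis using less.prems by (intro exI[of _ 0] exI[of _ "\<lambda>_. S"]) simp
  next
    case False
    obtain f where f: "f \<in> S" "f \<notin> J" "\<And>x. x \<in> m \<Longrightarrow> x * f \<in> J"
      using exists_socle_element[OF less.prems False] by blast
    define J' where "J' = {x + to_fract [:c:] * f | x c. x \<in> J}"
    have J': "ideal J' R" unfolding J'_def by (rule ideal_adjoin[OF less.prems(1) f(1,3)])
    have "J \<subseteq> J'"
    proof
      fix x assume "x \<in> J"
      then show "x \<in> J'" unfolding J'_def by (intro CollectI exI[of _ x] exI[of _ 0]) simp
    qed
    moreover have "f \<in> J'"
    proof -
      have "0 \<in> J" by (rule ideal_memD(2)[OF less.prems(1)])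
      then show ?thesis
        unfolding J'_def by (intro CollectI exI[of _ 0] exI[of _ 1]) (simp flip: one_pCons)
    qed
    ultimately have sub: "J \<subset> J'" using f(2) by blast
    then have V: "vanishing D N \<subseteq> J'" using less.prems(2) by blast
    have "J' \<subseteq> S" using ideal_memD(1)[OF J'] by blast
    then have "card (degrees N J') \<le> card (degrees N S)"
      by (intro card_mono finite_degrees degrees_mono)
    then have "card (degrees N S) - card (degrees N J') < card (degrees N S) - card (degrees N J)"
      using card_degrees_strict[OF less.prems(1) J' sub less.prems(2)] by simp
    then obtain n I where I: "\<And>i. i \<le> n \<Longrightarrow> ideal (I i) R \<and> J' \<subseteq> I i" "\<And>i. i < n \<Longrightarrow> I i \<subset> I (Suc i)"
        "card (degrees N S) \<le> n + card (degrees N J')"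
      using less.hyps[OF _ J' V] by blast
    define I' where "I' i = (case i of 0 \<Rightarrow> J | Suc i \<Rightarrow> I i)" for i
    have "ideal (I' i) R \<and> J \<subseteq> I' i" if "i \<le> Suc n" for i
      using that I(1) less.prems(1) sub unfolding I'_def by (cases i) auto
    moreover have "I' i \<subset> I' (Suc i)" if "i < Suc n" for i
      using that I(1)[of 0] I(2) sub unfolding I'_def by (cases i) auto
    moreover have "card (degrees N J') \<le> card (degrees N J) + 1"
      unfolding J'_def by (rule card_degrees_adjoin[OF ideal_subspace[OF less.prems(1)]])
    ultimately show ?thesis using I(3)
      by (intro exI[of _ "Suc n"] exI[of _ I']) auto
  qed
qed

lemma colength_eq:
  assumes J: "ideal J R" "vanishing D N \<subseteq> J"
  shows "colength R J = enat (card (degrees N S) - card (degrees N J))"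
proof (rule antisym)
  show "colength R J \<le> enat (card (degrees N S) - card (degrees N J))"
    unfolding colength_def
  proof (rule Sup_least, clarify)
    fix n and I :: "nat \<Rightarrow> 'k poly fract set"
    assume I: "\<forall>i\<le>n. ideal (I i) R \<and> J \<subseteq> I i" "\<forall>i<n. I i \<subset> I (Suc i)"
    have "k \<le> n \<Longrightarrow> k + card (degrees N J) \<le> card (degrees N (I k))" for k
    proof (induction k)
      case 0
      then show ?case using I(1) by (auto intro!: card_mono finite_degrees degrees_mono)
    next
      case (Suc k)
      have "card (degrees N (I k)) < card (degrees N (I (Suc k)))"
      proof (rule card_degrees_strict)
        have "k \<le> n" "k < n" using Suc.prems by simp_all
        then show "ideal (I k) R" "I k \<subset> I (Suc k)" "vanishing D N \<subseteq> I k"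
          using I J(2) by blast+
        show "ideal (I (Suc k)) R" using I Suc.prems by blast
      qed
      then show ?case using Suc by simp
    qed
    from this[of n] have "n + card (degrees N J) \<le> card (degrees N (I n))" by simp
    also have "\<dots> \<le> card (degrees N S)"
      using I(1) ideal_memD(1) by (intro card_mono finite_degrees degrees_mono) auto
    finally show "enat n \<le> enat (card (degrees N S) - card (degrees N J))" by simp
  qed
  obtain n I where I: "\<forall>i\<le>n. ideal (I i) R \<and> J \<subseteq> I i" "\<forall>i<n. I i \<subset> I (Suc i)"
      "card (degrees N S) \<le> n + card (degrees N J)"
    using exists_long_chain[OF J] by blast
  have "enat n \<le> colength R J"
    unfolding colength_def
    by (rule Sup_upper, rule CollectI, rule exI[of _ n], rule conjI, rule refl, rule exI[of _ I],
        rule conjI[OF I(1,2)])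
  moreover have "enat (card (degrees N S) - card (degrees N J)) \<le> enat n" using I(3) by simp
  ultimately show "enat (card (degrees N S) - card (degrees N J)) \<le> colength R J"
    by (rule order_trans[rotated])
qed

text \<open>
  The inclusions \<open>D\<^sup>n\<^sup>0\<^sup>+\<^sup>n \<subseteq> m\<^sup>n \<subseteq> D\<^sup>n\<close> place the length of \<open>S / m\<^sup>n\<close> within \<open>n0 * degree D\<close> of
  \<open>n * degree D\<close>.
\<close>

theorem has_multiplicity_degree: "has_multiplicity R (degree D)"
proof -
  define l where "l n = card (degrees (n0 + n) S) - card (degrees (n0 + n) (ideal_power R m n))" for n
  have len: "colength R (ideal_power R m n) = enat (l n)" for n
    unfolding l_def by (rule colength_eq[OF ideal_power_m vanishing_subset_ideal_power])
  have upper: "l n \<le> (n0 + n) * degree D" for n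
    unfolding l_def using card_degrees_le[of "n0 + n" S] by simp
  have lower: "n * degree D \<le> l n + n0 * degree D" for n
  proof -
    have "n * degree D = card (degrees (n0 + n) (vanishing D n0))" by (simp add: card_degrees_vanishing)
    also have "\<dots> \<le> card (degrees (n0 + n) S)"
      by (intro card_mono finite_degrees degrees_mono conductor)
    finally have 1: "n * degree D \<le> card (degrees (n0 + n) S)" .
    have "card (degrees (n0 + n) (ideal_power R m n)) \<le> card (degrees (n0 + n) (vanishing D n))"
      by (intro card_mono finite_degrees degrees_mono ideal_power_subset)
    also have "\<dots> = n0 * degree D" by (simp add: card_degrees_vanishing)
    finally show ?thesis using 1 unfolding l_def by linarith
  qed
  have "(\<lambda>n. real (l n) / real n) \<longlonglongrightarrow> real (degree D)"
    by (rule tendsto_slope[where c = "n0 * degree D"])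
      (use lower upper in \<open>simp_all add: distrib_right add.commute\<close>)
  then have lim: "(\<lambda>n. fact 1 * real (l n) / real n ^ 1) \<longlonglongrightarrow> real (degree D)" by simp
  have "\<forall>n. colength R (ideal_power R m n) = enat (l n)" using len by blast
  note facts = local_with_maximal_m krull_dim_eq this lim
  show ?thesis
    unfolding has_multiplicity_def
    by (rule exI[of _ m], rule exI[of _ 1], rule exI[of _ l]) (intro conjI facts)
qed

end


section \<open>Isomorphic rings have the same multiplicity\<close>

locale ring_isomorphism = R: cring R + S: cring S
  for R :: "('a, 'm) ring_scheme" and S :: "('b, 'n) ring_scheme" +
  fixes h
  assumes iso: "h \<in> ring_iso R S"
begin

sublocale hom: ring_hom_ring R S h
  using iso unfolding ring_iso_def by (intro ring_hom_ringI2 R.ring_axioms S.ring_axioms) simp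

lemma bij: "bij_betw h (carrier R) (carrier S)"
  using iso unfolding ring_iso_def by simp

lemma inj: "inj_on h (carrier R)" and surj: "h ` carrier R = carrier S"
  using bij unfolding bij_betw_def by auto

lemma inverse: "ring_isomorphism S R (inv_into (carrier R) h)"
  by (intro ring_isomorphism.intro ring_isomorphism_axioms.intro ring_iso_set_sym
      S.is_cring R.is_cring R.ring_axioms iso)

lemma inverse_image: "A \<subseteq> carrier R \<Longrightarrow> inv_into (carrier R) h ` (h ` A) = A"
  by (rule inv_into_image_cancel[OF inj])

lemma image_inverse: "B \<subseteq> carrier S \<Longrightarrow> h ` (inv_into (carrier R) h ` B) = B"
  using image_inv_into_cancel[OF surj] .

lemma ideal_image: assumes "ideal I R" shows "ideal (h ` I) S"
proof -
  interpret I: ideal I R by (rule assms)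
  have sub: "I \<subseteq> carrier R" by (rule I.a_subset)
  show ?thesis
  proof (rule idealI[OF S.ring_axioms])
    show "subgroup (h ` I) (add_monoid S)"
    proof (rule S.add.subgroupI)
      show "h ` I \<subseteq> carrier S" using sub surj by blast
      show "h ` I \<noteq> {}" using I.zero_closed by blast
    next
      fix y assume "y \<in> h ` I"
      then obtain x where x: "x \<in> I" "y = h x" by blast
      then have "\<ominus>\<^bsub>S\<^esub> y = h (\<ominus>\<^bsub>R\<^esub> x)" using sub by auto
      then show "\<ominus>\<^bsub>S\<^esub> y \<in> h ` I" using I.a_inv_closed[OF x(1)] by simp
    next
      fix y y' assume "y \<in> h ` I" "y' \<in> h ` I"
      then obtain x x' where x: "x \<in> I" "y = h x" "x' \<in> I" "y' = h x'" by blast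
      then have "y \<oplus>\<^bsub>S\<^esub> y' = h (x \<oplus>\<^bsub>R\<^esub> x')" using sub by auto
      then show "y \<oplus>\<^bsub>S\<^esub> y' \<in> h ` I" using I.a_closed[OF x(1,3)] by simp
    qed
  next
    fix y z assume "y \<in> h ` I" "z \<in> carrier S"
    then obtain x w where x: "x \<in> I" "y = h x" "w \<in> carrier R" "z = h w" using surj by blast
    then have "z \<otimes>\<^bsub>S\<^esub> y = h (w \<otimes>\<^bsub>R\<^esub> x)" using sub by auto
    then show "z \<otimes>\<^bsub>S\<^esub> y \<in> h ` I" using I.I_l_closed[OF x(1,3)] by simp
    have "y \<otimes>\<^bsub>S\<^esub> z = h (x \<otimes>\<^bsub>R\<^esub> w)" using sub x by auto
    then show "y \<otimes>\<^bsub>S\<^esub> z \<in> h ` I" using I.I_r_closed[OF x(1,3)] by simp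
  qed
qed

lemma image_eq_carrier: "A \<subseteq> carrier R \<Longrightarrow> h ` A = carrier S \<Longrightarrow> A = carrier R"
  using inverse_image[of A] inverse_image[of "carrier R"] surj by simp

lemma image_psubset: "A \<subset> B \<Longrightarrow> B \<subseteq> carrier R \<Longrightarrow> h ` A \<subset> h ` B"
  using inverse_image[of A] inverse_image[of B] by (metis image_mono order.strict_iff_order subset_trans)

lemma mem_image_iff: "A \<subseteq> carrier R \<Longrightarrow> x \<in> carrier R \<Longrightarrow> h x \<in> h ` A \<longleftrightarrow> x \<in> A"
  using inj_on_image_mem_iff[OF inj] by blast

lemma primeideal_image: assumes "primeideal I R" shows "primeideal (h ` I) S"
proof (rule primeidealI)
  interpret I: primeideal I R by (rule assms)
  show "ideal (h ` I) S" by (rule ideal_image[OF I.is_ideal])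
  show "carrier S \<noteq> h ` I" using image_eq_carrier[OF I.a_subset] I.I_notcarr by metis
  fix y y' assume y: "y \<in> carrier S" "y' \<in> carrier S" "y \<otimes>\<^bsub>S\<^esub> y' \<in> h ` I"
  then obtain x x' where x: "x \<in> carrier R" "y = h x" "x' \<in> carrier R" "y' = h x'"
    unfolding surj[symmetric] by blast
  then have "h (x \<otimes>\<^bsub>R\<^esub> x') \<in> h ` I" using y(3) by simp
  then have "x \<otimes>\<^bsub>R\<^esub> x' \<in> I"
    by (simp only: mem_image_iff[OF I.a_subset R.m_closed[OF x(1,3)]])
  then show "y \<in> h ` I \<or> y' \<in> h ` I" using I.I_prime x by blast
qed (rule S.is_cring)

lemma prime_height_le: "prime_height R P \<le> prime_height S (h ` P)"
  unfolding prime_height_def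
proof (rule Sup_least, clarify)
  fix n and p :: "nat \<Rightarrow> 'a set"
  assume p: "\<forall>i\<le>n. primeideal (p i) R" "\<forall>i<n. p i \<subset> p (Suc i)"
  have "primeideal (h ` p i) S" if "i \<le> n" for i using primeideal_image p(1) that by blast
  moreover have "h ` p i \<subset> h ` p (Suc i)" if "i < n" for i
  proof (rule image_psubset)
    show "p i \<subset> p (Suc i)" using p(2) that by blast
    have "primeideal (p (Suc i)) R" using p(1) that by simp
    then show "p (Suc i) \<subseteq> carrier R"
      using additive_subgroup.a_subset[OF ideal.axioms(1)[OF primeideal.axioms(1)]] by blast
  qed
  ultimately show "enat n \<le> Sup {enat na |na. \<exists>q. (\<forall>i\<le>na. primeideal (q i) S) \<and>
      (\<forall>i<na. q i \<subset> q (Suc i)) \<and> q na = h ` p n}"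
    by (intro Sup_upper CollectI exI[of _ n] conjI refl exI[of _ "\<lambda>i. h ` p i"]) simp_all
qed

lemma krull_dim_le: "krull_dim R \<le> krull_dim S"
  unfolding krull_dim_def
proof (rule Sup_least, clarify)
  fix P assume "primeideal P R"
  then show "prime_height R P \<le> Sup (prime_height S ` {P. primeideal P S})"
    using prime_height_le[of P] primeideal_image[of P] by (intro Sup_upper2) auto
qed

lemma colength_le: "colength R J \<le> colength S (h ` J)"
  unfolding colength_def
proof (rule Sup_least, clarify)
  fix n and I :: "nat \<Rightarrow> 'a set"
  assume I: "\<forall>i\<le>n. ideal (I i) R \<and> J \<subseteq> I i" "\<forall>i<n. I i \<subset> I (Suc i)"
  have "ideal (h ` I i) S \<and> h ` J \<subseteq> h ` I i" if "i \<le> n" for i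
    using I(1) that ideal_image by (meson image_mono)
  moreover have "h ` I i \<subset> h ` I (Suc i)" if "i < n" for i
  proof (rule image_psubset)
    show "I i \<subset> I (Suc i)" using I(2) that by blast
    have "ideal (I (Suc i)) R" using I(1) that by simp
    then show "I (Suc i) \<subseteq> carrier R" using additive_subgroup.a_subset[OF ideal.axioms(1)] by blast
  qed
  ultimately show "enat n \<le> Sup {enat na |na. \<exists>q. (\<forall>i\<le>na. ideal (q i) S \<and> h ` J \<subseteq> q i) \<and>
      (\<forall>i<na. q i \<subset> q (Suc i))}"
    by (intro Sup_upper CollectI exI[of _ n] conjI refl exI[of _ "\<lambda>i. h ` I i"]) simp_all
qed

lemma maximalideal_image: assumes "maximalideal M R" shows "maximalideal (h ` M) S"
proof (rule maximalidealI)
  interpret M: maximalideal M R by (rule assms)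
  interpret inv: ring_isomorphism S R "inv_into (carrier R) h" by (rule inverse)
  show "ideal (h ` M) S" by (rule ideal_image[OF M.is_ideal])
  show "carrier S \<noteq> h ` M" using image_eq_carrier[OF M.a_subset] M.I_notcarr by metis
  fix J assume J: "ideal J S" "h ` M \<subseteq> J" "J \<subseteq> carrier S"
  let ?J = "inv_into (carrier R) h ` J"
  have "ideal ?J R" by (rule inv.ideal_image[OF J(1)])
  moreover have "M \<subseteq> ?J" using image_mono[OF J(2), of "inv_into (carrier R) h"] inverse_image[OF M.a_subset] by simp
  moreover have "?J \<subseteq> carrier R" using image_mono[OF J(3), of "inv_into (carrier R) h"] inv.surj by simp
  ultimately have "?J = M \<or> ?J = carrier R" by (rule M.I_maximal)
  then show "J = h ` M \<or> J = carrier S" using image_inverse[OF J(3)] surj by metis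
qed

lemma ideal_prod_image:
  assumes "I \<subseteq> carrier R" "J \<subseteq> carrier R"
  shows "h ` (I \<cdot>\<^bsub>R\<^esub> J) = h ` I \<cdot>\<^bsub>S\<^esub> h ` J"
proof -
  have carr: "x \<in> I \<cdot>\<^bsub>R\<^esub> J \<Longrightarrow> x \<in> carrier R" for x
    by (induction rule: ideal_prod.induct) (use assms in auto)
  have 1: "h x \<in> h ` I \<cdot>\<^bsub>S\<^esub> h ` J" if "x \<in> I \<cdot>\<^bsub>R\<^esub> J" for x
    using that
  proof (induction rule: ideal_prod.induct)
    case (prod i j)
    then have "h (i \<otimes>\<^bsub>R\<^esub> j) = h i \<otimes>\<^bsub>S\<^esub> h j"
      by (intro hom.hom_mult subsetD[OF assms(1)] subsetD[OF assms(2)])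
    then show ?case using prod ideal_prod.prod[of "h i" "h ` I" "h j" "h ` J" S] by simp
  next
    case (sum x y)
    then have "h (x \<oplus>\<^bsub>R\<^esub> y) = h x \<oplus>\<^bsub>S\<^esub> h y" by (intro hom.hom_add carr)
    then show ?case using sum ideal_prod.sum[of "h x" S "h ` I" "h ` J" "h y"] by simp
  qed
  have 2: "y \<in> h ` (I \<cdot>\<^bsub>R\<^esub> J)" if "y \<in> h ` I \<cdot>\<^bsub>S\<^esub> h ` J" for y
    using that
  proof (induction rule: ideal_prod.induct)
    case (prod i j)
    then obtain i' j' where *: "i = h i'" "i' \<in> I" "j = h j'" "j' \<in> J" by blast
    have "h (i' \<otimes>\<^bsub>R\<^esub> j') = h i' \<otimes>\<^bsub>S\<^esub> h j'"
      by (intro hom.hom_mult subsetD[OF assms(1)] subsetD[OF assms(2)] *)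
    then have "i \<otimes>\<^bsub>S\<^esub> j = h (i' \<otimes>\<^bsub>R\<^esub> j')" using * by simp
    then show ?case using ideal_prod.prod[OF *(2,4), of R] by simp
  next
    case (sum x y)
    then obtain x' y' where *: "x = h x'" "x' \<in> I \<cdot>\<^bsub>R\<^esub> J" "y = h y'" "y' \<in> I \<cdot>\<^bsub>R\<^esub> J" by blast
    have "h (x' \<oplus>\<^bsub>R\<^esub> y') = h x' \<oplus>\<^bsub>S\<^esub> h y'" by (intro hom.hom_add carr *)
    then have "x \<oplus>\<^bsub>S\<^esub> y = h (x' \<oplus>\<^bsub>R\<^esub> y')" using * by simp
    then show ?case using ideal_prod.sum[OF *(2,4)] by simp
  qed
  show ?thesis using 1 2 by (intro equalityI subsetI) auto
qed

lemma ideal_power_image: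
  assumes "ideal I R"
  shows "ideal (ideal_power R I n) R \<and> h ` ideal_power R I n = ideal_power S (h ` I) n"
proof (induction n)
  case 0
  then show ?case using R.oneideal surj by simp
next
  case (Suc n)
  then have "ideal (ideal_power R I n) R" by simp
  then have "ideal (ideal_power R I (Suc n)) R" using R.ideal_prod_is_ideal[OF _ assms] by simp
  moreover have "h ` ideal_power R I (Suc n) = h ` ideal_power R I n \<cdot>\<^bsub>S\<^esub> h ` I"
    unfolding ideal_power.simps
    by (intro ideal_prod_image additive_subgroup.a_subset ideal.axioms(1) assms
        \<open>ideal (ideal_power R I n) R\<close>)
  ultimately show ?case using Suc by simp
qed

lemma has_multiplicity_transfer:
  assumes "has_multiplicity R e" shows "has_multiplicity S e"
proof -
  interpret inv: ring_isomorphism S R "inv_into (carrier R) h" by (rule inverse)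
  obtain m r l where m: "local_with_maximal R m" and r: "krull_dim R = enat r"
    and l: "\<And>n. colength R (ideal_power R m n) = enat (l n)"
    and lim: "(\<lambda>n. fact r * real (l n) / real n ^ r) \<longlonglongrightarrow> real e"
    using assms unfolding has_multiplicity_def by metis
  have max: "maximalideal M R \<longleftrightarrow> M = m" for M using m unfolding local_with_maximal_def by simp
  then have mm: "maximalideal m R" by simp
  then have id: "ideal m R" by (rule maximalideal.axioms(1))
  have "maximalideal M S \<longleftrightarrow> M = h ` m" for M
  proof
    assume M: "maximalideal M S"
    then have "inv_into (carrier R) h ` M = m" by (intro max[THEN iffD1] inv.maximalideal_image)
    moreover have "M \<subseteq> carrier S"
      by (rule additive_subgroup.a_subset[OF ideal.axioms(1)[OF maximalideal.axioms(1)[OF M]]])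
    ultimately show "M = h ` m" using image_inverse by metis
  next
    show "M = h ` m \<Longrightarrow> maximalideal M S" using maximalideal_image[OF mm] by simp
  qed
  then have loc: "local_with_maximal S (h ` m)"
    unfolding local_with_maximal_def using S.is_cring by (intro conjI allI)
  have kd: "krull_dim S = enat r"
    using antisym[OF krull_dim_le inv.krull_dim_le] r by simp
  have len: "\<forall>n. colength S (ideal_power S (h ` m) n) = enat (l n)"
  proof
    fix n
    let ?I = "ideal_power R m n"
    have I: "ideal ?I R" "h ` ?I = ideal_power S (h ` m) n" using ideal_power_image[OF id, of n] by simp_all
    have "?I \<subseteq> carrier R" by (rule additive_subgroup.a_subset[OF ideal.axioms(1)[OF I(1)]])
    then have "colength S (h ` ?I) \<le> colength R ?I"
      using inv.colength_le[of "h ` ?I"] inverse_image[of ?I] by simp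
    then have "colength S (h ` ?I) = colength R ?I" using colength_le[of ?I] by (rule antisym)
    then show "colength S (ideal_power S (h ` m) n) = enat (l n)" using I(2) l by simp
  qed
  show ?thesis unfolding has_multiplicity_def
    by (rule exI[of _ "h ` m"], rule exI[of _ r], rule exI[of _ l]) (intro conjI loc kd len lim)
qed

end


section \<open>Bihomogeneous forms\<close>

lemma finite_exponents: "finite {\<alpha> :: 'n::finite \<Rightarrow> nat. sum \<alpha> UNIV = m}"
proof (rule finite_subset)
  show "{\<alpha> :: 'n \<Rightarrow> nat. sum \<alpha> UNIV = m} \<subseteq> PiE UNIV (\<lambda>_. {..m})"
    by (auto intro: member_le_sum)
  show "finite (PiE (UNIV :: 'n set) (\<lambda>_. {..m}))" by (rule finite_PiE) auto
qed

lemma biform_zero: "biform m n (\<lambda>v w. 0)"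
  unfolding biform_def by (rule exI[of _ "\<lambda>_ _. 0"]) simp

lemma biform_add: "biform m n F \<Longrightarrow> biform m n G \<Longrightarrow> biform m n (\<lambda>v w. F v w + G v w)"
  unfolding biform_def
proof (elim exE)
  fix c c'
  assume *: "\<forall>v w. F v w = (\<Sum>\<alpha> | sum \<alpha> UNIV = m. \<Sum>\<beta> | sum \<beta> UNIV = n.
      c \<alpha> \<beta> * monomial_fun \<alpha> v * monomial_fun \<beta> w)"
    "\<forall>v w. G v w = (\<Sum>\<alpha> | sum \<alpha> UNIV = m. \<Sum>\<beta> | sum \<beta> UNIV = n.
      c' \<alpha> \<beta> * monomial_fun \<alpha> v * monomial_fun \<beta> w)"
  show "\<exists>c. \<forall>v w. F v w + G v w = (\<Sum>\<alpha> | sum \<alpha> UNIV = m. \<Sum>\<beta> | sum \<beta> UNIV = n.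
      c \<alpha> \<beta> * monomial_fun \<alpha> v * monomial_fun \<beta> w)"
    unfolding *[rule_format]
    by (rule exI[of _ "\<lambda>\<alpha> \<beta>. c \<alpha> \<beta> + c' \<alpha> \<beta>"]) (simp add: distrib_right sum.distrib)
qed

lemma biform_scale: "biform m n F \<Longrightarrow> biform m n (\<lambda>v w. a * F v w)"
  unfolding biform_def
proof (elim exE)
  fix c
  assume *: "\<forall>v w. F v w = (\<Sum>\<alpha> | sum \<alpha> UNIV = m. \<Sum>\<beta> | sum \<beta> UNIV = n.
      c \<alpha> \<beta> * monomial_fun \<alpha> v * monomial_fun \<beta> w)"
  show "\<exists>c. \<forall>v w. a * F v w = (\<Sum>\<alpha> | sum \<alpha> UNIV = m. \<Sum>\<beta> | sum \<beta> UNIV = n.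
      c \<alpha> \<beta> * monomial_fun \<alpha> v * monomial_fun \<beta> w)"
    unfolding *[rule_format]
    by (rule exI[of _ "\<lambda>\<alpha> \<beta>. a * c \<alpha> \<beta>"]) (simp add: sum_distrib_left mult.assoc)
qed

lemma biform_diff: "biform m n F \<Longrightarrow> biform m n G \<Longrightarrow> biform m n (\<lambda>v w. F v w - G v w)"
  using biform_add[OF _ biform_scale[of m n G "- 1"], of F] by simp

lemma biform_sum:
  "(\<And>i. i \<in> A \<Longrightarrow> biform m n (F i)) \<Longrightarrow> biform m n (\<lambda>v w. \<Sum>i\<in>A. F i v w)"
  by (induction A rule: infinite_finite_induct) (simp_all add: biform_zero biform_add)

lemma biform_monomial:
  fixes \<alpha> :: "'n::finite \<Rightarrow> nat" and \<beta> :: "'m::finite \<Rightarrow> nat"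
  assumes "sum \<alpha> UNIV = m" "sum \<beta> UNIV = n"
  shows "biform m n (\<lambda>(v :: 'k::field ^ 'n) (w :: 'k ^ 'm). monomial_fun \<alpha> v * monomial_fun \<beta> w)"
  unfolding biform_def
proof (intro exI allI)
  fix v :: "'k ^ 'n" and w :: "'k ^ 'm"
  have "(\<Sum>\<alpha>' | sum \<alpha>' UNIV = m. \<Sum>\<beta>' | sum \<beta>' UNIV = n.
      (if \<alpha>' = \<alpha> then if \<beta>' = \<beta> then 1 else 0 else 0) * monomial_fun \<alpha>' v * monomial_fun \<beta>' w)
    = (\<Sum>\<alpha>' | sum \<alpha>' UNIV = m. if \<alpha>' = \<alpha> then (\<Sum>\<beta>' | sum \<beta>' UNIV = n.
        if \<beta>' = \<beta> then monomial_fun \<alpha> v * monomial_fun \<beta> w else 0) else 0)"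
    by (intro sum.cong refl) (auto intro!: sum.cong)
  also have "\<dots> = monomial_fun \<alpha> v * monomial_fun \<beta> w"
    using assms by (simp add: finite_exponents)
  finally show "monomial_fun \<alpha> v * monomial_fun \<beta> w = (\<Sum>\<alpha>' | sum \<alpha>' UNIV = m. \<Sum>\<beta>' | sum \<beta>' UNIV = n.
      (if \<alpha>' = \<alpha> then if \<beta>' = \<beta> then 1 else 0 else 0) * monomial_fun \<alpha>' v * monomial_fun \<beta>' w)"
    by (rule sym)
qed

lemma biform_induct [consumes 1, case_names zero add scale monomial]:
  assumes F: "biform m n F"
    and zero: "Q (\<lambda>v w. 0)"
    and add: "\<And>F G. Q F \<Longrightarrow> Q G \<Longrightarrow> Q (\<lambda>v w. F v w + G v w)"
    and scale: "\<And>a F. Q F \<Longrightarrow> Q (\<lambda>v w. a * F v w)"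
    and mono: "\<And>\<alpha> \<beta>. sum \<alpha> UNIV = m \<Longrightarrow> sum \<beta> UNIV = n \<Longrightarrow>
      Q (\<lambda>v w. monomial_fun \<alpha> v * monomial_fun \<beta> w)"
  shows "Q F"
proof -

  obtain c where c: "\<And>v w. F v w = (\<Sum>\<alpha> | sum \<alpha> UNIV = m. \<Sum>\<beta> | sum \<beta> UNIV = n.
      c \<alpha> \<beta> * monomial_fun \<alpha> v * monomial_fun \<beta> w)"
    using F unfolding biform_def by blast
  have F_eq: "F = (\<lambda>v w. \<Sum>\<alpha> | sum \<alpha> UNIV = m. \<Sum>\<beta> | sum \<beta> UNIV = n.
      c \<alpha> \<beta> * (monomial_fun \<alpha> v * monomial_fun \<beta> w))"
    by (intro ext) (simp add: c mult.assoc)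
  have fin: "Q (\<lambda>v w. \<Sum>\<alpha>\<in>A. \<Sum>\<beta>\<in>B. c \<alpha> \<beta> * (monomial_fun \<alpha> v * monomial_fun \<beta> w))"
      if "A \<subseteq> {\<alpha>. sum \<alpha> UNIV = m}" "B \<subseteq> {\<beta>. sum \<beta> UNIV = n}" for A B
    proof -
      have inner: "Q (\<lambda>v w. \<Sum>\<beta>\<in>B. c \<alpha> \<beta> * (monomial_fun \<alpha> v * monomial_fun \<beta> w))"
        if "\<alpha> \<in> A" for \<alpha>
        using \<open>B \<subseteq> _\<close>
      proof (induction B rule: infinite_finite_induct)
        case (insert \<beta> B)
        then show ?case using that \<open>A \<subseteq> _\<close> by (auto intro!: add scale mono)
      qed (simp_all add: zero)
      show ?thesis using inner
        by (induction A rule: infinite_finite_induct) (simp_all add: zero add)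
    qed
  show ?thesis unfolding F_eq by (rule fin) simp_all
qed

lemma monomial_fun_add:
  "monomial_fun (\<lambda>i. \<alpha> i + \<alpha>' i) v = monomial_fun \<alpha> v * monomial_fun \<alpha>' v"
  unfolding monomial_fun_def by (simp add: power_add prod.distrib)

lemma biform_mult:
  assumes "biform m n F" "biform m' n' G"
  shows "biform (m + m') (n + n') (\<lambda>v w. F v w * G v w)"
  using assms(1)
proof (induction rule: biform_induct)
  case (monomial \<alpha> \<beta>)
  show ?case using assms(2)
  proof (induction rule: biform_induct)
    case (monomial \<alpha>' \<beta>')
    have "biform (m + m') (n + n') (\<lambda>v w. monomial_fun (\<lambda>i. \<alpha> i + \<alpha>' i) v * monomial_fun (\<lambda>i. \<beta> i + \<beta>' i) w)"
      using monomial \<open>sum \<alpha> UNIV = m\<close> \<open>sum \<beta> UNIV = n\<close> by (intro biform_monomial) (simp_all add: sum.distrib)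
    then show ?case by (simp add: monomial_fun_add ac_simps)
  next
    case (add F G)
    then show ?case by (simp add: distrib_left biform_add)
  next
    case (scale a F)
    then show ?case using biform_scale[OF scale, of a] by (simp add: ac_simps)
  qed (simp add: biform_zero)
next
  case (add F G)
  then show ?case by (simp add: distrib_right biform_add)
next
  case (scale a F)
  then show ?case using biform_scale[OF scale, of a] by (simp add: ac_simps)
qed (simp add: biform_zero)

lemma monomial_fun_zero [simp]: "monomial_fun (\<lambda>_. 0) v = 1"
  unfolding monomial_fun_def by simp

lemma monomial_fun_single [simp]: "monomial_fun (\<lambda>j. if j = i then 1 else 0) v = v $ i"
  unfolding monomial_fun_def by (simp add: if_distrib[of "\<lambda>n. _ ^ n"] cong: if_cong)

lemma biform_const: "biform 0 0 (\<lambda>v w. c)"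
  using biform_scale[OF biform_monomial[of "\<lambda>_. 0" 0 "\<lambda>_. 0" 0], of c] by simp

lemma biform_fst: "biform 1 0 (\<lambda>v w. v $ i)"
  using biform_monomial[of "\<lambda>j. if j = i then 1 else 0" 1 "\<lambda>_. 0" 0] by simp

lemma biform_snd: "biform 0 1 (\<lambda>v w. w $ i)"
  using biform_monomial[of "\<lambda>_. 0" 0 "\<lambda>j. if j = i then 1 else 0" 1] by simp

lemma biform_power: "biform m n F \<Longrightarrow> biform (k * m) (k * n) (\<lambda>v w. F v w ^ k)"
  by (induction k) (use biform_const[of 1] biform_mult[of m n F] in \<open>simp_all\<close>)

lemma form_imp_biform:
  assumes "form m F" shows "biform m 0 (\<lambda>v w. F v)"
proof -
  obtain c where c: "\<And>v. F v = (\<Sum>\<alpha> | sum \<alpha> UNIV = m. c \<alpha> * monomial_fun \<alpha> v)"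
    using assms unfolding form_def by blast
  have "biform m 0 (\<lambda>v w. c \<alpha> * monomial_fun \<alpha> v)" if "sum \<alpha> UNIV = m" for \<alpha>
    using biform_scale[OF biform_monomial[of \<alpha> m "\<lambda>_. 0" 0], of "c \<alpha>"] that by simp
  then show ?thesis unfolding c by (intro biform_sum) simp
qed

lemma monomial_fun_scale: "monomial_fun \<alpha> (c *s v) = c ^ sum \<alpha> UNIV * monomial_fun \<alpha> v"
  unfolding monomial_fun_def by (simp add: power_mult_distrib prod.distrib power_sum)

lemma biform_homogeneous:
  assumes "biform m n F" shows "F (c *s v) (c' *s w) = c ^ m * c' ^ n * F v w"
  using assms
proof (induction rule: biform_induct)
  case (monomial \<alpha> \<beta>)
  then show ?case by (simp add: monomial_fun_scale)
qed (simp_all add: algebra_simps)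


section \<open>Pulling forms back along a parametrized curve\<close>

lemma infinite_UNIV_alg_closed: "infinite (UNIV :: 'k::alg_closed_field set)"
proof
  assume fin: "finite (UNIV :: 'k set)"
  define p :: "'k poly" where "p = (\<Prod>a\<in>UNIV. [:- a, 1:])"
  have "degree p = card (UNIV :: 'k set)"
    unfolding p_def by (subst degree_prod_eq_sum_degree) auto
  then have "0 < degree (p + 1)" using fin by (subst degree_add_eq_left) (auto simp: finite_UNIV_card_ge_0)
  then obtain x where "poly (p + 1) x = 0" using alg_closed_imp_poly_has_root by blast
  moreover have "poly p x = 0" unfolding p_def poly_prod using fin by (intro prod_zero) (auto intro!: bexI[of _ x])
  ultimately show False by simp
qed

lemma poly_zero_if_cofinite_zero:
  fixes p :: "'k::alg_closed_field poly"
  assumes "\<And>s. s \<notin> A \<Longrightarrow> poly p s = 0" "finite A"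
  shows "p = 0"
proof (rule ccontr)
  assume "p \<noteq> 0"
  then have "finite {s. poly p s = 0}" by (rule poly_roots_finite)
  then have "finite (A \<union> {s. poly p s = 0})" using assms(2) by simp
  moreover have "A \<union> {s. poly p s = 0} = UNIV" using assms(1) by blast
  ultimately show False using infinite_UNIV_alg_closed by metis
qed

lemma poly_ext: "(\<And>s. poly p s = poly q s) \<Longrightarrow> p = (q :: 'k::alg_closed_field poly)"
  using poly_zero_if_cofinite_zero[of "{}" "p - q"] by simp

definition eval_vec :: "'k::field poly ^ 'n \<Rightarrow> 'k \<Rightarrow> 'k ^ 'n" where
  "eval_vec g s = (\<chi> i. poly (g $ i) s)"

text \<open>
  Forms are functions, so the pullback is the polynomial with the right values; over an infinite field
  it is unique, and identities between pullbacks are checked pointwise.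
\<close>

definition pullback ::
  "'k::field poly ^ 'n \<Rightarrow> 'k poly ^ 'm \<Rightarrow> ('k ^ 'n \<Rightarrow> 'k ^ 'm \<Rightarrow> 'k) \<Rightarrow> 'k poly" where
  "pullback g w F = (THE p. \<forall>s. poly p s = F (eval_vec g s) (eval_vec w s))"

lemma pullback_eqI:
  fixes p :: "'k::alg_closed_field poly"
  assumes "\<And>s. poly p s = F (eval_vec g s) (eval_vec w s)"
  shows "pullback g w F = p"
  unfolding pullback_def by (rule the_equality) (use assms in \<open>auto intro: poly_ext\<close>)

definition is_pullback where
  "is_pullback g w F p \<longleftrightarrow> (\<forall>s. poly p s = F (eval_vec g s) (eval_vec w s))"

lemma dvd_diff_mult:
  fixes E :: "'a::comm_ring_1"
  assumes "E dvd x - y" "E dvd x' - y'" shows "E dvd x * x' - y * y'"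
proof -
  have "x * x' - y * y' = (x - y) * x' + y * (x' - y')" by (simp add: algebra_simps)
  then show ?thesis using assms by simp
qed

lemma dvd_diff_power: "(E :: 'a::comm_ring_1) dvd x - y \<Longrightarrow> E dvd x ^ n - y ^ n"
  by (induction n) (auto intro: dvd_diff_mult)

lemma dvd_diff_prod:
  fixes E :: "'a::comm_ring_1"
  shows "(\<And>i. i \<in> A \<Longrightarrow> E dvd x i - y i) \<Longrightarrow> E dvd prod x A - prod y A"
  by (induction A rule: infinite_finite_induct) (auto intro: dvd_diff_mult)

lemma monomial_pullback:
  fixes g :: "'k::field poly ^ 'n::finite" and \<alpha> :: "'n \<Rightarrow> nat"
  defines "p \<equiv> (\<Prod>i\<in>UNIV. (g $ i) ^ \<alpha> i)"
  shows "poly p s = monomial_fun \<alpha> (eval_vec g s)"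
    and "(\<And>i. degree (g $ i) \<le> d) \<Longrightarrow> degree p \<le> sum \<alpha> UNIV * d"
    and "(\<And>i. E dvd g $ i - \<mu> * [:v $ i:]) \<Longrightarrow> E dvd p - \<mu> ^ sum \<alpha> UNIV * [:monomial_fun \<alpha> v:]"
proof -
  show "poly p s = monomial_fun \<alpha> (eval_vec g s)"
    unfolding p_def monomial_fun_def eval_vec_def by (simp add: poly_prod)
  show "degree p \<le> sum \<alpha> UNIV * d" if "\<And>i. degree (g $ i) \<le> d"
  proof -
    have "degree p \<le> (\<Sum>i\<in>UNIV. degree ((g $ i) ^ \<alpha> i))"
      using degree_prod_sum_le[of UNIV "\<lambda>i. (g $ i) ^ \<alpha> i"] unfolding p_def by simp
    also have "\<dots> \<le> (\<Sum>i\<in>UNIV. \<alpha> i * d)"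
    proof (rule sum_mono)
      fix i
      have "degree ((g $ i) ^ \<alpha> i) \<le> degree (g $ i) * \<alpha> i" by (rule degree_power_le)
      also have "\<dots> \<le> \<alpha> i * d" using that[of i] by (simp add: mult.commute)
      finally show "degree ((g $ i) ^ \<alpha> i) \<le> \<alpha> i * d" .
    qed
    finally show ?thesis by (simp add: sum_distrib_right)
  qed
  show "E dvd p - \<mu> ^ sum \<alpha> UNIV * [:monomial_fun \<alpha> v:]" if "\<And>i. E dvd g $ i - \<mu> * [:v $ i:]"
  proof -
    have "[:\<Prod>i\<in>A. f i:] = (\<Prod>i\<in>A. [:f i:])" for A and f :: "'n \<Rightarrow> 'k"
    proof (induction A rule: infinite_finite_induct)
      case (insert x A)
      then show ?case by (simp flip: insert.IH)
    qed (simp_all add: one_pCons)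
    then have const: "[:monomial_fun \<alpha> v:] = (\<Prod>i\<in>UNIV. [:v $ i:] ^ \<alpha> i)"
      unfolding monomial_fun_def by (simp only: poly_const_pow)
    have "(\<Prod>i\<in>UNIV. (\<mu> * [:v $ i:]) ^ \<alpha> i) = (\<Prod>i\<in>UNIV. \<mu> ^ \<alpha> i) * (\<Prod>i\<in>UNIV. [:v $ i:] ^ \<alpha> i)"
      unfolding power_mult_distrib by (rule prod.distrib)
    also have "(\<Prod>i\<in>UNIV. \<mu> ^ \<alpha> i) = \<mu> ^ sum \<alpha> UNIV" by (rule power_sum[symmetric])
    finally have "\<mu> ^ sum \<alpha> UNIV * [:monomial_fun \<alpha> v:] = (\<Prod>i\<in>UNIV. (\<mu> * [:v $ i:]) ^ \<alpha> i)"
      unfolding const by (rule sym)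
    then show ?thesis unfolding p_def by (simp only:) (intro dvd_diff_prod dvd_diff_power that)
  qed
qed

text \<open>
  If the parametrization is congruent to multiples of a fixed point modulo \<open>E\<close>, then so is every pullback
  to a multiple of the value at that point.
\<close>

lemma pullback_exists:
  fixes g :: "'k::alg_closed_field poly ^ 'n::finite" and w :: "'k poly ^ 'm::finite"
  assumes F: "biform m n F"
    and deg: "\<And>i. degree (g $ i) \<le> d" "\<And>j. degree (w $ j) \<le> \<delta>"
    and cong: "\<And>i. E dvd g $ i - \<mu> * [:v $ i:]" "\<And>j. E dvd w $ j - \<nu> * [:y $ j:]"
  shows "\<exists>p. is_pullback g w F p \<and> degree p \<le> m * d + n * \<delta> \<and> E dvd p - \<mu> ^ m * \<nu> ^ n * [:F v y:]"
  using F
proof (induction rule: biform_induct)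
  case zero
  then show ?case by (intro exI[of _ 0]) (simp add: is_pullback_def)
next
  case (add F G)
  then obtain p q where *: "is_pullback g w F p" "is_pullback g w G q"
    "degree p \<le> m * d + n * \<delta>" "degree q \<le> m * d + n * \<delta>"
    "E dvd p - \<mu> ^ m * \<nu> ^ n * [:F v y:]" "E dvd q - \<mu> ^ m * \<nu> ^ n * [:G v y:]" by blast
  have "[:F v y + G v y:] = [:F v y:] + [:G v y:]" by simp
  then have "p + q - \<mu> ^ m * \<nu> ^ n * [:F v y + G v y:]
      = (p - \<mu> ^ m * \<nu> ^ n * [:F v y:]) + (q - \<mu> ^ m * \<nu> ^ n * [:G v y:])"
    by (simp only: distrib_left) (simp only: add_diff_add)
  then have "E dvd p + q - \<mu> ^ m * \<nu> ^ n * [:F v y + G v y:]"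
    using dvd_add[OF *(5,6)] by (simp only:)
  then show ?case using *(1-4) by (intro exI[of _ "p + q"]) (simp add: is_pullback_def degree_add_le)
next
  case (scale a F)
  then obtain p where *: "is_pullback g w F p" "degree p \<le> m * d + n * \<delta>"
    "E dvd p - \<mu> ^ m * \<nu> ^ n * [:F v y:]" by blast
  have "[:a * F v y:] = [:a:] * [:F v y:]" by simp
  then have "[:a:] * p - \<mu> ^ m * \<nu> ^ n * [:a * F v y:] = [:a:] * (p - \<mu> ^ m * \<nu> ^ n * [:F v y:])"
    by (simp only: right_diff_distrib ac_simps)
  then have "E dvd [:a:] * p - \<mu> ^ m * \<nu> ^ n * [:a * F v y:]" using *(3) by (simp only: dvd_mult)
  moreover have "degree ([:a:] * p) \<le> m * d + n * \<delta>" using *(2) degree_smult_le[of a p] by simp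
  ultimately show ?case using *(1) by (intro exI[of _ "[:a:] * p"]) (simp add: is_pullback_def)
next
  case (monomial \<alpha> \<beta>)
  define p where "p = (\<Prod>i\<in>UNIV. (g $ i) ^ \<alpha> i)"
  define q where "q = (\<Prod>j\<in>UNIV. (w $ j) ^ \<beta> j)"
  have p: "\<And>s. poly p s = monomial_fun \<alpha> (eval_vec g s)" "degree p \<le> m * d"
    "E dvd p - \<mu> ^ m * [:monomial_fun \<alpha> v:]"
    using monomial_pullback[where g = g and \<alpha> = \<alpha>, folded p_def] deg(1) cong(1) monomial(1) by auto
  have q: "\<And>s. poly q s = monomial_fun \<beta> (eval_vec w s)" "degree q \<le> n * \<delta>"
    "E dvd q - \<nu> ^ n * [:monomial_fun \<beta> y:]"
    using monomial_pullback[where g = w and \<alpha> = \<beta>, folded q_def] deg(2) cong(2) monomial(2) by auto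
  have "(\<mu> ^ m * [:monomial_fun \<alpha> v:]) * (\<nu> ^ n * [:monomial_fun \<beta> y:])
      = \<mu> ^ m * \<nu> ^ n * ([:monomial_fun \<alpha> v:] * [:monomial_fun \<beta> y:])"
    by (simp only: ac_simps)
  also have "[:monomial_fun \<alpha> v:] * [:monomial_fun \<beta> y:] = [:monomial_fun \<alpha> v * monomial_fun \<beta> y:]" by simp
  finally have "E dvd p * q - \<mu> ^ m * \<nu> ^ n * [:monomial_fun \<alpha> v * monomial_fun \<beta> y:]"
    using dvd_diff_mult[OF p(3) q(3)] by (simp only:)
  moreover have "degree (p * q) \<le> m * d + n * \<delta>"
    using degree_mult_le[of p q] p(2) q(2) by linarith
  ultimately show ?case using p(1) q(1) by (intro exI[of _ "p * q"]) (simp add: is_pullback_def)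
qed

lemma is_pullback_pullback:
  fixes g :: "'k::alg_closed_field poly ^ 'n::finite" and w :: "'k poly ^ 'm::finite"
  assumes "biform m n F" shows "is_pullback g w F (pullback g w F)"
proof -
  have "\<exists>p. is_pullback g w F p \<and> degree p \<le> m * (\<Sum>i\<in>UNIV. degree (g $ i)) + n * (\<Sum>j\<in>UNIV. degree (w $ j))
      \<and> 1 dvd p - 1 ^ m * 1 ^ n * [:F 0 0:]"
    by (rule pullback_exists[OF assms]) (auto intro: member_le_sum)
  then obtain p where "is_pullback g w F p" by blast
  then show ?thesis using pullback_eqI[of p F g w] unfolding is_pullback_def by simp
qed

lemma poly_pullback:
  fixes g :: "'k::alg_closed_field poly ^ 'n::finite" and w :: "'k poly ^ 'm::finite"
  shows "biform m n F \<Longrightarrow> poly (pullback g w F) s = F (eval_vec g s) (eval_vec w s)"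
  using is_pullback_pullback unfolding is_pullback_def by blast

lemma pullback_properties:
  fixes g :: "'k::alg_closed_field poly ^ 'n::finite" and w :: "'k poly ^ 'm::finite"
  assumes "biform m n F"
  shows "(\<And>i. degree (g $ i) \<le> d) \<Longrightarrow> (\<And>j. degree (w $ j) \<le> \<delta>) \<Longrightarrow>
      degree (pullback g w F) \<le> m * d + n * \<delta>"
    and "(\<And>i. E dvd g $ i - \<mu> * [:v $ i:]) \<Longrightarrow> (\<And>j. E dvd w $ j - \<nu> * [:y $ j:]) \<Longrightarrow>
      E dvd pullback g w F - \<mu> ^ m * \<nu> ^ n * [:F v y:]"
proof -
  have eq: "p = pullback g w F" if "is_pullback g w F p" for p
    using pullback_eqI[of p F g w] that unfolding is_pullback_def by simp
  show "degree (pullback g w F) \<le> m * d + n * \<delta>"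
    if "\<And>i. degree (g $ i) \<le> d" "\<And>j. degree (w $ j) \<le> \<delta>"
    using pullback_exists[OF assms that, of 1 1 0 1 0] eq by auto
  show "E dvd pullback g w F - \<mu> ^ m * \<nu> ^ n * [:F v y:]"
    if "\<And>i. E dvd g $ i - \<mu> * [:v $ i:]" "\<And>j. E dvd w $ j - \<nu> * [:y $ j:]"
  proof -
    have "degree (g $ i) \<le> (\<Sum>i\<in>UNIV. degree (g $ i))" "degree (w $ j) \<le> (\<Sum>j\<in>UNIV. degree (w $ j))" for i j
      by (rule member_le_sum; simp)+
    from pullback_exists[OF assms this that] show ?thesis using eq by blast
  qed
qed



lemma pullback_diff:
  fixes g :: "'k::alg_closed_field poly ^ 'n::finite" and w :: "'k poly ^ 'm::finite"
  shows "biform m n F \<Longrightarrow> biform m' n' G \<Longrightarrow>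
    pullback g w (\<lambda>v y. F v y - G v y) = pullback g w F - pullback g w G"
  by (rule pullback_eqI) (simp add: poly_pullback)

lemma pullback_mult:
  fixes g :: "'k::alg_closed_field poly ^ 'n::finite" and w :: "'k poly ^ 'm::finite"
  shows "biform m n F \<Longrightarrow> biform m' n' G \<Longrightarrow>
    pullback g w (\<lambda>v y. F v y * G v y) = pullback g w F * pullback g w G"
  by (rule pullback_eqI) (simp add: poly_pullback)

lemma pullback_fst [simp]: "pullback g w (\<lambda>v y. v $ i) = (g $ i :: 'k::alg_closed_field poly)"
  by (rule pullback_eqI) (simp add: eval_vec_def)

lemma pullback_snd [simp]: "pullback g w (\<lambda>v y. y $ i) = (w $ i :: 'k::alg_closed_field poly)"
  by (rule pullback_eqI) (simp add: eval_vec_def)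

lemma pullback_const [simp]: "pullback g w (\<lambda>v y. c) = [:c :: 'k::alg_closed_field:]"
  by (rule pullback_eqI) simp


section \<open>Coordinates of points\<close>

lemma proportional_coords_proj:
  fixes v :: "'k::field ^ 'n::finite"
  assumes "v \<noteq> 0" shows "\<exists>c. c \<noteq> 0 \<and> coords (proj v) = c *s v"
proof -
  have "proportional v v" using assms unfolding proportional_def by (auto intro: exI[of _ 1])
  then have "proportional (coords (proj v)) v" by (rule Quotient3_rep_abs[OF Quotient3_pspace])
  then obtain c where c: "c \<noteq> 0" "v = c *s coords (proj v)" unfolding proportional_def by blast
  have "inverse c *s v = (inverse c * c) *s coords (proj v)"
    by (subst c(2)) (simp only: vector_smult_assoc)
  also have "\<dots> = coords (proj v)" using c(1) by simp
  finally have "coords (proj v) = inverse c *s v" by simp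
  then show ?thesis using c(1) by (intro exI[of _ "inverse c"]) simp
qed

lemma coords_nonzero: "coords x \<noteq> (0 :: 'k::field ^ 'n::finite)"
  using Quotient3_rep_reflp[OF Quotient3_pspace, of x] unfolding proportional_def by blast

lemma proj_coords: "proj (coords x) = x"
  by (rule Quotient3_abs_rep[OF Quotient3_pspace])

lemma proj_eq_iff:
  fixes v w :: "'k::field ^ 'n::finite"
  assumes "v \<noteq> 0" "w \<noteq> 0"
  shows "proj v = proj w \<longleftrightarrow> (\<exists>c. c \<noteq> 0 \<and> w = c *s v)"
proof -
  have refl: "proportional v v" "proportional w w"
    using assms unfolding proportional_def by (auto intro: exI[of _ 1])
  have "proj v = proj w \<longleftrightarrow> proportional v w"
    using Quotient3_rel[OF Quotient3_pspace, of v w] refl by blast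
  then show ?thesis using assms unfolding proportional_def by simp
qed

lemma forms_on_product_ex:
  "(\<exists>A\<in>forms_on_product. Q A) \<longleftrightarrow>
     (\<exists>m n. Q {\<lambda>(x, y). F (coords x) (coords y) | F. biform m n F})"
  unfolding forms_on_product_def by auto


section \<open>The blowup in a chart of the parameter line\<close>

lemma poly_eq_sum:
  fixes p :: "'a::comm_semiring_1 poly"
  assumes "degree p \<le> n" shows "poly p x = (\<Sum>i\<le>n. coeff p i * x ^ i)"
proof -
  have "poly p x = poly (\<Sum>i\<le>n. monom (coeff p i) i) x"
    using poly_as_sum_of_monoms'[OF assms] by simp
  then show ?thesis by (simp add: poly_sum poly_monom)
qed

text \<open>
  The curve is parametrized by \<open>g = (h w\<^sub>1, h w\<^sub>2, g\<^sub>3)\<close>, and its lift to the blowup by \<open>(g, w)\<close>, which is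
  defined everywhere. The degree conditions keep the point at infinity of the parameter line away from
  the fibre over the base point; the rational inverse of the parametrization is \<open>s = H1 / H0\<close>. The points
  of the parameter line over \<open>(base_point, [a : b])\<close> are the common zeros of \<open>h\<close> and \<open>b w\<^sub>1 - a w\<^sub>2\<close>, hence
  the zeros of \<open>D\<close>.
\<close>

locale blowup_chart =
  fixes g :: "'k::alg_closed_field poly ^ 3" and w :: "'k poly ^ 2" and h :: "'k poly"
    and d \<delta> :: nat and a b :: 'k and Z :: "(('k, 3) pspace \<times> ('k, 2) pspace) set"
    and D :: "'k poly"
  assumes g1: "g $ 1 = h * w $ 1" and g2: "g $ 2 = h * w $ 2"
    and g_no_zero: "\<exists>i. poly (g $ i) s \<noteq> 0" and w_no_zero: "\<exists>j. poly (w $ j) s \<noteq> 0"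
    and deg_g: "degree (g $ i) \<le> d" and deg_g3: "degree (g $ 3) = d"
    and deg_w: "degree (w $ j) \<le> \<delta>" and deg_w_full: "\<exists>j. w $ j \<noteq> 0 \<and> degree (w $ j) = \<delta>"
    and h_nonzero: "h \<noteq> 0" and deg_h: "degree h + \<delta> = d"
    and birational: "\<exists>e H0 H1 c. c \<noteq> 0 \<and> form e H0 \<and> form e H1 \<and>
      (\<forall>s. H0 (eval_vec g s) = poly c s \<and> H1 (eval_vec g s) = s * poly c s)"
    and ab: "(a, b) \<noteq> (0, 0)"
    and Z: "biform m n F \<Longrightarrow> (\<forall>(x, y)\<in>Z. F (coords x) (coords y) = 0) \<longleftrightarrow>
      (\<forall>s. F (eval_vec g s) (eval_vec w s) = 0)"
    and D_dvd: "D dvd h" "D dvd smult b (w $ 1) - smult a (w $ 2)"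
    and D_bezout: "\<exists>x y. D = x * h + y * (smult b (w $ 1) - smult a (w $ 2))"
begin

abbreviation "r \<equiv> smult b (w $ 1) - smult a (w $ 2)"
abbreviation "V \<equiv> zariski_closure forms_on_product Z"
abbreviation "P \<equiv> (base_point :: ('k, 3) pspace, proj (vector [a, b]) :: ('k, 2) pspace)"
abbreviation "t0 \<equiv> vector [0, 0, 1] :: 'k ^ 3"
abbreviation "y0 \<equiv> vector [a, b] :: 'k ^ 2"
abbreviation "hat \<equiv> pullback g w"

lemma t0_simps [simp]: "t0 $ 1 = 0" "t0 $ 2 = 0" "t0 $ 3 = 1"
  by (simp_all add: vector_3)

lemma y0_simps [simp]: "y0 $ 1 = a" "y0 $ 2 = b"
  by (simp_all add: vector_2)

lemma t0_nonzero: "t0 \<noteq> 0" and y0_nonzero: "y0 \<noteq> 0"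
  using ab t0_simps y0_simps by (metis zero_index zero_neq_one, metis zero_index)

lemma eval_P:
  "\<exists>c c'. c \<noteq> 0 \<and> c' \<noteq> 0 \<and> (\<forall>m n F. biform m n F \<longrightarrow>
      F (coords base_point) (coords (proj y0)) = c ^ m * c' ^ n * F t0 y0)"
proof -
  obtain c c' where c: "c \<noteq> 0" "coords (proj t0) = c *s t0" "c' \<noteq> 0" "coords (proj y0) = c' *s y0"
    using proportional_coords_proj[OF t0_nonzero] proportional_coords_proj[OF y0_nonzero] by blast
  have "F (coords base_point) (coords (proj y0)) = c ^ m * c' ^ n * F t0 y0" if "biform m n F" for m n F
    unfolding base_point_def c(2,4) by (rule biform_homogeneous[OF that])
  then show ?thesis using c(1,3) by blast
qed

lemma eval_P_zero_iff:
  "biform m n F \<Longrightarrow> F (coords base_point) (coords (proj y0)) = 0 \<longleftrightarrow> F t0 y0 = 0"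
  using eval_P by (metis mult_eq_0_iff power_not_zero)

lemma hat_zero_iff: "biform m n F \<Longrightarrow> hat F = 0 \<longleftrightarrow> (\<forall>s. F (eval_vec g s) (eval_vec w s) = 0)"
  using poly_pullback[of m n F g w] poly_ext[of "hat F" 0] by auto

lemma mem_V_iff:
  "(x, y) \<in> V \<longleftrightarrow> (\<forall>m n F. biform m n F \<longrightarrow> hat F = 0 \<longrightarrow> F (coords x) (coords y) = 0)"
proof -
  have "(x, y) \<in> V \<longleftrightarrow> (\<forall>m n F. biform m n F \<longrightarrow>
      (\<forall>(x, y)\<in>Z. F (coords x) (coords y) = 0) \<longrightarrow> F (coords x) (coords y) = 0)"
  proof (intro iffI allI impI)
    fix m n F
    assume V: "(x, y) \<in> V" and F: "biform m n F" "\<forall>(x, y)\<in>Z. F (coords x) (coords y) = 0"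
    have "{\<lambda>(x, y). F (coords x) (coords y) | F. biform m n F}
        \<in> (forms_on_product :: (('k, 3) pspace \<times> ('k, 2) pspace \<Rightarrow> 'k) set set)"
      unfolding forms_on_product_def by (rule image_eqI[of _ _ "(m, n)"]) auto
    moreover have "(\<lambda>(x, y). F (coords x) (coords y)) \<in> {\<lambda>(x, y). F (coords x) (coords y) | F. biform m n F}"
      using F(1) by blast
    moreover have "\<forall>A\<in>forms_on_product. \<forall>F\<in>A. (\<forall>z\<in>Z. F z = 0) \<longrightarrow> F (x, y) = 0"
      using V unfolding zariski_closure_def by (rule CollectD)
    ultimately have "(\<forall>z\<in>Z. (case z of (x, y) \<Rightarrow> F (coords x) (coords y)) = 0) \<longrightarrow>
        (case (x, y) of (x, y) \<Rightarrow> F (coords x) (coords y)) = 0"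
      by (metis (no_types, lifting))
    then show "F (coords x) (coords y) = 0" using F(2) by (simp add: case_prod_beta)
  next
    assume *: "\<forall>m n F. biform m n F \<longrightarrow>
      (\<forall>(x, y)\<in>Z. F (coords x) (coords y) = 0) \<longrightarrow> F (coords x) (coords y) = 0"
    show "(x, y) \<in> V"
      unfolding zariski_closure_def forms_on_product_def
    proof (intro CollectI ballI impI)
      fix A F
      assume "A \<in> range (\<lambda>(m, n). {\<lambda>(x, y). F (coords x) (coords y) | F. biform m n F})"
        "F \<in> A" "\<forall>z\<in>Z. F z = 0"
      then obtain m n F' where F': "biform m n F'" "F = (\<lambda>(x, y). F' (coords x) (coords y))"
        and zero: "\<forall>z\<in>Z. F z = 0" by auto
      have "\<forall>(x, y)\<in>Z. F' (coords x) (coords y) = 0" using zero unfolding F'(2) by (simp add: case_prod_beta)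
      then have "F' (coords x) (coords y) = 0" using * F'(1) by blast
      then show "F (x, y) = 0" unfolding F'(2) by simp
    qed
  qed
  moreover have "(\<forall>(x, y)\<in>Z. F (coords x) (coords y) = 0) \<longleftrightarrow> hat F = 0" if "biform m n F" for m n F
    using Z[OF that] hat_zero_iff[OF that] by simp
  ultimately show ?thesis by (simp cong: imp_cong)
qed

lemma Z_subset_V: "Z \<subseteq> V"
  unfolding zariski_closure_def by blast

lemma P_in_V_iff: "P \<in> V \<longleftrightarrow> (\<forall>m n F. biform m n F \<longrightarrow> hat F = 0 \<longrightarrow> F t0 y0 = 0)"
  unfolding mem_V_iff using eval_P_zero_iff by blast

lemma common_zero_iff: "poly D s = 0 \<longleftrightarrow> poly h s = 0 \<and> poly r s = 0"
proof -
  obtain x y where "D = x * h + y * r" using D_bezout by blast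
  then have "poly h s = 0 \<and> poly r s = 0 \<Longrightarrow> poly D s = 0" by simp
  moreover have "poly D s = 0 \<Longrightarrow> poly h s = 0 \<and> poly r s = 0"
    using D_dvd by (metis dvd_0_left_iff poly_eq_0_iff_dvd dvd_trans)
  ultimately show ?thesis by blast
qed

lemma D_nonzero': "D \<noteq> 0"
  using D_dvd(1) h_nonzero by auto

text \<open>
  Modulo \<open>D\<close> both \<open>h\<close> and \<open>b w\<^sub>1 - a w\<^sub>2\<close> vanish, so \<open>g\<close> is the multiple \<open>g\<^sub>3\<close> of \<open>(0, 0, 1)\<close> and \<open>w\<close> is
  the multiple \<open>\<nu>\<close> of \<open>(a, b)\<close>. Thus vanishing at the point means divisibility of the pullback by \<open>D\<close>.
\<close>

lemma hat_cong:
  "\<exists>\<nu> a' b'. \<nu> = smult a' (w $ 1) + smult b' (w $ 2) \<and> a' * a + b' * b = 1 \<and>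
     (\<forall>m n F. biform m n F \<longrightarrow> D dvd hat F - (g $ 3) ^ m * \<nu> ^ n * [:F t0 y0:]) \<and>
     (\<forall>s. poly D s = 0 \<longrightarrow> poly (g $ 3) s \<noteq> 0 \<and> poly \<nu> s \<noteq> 0)"
proof -
  obtain a' b' where a': "a' * a + b' * b = 1"
  proof (cases "a = 0")
    case True
    then show ?thesis using ab that[of 0 "inverse b"] by simp
  next
    case False
    then show ?thesis using that[of "inverse a" 0] by simp
  qed
  define \<nu> where "\<nu> = smult a' (w $ 1) + smult b' (w $ 2)"
  have bb: "1 - a' * a = b' * b" "1 - b' * b = a' * a" using a' by (simp_all add: algebra_simps)
  have "w $ 1 - \<nu> * [:a:] = smult (1 - a' * a) (w $ 1) - smult (b' * a) (w $ 2)"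
    unfolding \<nu>_def by (simp add: smult_diff_left smult_add_right ac_simps)
  then have w1: "w $ 1 - \<nu> * [:a:] = smult b' r"
    unfolding bb by (simp add: smult_diff_right)
  have "w $ 2 - \<nu> * [:b:] = smult (1 - b' * b) (w $ 2) - smult (a' * b) (w $ 1)"
    unfolding \<nu>_def by (simp add: smult_diff_left smult_add_right ac_simps)
  then have w2: "w $ 2 - \<nu> * [:b:] = smult (- a') r"
    unfolding bb by (simp add: smult_diff_right)
  have cong_g: "D dvd g $ i - g $ 3 * [:t0 $ i:]" for i
    using exhaust_3[of i] D_dvd(1) g1 g2 by auto
  have cong_w: "D dvd w $ j - \<nu> * [:y0 $ j:]" for j
    using exhaust_2[of j]
  proof
    assume "j = 1" then show ?thesis using w1 D_dvd(2) by (simp add: dvd_smult)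
  next
    assume "j = 2" then show ?thesis using w2 D_dvd(2) dvd_smult[of D r "- a'"] by simp
  qed
  have "poly (g $ 3) s \<noteq> 0 \<and> poly \<nu> s \<noteq> 0" if s: "poly D s = 0" for s
  proof
    have hr: "poly h s = 0" "poly r s = 0" using s common_zero_iff by blast+
    then show "poly (g $ 3) s \<noteq> 0" using g_no_zero[of s] g1 g2 by (metis exhaust_3 mult_zero_left poly_mult)
    have "poly (w $ 1) s = poly \<nu> s * a" "poly (w $ 2) s = poly \<nu> s * b"
    proof -
      have "poly (w $ 1 - \<nu> * [:a:]) s = 0" "poly (w $ 2 - \<nu> * [:b:]) s = 0"
        unfolding w1 w2 using hr(2) by (simp_all only: poly_smult mult_zero_right)
      then show "poly (w $ 1) s = poly \<nu> s * a" "poly (w $ 2) s = poly \<nu> s * b"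
        by (simp_all add: mult.commute)
    qed
    then show "poly \<nu> s \<noteq> 0" using w_no_zero[of s] by (metis exhaust_2 mult_zero_left)
  qed
  then show ?thesis using a' \<nu>_def pullback_properties(2)[OF _ cong_g cong_w] by blast
qed

lemma hat_at_zero:
  assumes "biform m n F" "poly D s = 0"
  shows "poly (hat F) s = 0 \<longleftrightarrow> F t0 y0 = 0"
proof -
  obtain \<nu> where \<nu>: "D dvd hat F - (g $ 3) ^ m * \<nu> ^ n * [:F t0 y0:]"
    "poly (g $ 3) s \<noteq> 0" "poly \<nu> s \<noteq> 0"
    using hat_cong assms by metis
  then have "poly (hat F - (g $ 3) ^ m * \<nu> ^ n * [:F t0 y0:]) s = 0"
    using assms(2) by (metis dvd_trans poly_eq_0_iff_dvd)
  then show ?thesis using \<nu>(2,3) by auto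
qed

lemma D_dvd_hat: "biform m n F \<Longrightarrow> F t0 y0 = 0 \<Longrightarrow> D dvd hat F"
  using hat_cong by fastforce

subsection \<open>Producing forms with prescribed pullback\<close>

lemma d_pos: "0 < d"
proof (rule ccontr)
  assume "\<not> 0 < d"
  obtain e H0 H1 c where H: "c \<noteq> 0" "form e H1" "\<forall>s. H1 (eval_vec g s) = s * poly c s"
    using birational by metis
  have bi: "biform e 0 (\<lambda>v y. H1 v)" by (rule form_imp_biform[OF H(2)])
  have "hat (\<lambda>v y. H1 v) = [:0, 1:] * c" by (rule pullback_eqI) (simp add: H(3))
  moreover have "degree (hat (\<lambda>v y. H1 v)) \<le> e * d + 0 * \<delta>"
    by (rule pullback_properties(1)[OF bi deg_g deg_w])
  ultimately have "degree ([:0, 1:] * c) = 0" using \<open>\<not> 0 < d\<close> by simp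
  then show False using H(1) by (simp add: degree_mult_eq)
qed

text \<open>
  The rational inverse expresses the parameter by forms on the curve, so a fixed multiple \<open>C\<close> of every
  polynomial of bounded degree is a pullback; larger degrees follow by descent.
\<close>

lemma conductor_exists:
  "\<exists>C m0. C \<noteq> 0 \<and> (\<forall>m n f. degree f \<le> m * d + n * \<delta> \<longrightarrow>
     (\<exists>F. biform (m + m0) n F \<and> hat F = C * f))"
proof -
  obtain e H0 H1 c where H: "c \<noteq> 0" "form e H0" "form e H1"
    "\<And>s. H0 (eval_vec g s) = poly c s" "\<And>s. H1 (eval_vec g s) = s * poly c s"
    using birational by metis
  have \<delta>_le: "\<delta> \<le> d" using deg_h by simp
  have base: "\<exists>F. biform (d * e) 0 F \<and> hat F = c ^ d * f" if f: "degree f \<le> d" for f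
  proof -
    define F where "F = (\<lambda>(v :: 'k ^ 3) (y :: 'k ^ 2). \<Sum>j\<le>d. coeff f j * (H0 v ^ (d - j) * H1 v ^ j))"
    have "biform (d * e) 0 (\<lambda>(v :: 'k ^ 3) (y :: 'k ^ 2). H0 v ^ (d - j) * H1 v ^ j)" if "j \<le> d" for j
    proof -
      have "biform ((d - j) * e + j * e) ((d - j) * 0 + j * 0)
          (\<lambda>(v :: 'k ^ 3) (y :: 'k ^ 2). H0 v ^ (d - j) * H1 v ^ j)"
        by (intro biform_mult biform_power form_imp_biform H)
      moreover have "(d - j) * e + j * e = d * e" using that by (simp flip: add_mult_distrib)
      ultimately show ?thesis by simp
    qed
    then have "biform (d * e) 0 F" unfolding F_def by (intro biform_sum biform_scale) simp
    moreover have "hat F = c ^ d * f"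
    proof (rule pullback_eqI)
      fix s
      have "F (eval_vec g s) (eval_vec w s) = (\<Sum>j\<le>d. coeff f j * (poly c s ^ (d - j) * (s * poly c s) ^ j))"
        unfolding F_def H(4,5) by simp
      also have "\<dots> = (\<Sum>j\<le>d. poly c s ^ d * (coeff f j * s ^ j))"
      proof (rule sum.cong[OF refl])
        fix j assume "j \<in> {..d}"
        then have "poly c s ^ d = poly c s ^ (d - j) * poly c s ^ j" by (simp flip: power_add)
        then show "coeff f j * (poly c s ^ (d - j) * (s * poly c s) ^ j) = poly c s ^ d * (coeff f j * s ^ j)"
          by (simp add: power_mult_distrib)
      qed
      also have "\<dots> = poly (c ^ d * f) s"
        by (simp add: poly_eq_sum[OF f] sum_distrib_left)
      finally show "poly (c ^ d * f) s = F (eval_vec g s) (eval_vec w s)" by simp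
    qed
    ultimately show ?thesis by blast
  qed
  have first: "\<exists>F. biform (m + d * e) 0 F \<and> hat F = c ^ d * f" if "degree f \<le> m * d + d" for m f
    using that
  proof (induction m arbitrary: f)
    case 0
    then show ?case using base by simp
  next
    case (Suc m)
    have "degree f \<le> d + (m * d + d)" using Suc.prems by (simp add: algebra_simps)
    then obtain q where q: "f = (\<Sum>i\<in>UNIV. q i * g $ i)" "\<And>i. degree (q i) \<le> m * d + d"
      using bezout_degree[where f = "($) g", OF g_no_zero deg_g deg_g3, of f "m * d + d"] by auto
    obtain F where F: "\<And>i. biform (m + d * e) 0 (F i)" "\<And>i. hat (F i) = c ^ d * q i"
      using Suc.IH[OF q(2)] by metis
    define G where "G = (\<lambda>v y. \<Sum>i\<in>UNIV. F i v y * v $ i)"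
    have "biform (m + d * e + 1) (0 + 0) G" unfolding G_def
      by (intro biform_sum biform_mult F biform_fst)
    moreover have "hat G = c ^ d * f"
    proof (rule pullback_eqI)
      fix s
      have "F i (eval_vec g s) (eval_vec w s) = poly (c ^ d * q i) s" for i
        using poly_pullback[OF F(1)] F(2) by metis
      then show "poly (c ^ d * f) s = G (eval_vec g s) (eval_vec w s)"
        unfolding G_def q(1) by (simp add: poly_sum sum_distrib_left eval_vec_def mult.assoc)
    qed
    ultimately show ?case by (intro exI[of _ G]) simp
  qed
  have both: "\<exists>F. biform (m + d * e) n F \<and> hat F = c ^ d * f" if "degree f \<le> m * d + n * \<delta> + d" for m n f
    using that
  proof (induction n arbitrary: f)
    case 0
    then show ?case using first by simp
  next
    case (Suc n)
    obtain j0 where j0: "degree (w $ j0) = \<delta>" using deg_w_full by blast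
    have "degree f \<le> \<delta> + (m * d + n * \<delta> + d)" using Suc.prems by (simp add: algebra_simps)
    then obtain q where q: "f = (\<Sum>j\<in>UNIV. q j * w $ j)" "\<And>j. degree (q j) \<le> m * d + n * \<delta> + d"
      using bezout_degree[where f = "($) w", OF w_no_zero deg_w j0, of f "m * d + n * \<delta> + d"] \<delta>_le by auto
    obtain F where F: "\<And>i. biform (m + d * e) n (F i)" "\<And>i. hat (F i) = c ^ d * q i"
      using Suc.IH[OF q(2)] by metis
    define G where "G = (\<lambda>v y. \<Sum>i\<in>UNIV. F i v y * y $ i)"
    have "biform (m + d * e + 0) (n + 1) G" unfolding G_def
      by (intro biform_sum biform_mult F biform_snd)
    moreover have "hat G = c ^ d * f"
    proof (rule pullback_eqI)
      fix s
      have "F i (eval_vec g s) (eval_vec w s) = poly (c ^ d * q i) s" for i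
        using poly_pullback[OF F(1)] F(2) by metis
      then show "poly (c ^ d * f) s = G (eval_vec g s) (eval_vec w s)"
        unfolding G_def q(1) by (simp add: poly_sum sum_distrib_left eval_vec_def mult.assoc)
    qed
    ultimately show ?case by (intro exI[of _ G]) simp
  qed
  show ?thesis
  proof (rule exI[of _ "c ^ d"], rule exI[of _ "d * e"], intro conjI allI impI)
    show "c ^ d \<noteq> 0" using H(1) by simp
    show "\<exists>F. biform (m + d * e) n F \<and> hat F = c ^ d * f" if "degree f \<le> m * d + n * \<delta>" for m n f
      using both[of f m n] that by simp
  qed
qed

text \<open>
  A drop in the degree of the pullback is a zero at infinity of the parameter line. Powers of the form
  below make room for factors of arbitrary degree.
\<close>

lemma low_degree_form:
  "\<exists>B. biform 1 0 B \<and> B t0 y0 \<noteq> 0 \<and> degree (hat B) + 1 \<le> d"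
proof -
  obtain j where j: "w $ j \<noteq> 0" "degree (w $ j) = \<delta>" using deg_w_full by blast
  obtain i where i: "t0 $ i = 0" "g $ i = h * w $ j"
    using exhaust_2[of j] g1 g2 t0_simps by metis
  have deg: "degree (g $ i) = d" "g $ i \<noteq> 0"
    using i(2) j h_nonzero deg_h by (auto simp: degree_mult_eq)
  define B where "B = (\<lambda>(v :: 'k ^ 3) (y :: 'k ^ 2). lead_coeff (g $ i) * v $ 3 - lead_coeff (g $ 3) * v $ i)"
  have hat: "hat B = smult (lead_coeff (g $ i)) (g $ 3) - smult (lead_coeff (g $ 3)) (g $ i)"
    unfolding B_def by (rule pullback_eqI) (simp add: eval_vec_def)
  have "degree (hat B) \<le> d" unfolding hat using deg(1) deg_g3 by (intro degree_diff_le) auto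
  moreover have "coeff (hat B) d = 0" unfolding hat using deg(1) deg_g3 by simp
  ultimately have "degree (hat B) < d" using d_pos
    by (metis degree_0 leading_coeff_0_iff order_le_less)
  moreover have "biform 1 0 B" unfolding B_def by (intro biform_diff biform_scale biform_fst)
  moreover have "B t0 y0 \<noteq> 0" unfolding B_def using i(1) deg(2) by simp
  ultimately show ?thesis by (intro exI[of _ B]) simp
qed

text \<open>
  A parameter \<open>s\<close> outside the fibre is mapped to another point; the two points differ in the plane if
  \<open>h\<close> does not vanish at \<open>s\<close>, and in the exceptional line otherwise.
\<close>

lemma separating_linear_form:
  assumes "poly D s \<noteq> 0"
  shows "\<exists>m n L. biform m n L \<and> L t0 y0 \<noteq> 0 \<and> poly (hat L) s = 0"
proof (cases "poly h s = 0")
  case False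
  obtain j where "poly (w $ j) s \<noteq> 0" using w_no_zero by blast
  then obtain i where i: "t0 $ i = 0" "poly (g $ i) s \<noteq> 0"
    using exhaust_2[of j] g1 g2 t0_simps False by (metis mult_eq_0_iff poly_mult)
  define L where "L = (\<lambda>(v :: 'k ^ 3) (y :: 'k ^ 2). poly (g $ i) s * v $ 3 - poly (g $ 3) s * v $ i)"
  have L: "biform 1 0 L" unfolding L_def by (intro biform_diff biform_scale biform_fst)
  moreover have "L t0 y0 \<noteq> 0" unfolding L_def using i by simp
  moreover have "poly (hat L) s = 0"
    unfolding poly_pullback[OF L] unfolding L_def by (simp add: eval_vec_def mult.commute)
  ultimately show ?thesis by blast
next
  case True
  then have r: "poly r s \<noteq> 0" using assms common_zero_iff by blast
  define L where "L = (\<lambda>(v :: 'k ^ 3) (y :: 'k ^ 2). poly (w $ 2) s * y $ 1 - poly (w $ 1) s * y $ 2)"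
  have L: "biform 0 1 L" unfolding L_def by (intro biform_diff biform_scale biform_snd)
  moreover have "L t0 y0 \<noteq> 0" unfolding L_def using r by (simp add: mult.commute)
  moreover have "poly (hat L) s = 0"
    unfolding poly_pullback[OF L] unfolding L_def by (simp add: eval_vec_def mult.commute)
  ultimately show ?thesis by blast
qed

lemma separation:
  assumes "q \<noteq> 0" "\<And>s. poly D s = 0 \<Longrightarrow> poly q s \<noteq> 0"
  shows "\<exists>m n B. biform m n B \<and> B t0 y0 \<noteq> 0 \<and> q dvd hat B \<and>
    degree (hat B) + N \<le> m * d + n * \<delta> \<and> N \<le> m"
  using assms
proof (induction "degree q" arbitrary: q)
  case 0
  obtain B where B: "biform 1 0 B" "B t0 y0 \<noteq> 0" "degree (hat B) + 1 \<le> d" using low_degree_form by blast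
  define B' where "B' = (\<lambda>v y. B v y ^ N)"
  have "biform (N * 1) (N * 0) B'" unfolding B'_def by (rule biform_power[OF B(1)])
  moreover have "hat B' = hat B ^ N"
    unfolding B'_def by (rule pullback_eqI) (simp add: poly_pullback[OF B(1)])
  moreover have "degree (hat B ^ N) + N \<le> N * d"
  proof -
    have "degree (hat B ^ N) + N \<le> degree (hat B) * N + N" using degree_power_le[of "hat B" N] by simp
    also have "\<dots> = N * (degree (hat B) + 1)" by (simp add: algebra_simps)
    also have "\<dots> \<le> N * d" using B(3) by (rule mult_le_mono2)
    finally show ?thesis .
  qed
  moreover have "q dvd p" for p
  proof -
    obtain c where "q = [:c:]" using 0(1) by (metis degree_eq_zeroE)
    then have "is_unit q" using 0(2) by (simp add: is_unit_const_poly_iff dvd_field_iff)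
    then show ?thesis by (rule unit_imp_dvd)
  qed
  moreover have "B' t0 y0 \<noteq> 0" unfolding B'_def using B(2) by simp
  ultimately show ?case by (intro exI[of _ N] exI[of _ 0] exI[of _ B']) simp
next
  case (Suc k)
  then obtain s where s: "poly q s = 0" using alg_closed_imp_poly_has_root[of q] by auto
  then obtain q' where q': "q = [:- s, 1:] * q'" unfolding poly_eq_0_iff_dvd by (metis dvdE)
  have nz: "q' \<noteq> 0" using Suc.prems(1) q' by auto
  then have "k = degree q'" using Suc.hyps(2) unfolding q' by (subst (asm) degree_mult_eq) auto
  moreover have "poly q' s \<noteq> 0" if "poly D s = 0" for s using Suc.prems(2)[OF that] unfolding q' by simp
  ultimately obtain m n B where B: "biform m n B" "B t0 y0 \<noteq> 0" "q' dvd hat B"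
      "degree (hat B) + N \<le> m * d + n * \<delta>" "N \<le> m"
    using Suc.hyps(1)[OF _ nz] by blast
  have "poly D s \<noteq> 0" using Suc.prems(2) s by blast
  then obtain m' n' L where L: "biform m' n' L" "L t0 y0 \<noteq> 0" "poly (hat L) s = 0"
    using separating_linear_form by blast
  define B' where "B' = (\<lambda>v y. L v y * B v y)"
  have hat: "hat B' = hat L * hat B" unfolding B'_def by (rule pullback_mult[OF L(1) B(1)])
  have "biform (m' + m) (n' + n) B'" unfolding B'_def by (rule biform_mult[OF L(1) B(1)])
  moreover have "B' t0 y0 \<noteq> 0" unfolding B'_def using L(2) B(2) by simp
  moreover have "q dvd hat B'" unfolding hat q' by (rule mult_dvd_mono) (use L(3) B(3) in \<open>simp_all add: poly_eq_0_iff_dvd\<close>)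
  moreover have "degree (hat B') + N \<le> (m' + m) * d + (n' + n) * \<delta>"
  proof -
    have "degree (hat L) \<le> m' * d + n' * \<delta>" by (rule pullback_properties(1)[OF L(1) deg_g deg_w])
    then show ?thesis using degree_mult_le[of "hat L" "hat B"] B(4) unfolding hat by (simp add: distrib_right)
  qed
  ultimately show ?case using B(5)
    by (intro exI[of _ "m' + m"] exI[of _ "n' + n"] exI[of _ B']) simp
qed

lemma P_in_V_if_zero: "poly D s = 0 \<Longrightarrow> P \<in> V"
  unfolding P_in_V_iff using hat_at_zero by (metis poly_0)

text \<open>
  With an empty fibre, separation produces a form \<open>B\<close> that does not vanish at the point and whose pullback
  is divisible by \<open>C * g $ i\<close> with \<open>i\<close> equal to 1 or 2. By the conductor the pullback equals that of a
  multiple of the \<open>i\<close>-th coordinate, which vanishes at the point, and the difference of the two forms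
  excludes the point from the closure.
\<close>

lemma P_notin_V:
  assumes "degree D = 0" shows "P \<notin> V"
proof -
  obtain c where "D = [:c:]" "c \<noteq> 0" using assms D_nonzero' by (metis degree_eq_zeroE pCons_0_0)
  then have no_zero: "poly D s \<noteq> 0" for s by simp
  obtain C m0 where C: "C \<noteq> 0" "\<And>m n f. degree f \<le> m * d + n * \<delta> \<Longrightarrow> \<exists>F. biform (m + m0) n F \<and> hat F = C * f"
    using conductor_exists by metis
  obtain j where j: "w $ j \<noteq> 0" using deg_w_full by blast
  obtain i where "t0 $ i = 0" "g $ i = h * w $ j"
    using exhaust_2[of j] g1 g2 t0_simps by metis
  then have i: "t0 $ i = 0" "g $ i \<noteq> 0" using h_nonzero j by auto
  \<comment> \<open>The margin leaves bidegree \<open>(m - 1 - m0, n)\<close> for the cofactor, to be raised by \<open>m0\<close> and by the coordinate.\<close>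
  obtain m n B where B: "biform m n B" "B t0 y0 \<noteq> 0" "C * g $ i dvd hat B"
      "degree (hat B) + (m0 + 1) * (d + 1) \<le> m * d + n * \<delta>" "(m0 + 1) * (d + 1) \<le> m"
    using separation[of "C * g $ i" "(m0 + 1) * (d + 1)"] C(1) i(2) no_zero by auto
  obtain f where f: "hat B = C * g $ i * f" using B(3) by (rule dvdE)
  have "m0 + 1 \<le> m" using B(5) by simp
  then obtain m1 where m1: "m = m1 + m0 + 1" by (metis add.assoc add.commute le_Suc_ex)
  have "degree f \<le> m1 * d + n * \<delta>"
  proof (cases "f = 0")
    case False
    then have "degree f \<le> degree (hat B)" unfolding f using C(1) i(2) by (simp add: degree_mult_eq)
    then show ?thesis using B(4) unfolding m1 by (simp add: algebra_simps)
  qed simp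
  then obtain F where F: "biform (m1 + m0) n F" "hat F = C * f" using C(2) by blast
  define B' where "B' = (\<lambda>v y. v $ i * F v y)"
  have "biform (1 + (m1 + m0)) (0 + n) B'" unfolding B'_def by (intro biform_mult biform_fst F)
  then have bi: "biform m n B'" unfolding m1 by (simp add: add.commute)
  have "hat B' = hat (\<lambda>v y. v $ i) * hat F" unfolding B'_def by (rule pullback_mult[OF biform_fst F(1)])
  then have "hat B' = hat B" unfolding f F(2) by (simp add: ac_simps)
  then have "hat (\<lambda>v y. B v y - B' v y) = 0" using pullback_diff[OF B(1) bi, of g w] by simp
  moreover have "B t0 y0 - B' t0 y0 \<noteq> 0" unfolding B'_def using i(1) B(2) by simp
  ultimately show ?thesis unfolding P_in_V_iff using biform_diff[OF B(1) bi] by blast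
qed

lemma P_in_V_iff_degree: "P \<in> V \<longleftrightarrow> degree D \<noteq> 0"
proof
  assume "degree D \<noteq> 0"
  then obtain s where "poly D s = 0" using alg_closed_imp_poly_has_root[of D] by blast
  then show "P \<in> V" by (rule P_in_V_if_zero)
qed (use P_notin_V in blast)

end


section \<open>The local ring of the blowup\<close>

lemma regular_at_eq_ring_on:
  "regular_at \<G> V P = ring_on {f. \<exists>A\<in>\<G>. \<exists>F\<in>A. \<exists>G\<in>A. G P \<noteq> 0 \<and> (\<forall>x\<in>V. G x \<noteq> 0 \<longrightarrow> f x = F x / G x)}"
  unfolding regular_at_def ring_on_def by (simp add: fun_eq_iff)

lemma forms_on_product_ex2:
  "(\<exists>A\<in>forms_on_product. \<exists>F\<in>A. \<exists>G\<in>A. Q F G) \<longleftrightarrow>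
     (\<exists>m n F G. biform m n F \<and> biform m n G \<and>
       Q (\<lambda>(x, y). F (coords x) (coords y)) (\<lambda>(x, y). G (coords x) (coords y)))"
  unfolding forms_on_product_ex by (simp only: bex_simps Bex_def mem_Collect_eq) metis

lemma forms_on_product_ex1:
  "(\<exists>A\<in>forms_on_product. \<exists>G\<in>A. Q G) \<longleftrightarrow>
     (\<exists>m n G. biform m n G \<and> Q (\<lambda>(x, y). G (coords x) (coords y)))"
  unfolding forms_on_product_ex by (simp only: bex_simps Bex_def mem_Collect_eq) metis

context blowup_chart
begin

text \<open>The local ring of the blowup at the point, as a subring of the function field of the parameter line.\<close>

definition germs :: "'k poly fract set" where
  "germs = {to_fract (hat F) / to_fract (hat G) | m n F G. biform m n F \<and> biform m n G \<and> G t0 y0 \<noteq> 0}"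

lemma germs_I:
  "biform m n F \<Longrightarrow> biform m n G \<Longrightarrow> G t0 y0 \<noteq> 0 \<Longrightarrow> to_fract (hat F) / to_fract (hat G) \<in> germs"
  unfolding germs_def by blast

lemma germs_E:
  assumes "x \<in> germs"
  obtains m n F G where "biform m n F" "biform m n G" "G t0 y0 \<noteq> 0" "x = to_fract (hat F) / to_fract (hat G)"
  using assms unfolding germs_def by blast

end

locale point_on_blowup = blowup_chart +
  assumes deg_D: "0 < degree D"
begin

sublocale nonconstant D
  using deg_D by unfold_locales

lemma hat_nonzero:
  assumes "biform m n G" "G t0 y0 \<noteq> 0" shows "hat G \<noteq> 0"
proof -
  obtain s where "poly D s = 0" using deg_D alg_closed_imp_poly_has_root by blast
  then show ?thesis using hat_at_zero[OF assms(1)] assms(2) by (metis poly_0)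
qed

lemma fraction_mem_vanishing:
  assumes F: "biform m n F" "F t0 y0 = 0" and G: "biform m n G" "G t0 y0 \<noteq> 0"
  shows "to_fract (hat F) / to_fract (hat G) \<in> vanishing D 1"
proof -
  obtain f where f: "hat F = D * f" using D_dvd_hat[OF F] by (rule dvdE)
  have "\<forall>s. poly D s = 0 \<longrightarrow> poly (hat G) s \<noteq> 0" using hat_at_zero[OF G(1)] G(2) by blast
  then have "to_fract f / to_fract (hat G) \<in> localization D" unfolding localization_def by blast
  moreover have "to_fract (hat F) / to_fract (hat G) = to_fract (D ^ 1) * (to_fract f / to_fract (hat G))"
    unfolding f by simp
  ultimately show ?thesis unfolding vanishing_def by blast
qed

sublocale germs: unital_subring germs
proof
  show "1 \<in> germs"
    using germs_I[OF biform_const[of 1] biform_const[of 1]] by (simp flip: one_pCons)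
next
  fix x y assume x: "x \<in> germs" and y: "y \<in> germs"
  obtain m n F G where F: "biform m n F" "biform m n G" "G t0 y0 \<noteq> 0" "x = to_fract (hat F) / to_fract (hat G)"
    using x by (rule germs_E)
  obtain m' n' F' G' where F': "biform m' n' F'" "biform m' n' G'" "G' t0 y0 \<noteq> 0"
      "y = to_fract (hat F') / to_fract (hat G')"
    using y by (rule germs_E)
  have nz: "hat G \<noteq> 0" "hat G' \<noteq> 0" using hat_nonzero F F' by blast+
  have bi: "biform (m + m') (n + n') (\<lambda>v y. F v y * G' v y)" "biform (m + m') (n + n') (\<lambda>v y. G v y * G' v y)"
    "biform (m + m') (n + n') (\<lambda>v y. G v y * F' v y)" "biform (m + m') (n + n') (\<lambda>v y. F v y * F' v y)"
    by (intro biform_mult F F')+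
  have hats: "hat (\<lambda>v y. F v y * G' v y - G v y * F' v y) = hat F * hat G' - hat G * hat F'"
    "hat (\<lambda>v y. F v y * F' v y) = hat F * hat F'" "hat (\<lambda>v y. G v y * G' v y) = hat G * hat G'"
    by (simp_all add: pullback_diff[OF bi(1,3)] pullback_mult[OF F(1) F'(2)]
        pullback_mult[OF F(2) F'(1)] pullback_mult[OF F(1) F'(1)] pullback_mult[OF F(2) F'(2)])
  have *: "G t0 y0 * G' t0 y0 \<noteq> 0" using F(3) F'(3) by simp
  have "x - y = (to_fract (hat F) * to_fract (hat G') - to_fract (hat G) * to_fract (hat F')) /
      (to_fract (hat G) * to_fract (hat G'))"
    unfolding F(4) F'(4) using nz by (subst diff_frac_eq) (simp_all add: mult.commute)
  then have "x - y = to_fract (hat F * hat G' - hat G * hat F') / to_fract (hat G * hat G')"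
    by simp
  then show "x - y \<in> germs" using germs_I[OF biform_diff[OF bi(1,3)] bi(2) *] unfolding hats by simp
  have "x * y = to_fract (hat F * hat F') / to_fract (hat G * hat G')" unfolding F(4) F'(4) by simp
  then show "x * y \<in> germs" using germs_I[OF bi(4,2) *] unfolding hats by simp
qed

lemma const_mem_germs: "to_fract [:c:] \<in> germs"
  using germs_I[OF biform_const[of c] biform_const[of 1]] by (simp flip: one_pCons)

text \<open>
  Separation turns the denominator of \<open>x\<close> into a pullback of a form that is nonzero at the point, with room
  in the degree for the numerator, and \<open>C\<close> turns the numerator into a pullback of the same bidegree.
\<close>

lemma conductor_germs: "\<exists>n0. vanishing D n0 \<subseteq> germs"
proof -
  obtain C m0 where C: "C \<noteq> 0" "\<And>m n f. degree f \<le> m * d + n * \<delta> \<Longrightarrow> \<exists>F. biform (m + m0) n F \<and> hat F = C * f"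
    using conductor_exists by metis
  have mult: "to_fract C * x \<in> germs" if x: "x \<in> localization D" for x
  proof -
    obtain f q where fq: "x = to_fract f / to_fract q" "\<forall>s. poly D s = 0 \<longrightarrow> poly q s \<noteq> 0"
      using x unfolding localization_def by blast
    have q0: "q \<noteq> 0" by (rule unit_bezout(1)[OF fq(2)])
    \<comment> \<open>The margin absorbs the degree of the numerator and the shift by \<open>m0\<close>.\<close>
    define N where "N = degree f + m0 * d + m0"
    obtain m n B where B: "biform m n B" "B t0 y0 \<noteq> 0" "q dvd hat B"
      "degree (hat B) + N \<le> m * d + n * \<delta>" "N \<le> m"
      using separation[of q N] q0 fq(2) by blast
    obtain q' where q': "hat B = q * q'" using B(3) by (rule dvdE)
    have nz: "q' \<noteq> 0" using hat_nonzero[OF B(1,2)] q' by auto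
    have "m0 \<le> m" using B(5) unfolding N_def by simp
    then obtain m1 where m1: "m = m1 + m0" by (metis add.commute le_Suc_ex)
    have "degree (f * q') \<le> degree f + degree q'" by (rule degree_mult_le)
    also have "\<dots> \<le> degree f + degree (hat B)" unfolding q' using q0 nz by (simp add: degree_mult_eq)
    also have "\<dots> \<le> m1 * d + n * \<delta>" using B(4) unfolding N_def m1 by (simp add: algebra_simps)
    finally obtain F where F: "biform (m1 + m0) n F" "hat F = C * (f * q')" using C(2) by blast
    have "to_fract (hat F) / to_fract (hat B) = to_fract C * x"
      unfolding F(2) q' fq(1) using nz by simp
    then show ?thesis using germs_I[OF F(1)[folded m1] B(1,2)] by simp
  qed
  obtain n0 y where y: "y \<in> localization D" "to_fract (D ^ n0) = to_fract C * y"
    using vanishing_subset_multiples[OF C(1)] by blast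
  have "vanishing D n0 \<subseteq> germs"
  proof
    fix z assume "z \<in> vanishing D n0"
    then obtain u where "u \<in> localization D" "z = to_fract C * (y * u)"
      unfolding vanishing_def y(2) by (auto simp: mult.assoc)
    then show "z \<in> germs" using mult O.mult_mem[OF y(1)] by blast
  qed
  then show ?thesis by blast
qed

lemma germ_ring_germs: "\<exists>n0. germ_ring D germs n0"
proof -
  obtain n0 where n0: "vanishing D n0 \<subseteq> germs" using conductor_germs by blast
  have "germ_ring D germs n0"
  proof
    show "to_fract [:c:] \<in> germs" for c by (rule const_mem_germs)
    show "vanishing D n0 \<subseteq> germs" by (rule n0)
    show "germs \<subseteq> localization D"
    proof
      fix x assume "x \<in> germs"
      then obtain m n F G where F: "biform m n G" "G t0 y0 \<noteq> 0" "x = to_fract (hat F) / to_fract (hat G)"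
        by (rule germs_E)
      then have "\<forall>s. poly D s = 0 \<longrightarrow> poly (hat G) s \<noteq> 0" using hat_at_zero by blast
      then show "x \<in> localization D" unfolding localization_def F(3) by blast
    qed
    show "inverse x \<in> germs" if x: "x \<in> germs" "x \<notin> vanishing D 1" for x
    proof -
      obtain m n F G where F: "biform m n F" "biform m n G" "G t0 y0 \<noteq> 0" "x = to_fract (hat F) / to_fract (hat G)"
        using x(1) by (rule germs_E)
      then have "F t0 y0 \<noteq> 0" using fraction_mem_vanishing[OF F(1) _ F(2,3)] x(2) by blast
      then show ?thesis using germs_I[OF F(2,1)] unfolding F(4) by simp
    qed
    show "\<exists>c. x - to_fract [:c:] \<in> vanishing D 1" if x: "x \<in> germs" for x
    proof -
      obtain m n F G where F: "biform m n F" "biform m n G" "G t0 y0 \<noteq> 0" "x = to_fract (hat F) / to_fract (hat G)"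
        using x by (rule germs_E)
      define c where "c = F t0 y0 / G t0 y0"
      have bi: "biform m n (\<lambda>v y. c * G v y)" by (rule biform_scale[OF F(2)])
      have "hat (\<lambda>v y. c * G v y) = [:c:] * hat G"
        by (rule pullback_eqI) (simp add: poly_pullback[OF F(2)])
      then have "hat (\<lambda>v y. F v y - c * G v y) = hat F - [:c:] * hat G"
        by (simp only: pullback_diff[OF F(1) bi])
      then have "to_fract (hat (\<lambda>v y. F v y - c * G v y)) / to_fract (hat G) = x - to_fract [:c:]"
        using hat_nonzero[OF F(2,3)] unfolding F(4)
        by (simp only: to_fract_diff to_fract_mult diff_divide_distrib) simp
      moreover have "F t0 y0 - c * G t0 y0 = 0" unfolding c_def using F(3) by simp
      ultimately show ?thesis
        using fraction_mem_vanishing[OF biform_diff[OF F(1) bi] _ F(2,3)] by metis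
    qed
    show "to_fract D \<in> A"
      if m: "germs \<inter> vanishing D 1 \<subseteq> A" and add: "\<And>x y. x \<in> A \<Longrightarrow> y \<in> A \<Longrightarrow> x + y \<in> A"
        and scale: "\<And>x y. x \<in> A \<Longrightarrow> y \<in> localization D \<Longrightarrow> y * x \<in> A" for A
    proof -
      have hat_in_A: "to_fract (hat F) \<in> A"
        if "biform m n F" "F t0 y0 = 0" "biform m n G" "G t0 y0 \<noteq> 0" for m n F G
      proof -
        have "to_fract (hat F) / to_fract (hat G) \<in> A"
          using fraction_mem_vanishing[OF that] germs_I[OF that(1,3,4)] m by blast
        then have "to_fract (hat G) * (to_fract (hat F) / to_fract (hat G)) \<in> A"
          using poly_mem_localization by (rule scale)
        then show ?thesis using hat_nonzero[OF that(3,4)] by simp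
      qed
      have g: "to_fract (g $ 1) \<in> A" "to_fract (g $ 2) \<in> A"
        using hat_in_A[OF biform_fst[of 1] _ biform_fst[of 3]] hat_in_A[OF biform_fst[of 2] _ biform_fst[of 3]]
        by simp_all
      obtain x y where xy: "x * w $ 1 + y * w $ 2 = 1"
        using bezout_pair[of "w $ 1" "w $ 2"] w_no_zero by (metis exhaust_2)
      have "h = (x * w $ 1 + y * w $ 2) * h" using xy by simp
      also have "\<dots> = x * g $ 1 + y * g $ 2" unfolding g1 g2 by (simp add: algebra_simps)
      finally have "to_fract h = to_fract x * to_fract (g $ 1) + to_fract y * to_fract (g $ 2)" by simp
      then have hA: "to_fract h \<in> A" using add scale g poly_mem_localization by simp
      obtain a' b' where ab': "a' * a + b' * b = 1" using hat_cong by metis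
      define R where "R = (\<lambda>(v :: 'a ^ 3) (y :: 'a ^ 2). b * y $ 1 - a * y $ 2)"
      define L where "L = (\<lambda>(v :: 'a ^ 3) (y :: 'a ^ 2). a' * y $ 1 + b' * y $ 2)"
      have "to_fract (hat R) \<in> A"
      proof (rule hat_in_A)
        show "biform 0 1 R" unfolding R_def by (intro biform_diff biform_scale biform_snd)
        show "biform 0 1 L" unfolding L_def by (intro biform_add biform_scale biform_snd)
        show "R t0 y0 = 0" "L t0 y0 \<noteq> 0" unfolding R_def L_def using ab' by (simp_all add: mult.commute)
      qed
      moreover have "hat R = r" unfolding R_def by (rule pullback_eqI) (simp add: eval_vec_def)
      ultimately have rA: "to_fract r \<in> A" by simp
      obtain x y where "D = x * h + y * r" using D_bezout by blast
      then have "to_fract D = to_fract x * to_fract h + to_fract y * to_fract r"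
        by (simp only: to_fract_add to_fract_mult)
      then show ?thesis using add scale hA rA poly_mem_localization by metis
    qed
  qed
  then show ?thesis by blast
qed

subsection \<open>Germs as rational functions of the parameter\<close>

definition represents where
  "represents f F G \<longleftrightarrow> (\<forall>x y. (x, y) \<in> V \<longrightarrow> G (coords x) (coords y) \<noteq> 0 \<longrightarrow>
     f (x, y) = F (coords x) (coords y) / G (coords x) (coords y))"

text \<open>
  The functions that represent germs are defined on the whole ambient space and constrained near the
  point only, so many of them have the same germ.
\<close>

definition regular :: "(('a, 3) pspace \<times> ('a, 2) pspace \<Rightarrow> 'a) set" where
  "regular = {f. \<exists>m n F G. biform m n F \<and> biform m n G \<and> G t0 y0 \<noteq> 0 \<and> represents f F G}"

definition germ :: "(('a, 3) pspace \<times> ('a, 2) pspace \<Rightarrow> 'a) \<Rightarrow> 'a poly fract" where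
  "germ f = (SOME x. \<exists>m n F G. biform m n F \<and> biform m n G \<and> G t0 y0 \<noteq> 0 \<and> represents f F G \<and>
     x = to_fract (hat F) / to_fract (hat G))"

lemma regular_at_eq: "regular_at forms_on_product V P = ring_on regular"
proof -
  have "(\<exists>A\<in>forms_on_product. \<exists>F\<in>A. \<exists>G\<in>A. G P \<noteq> 0 \<and> (\<forall>x\<in>V. G x \<noteq> 0 \<longrightarrow> f x = F x / G x)) \<longleftrightarrow>
      (\<exists>m n F G. biform m n F \<and> biform m n G \<and> G t0 y0 \<noteq> 0 \<and> represents f F G)" for f
  proof -
    have "(\<exists>A\<in>forms_on_product. \<exists>F\<in>A. \<exists>G\<in>A. G P \<noteq> 0 \<and> (\<forall>x\<in>V. G x \<noteq> 0 \<longrightarrow> f x = F x / G x)) \<longleftrightarrow>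
      (\<exists>m n F G. biform m n F \<and> biform m n G \<and> G (coords base_point) (coords (proj y0)) \<noteq> 0 \<and> represents f F G)"
      unfolding forms_on_product_ex2 represents_def Ball_def split_paired_All prod.case ..
    then show ?thesis by (simp add: eval_P_zero_iff cong: conj_cong)
  qed
  then show ?thesis unfolding regular_at_eq_ring_on regular_def by simp
qed

lemma locally_zero_at_eq:
  "locally_zero_at forms_on_product V P =
     {f. \<exists>m n G. biform m n G \<and> G t0 y0 \<noteq> 0 \<and> represents f (\<lambda>_ _. 0) G}"
proof -
  have "(\<exists>A\<in>forms_on_product. \<exists>G\<in>A. G P \<noteq> 0 \<and> (\<forall>x\<in>V. G x \<noteq> 0 \<longrightarrow> f x = 0)) \<longleftrightarrow>
      (\<exists>m n G. biform m n G \<and> G (coords base_point) (coords (proj y0)) \<noteq> 0 \<and> represents f (\<lambda>_ _. 0) G)" for f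
    unfolding forms_on_product_ex1 represents_def Ball_def split_paired_All prod.case div_0 ..
  then show ?thesis unfolding locally_zero_at_def by (simp add: eval_P_zero_iff cong: conj_cong)
qed

text \<open>
  After multiplication by both denominators the difference of the two fractions vanishes on all of \<open>Z\<close>, and
  a form with that property has zero pullback.
\<close>

lemma represents_unique:
  assumes F: "biform m n F" "biform m n G" "G t0 y0 \<noteq> 0" "represents f F G"
    and F': "biform m' n' F'" "biform m' n' G'" "G' t0 y0 \<noteq> 0" "represents f F' G'"
  shows "to_fract (hat F) / to_fract (hat G) = to_fract (hat F') / to_fract (hat G')"
proof -
  let ?K = "\<lambda>v y. (F v y * G' v y - G v y * F' v y) * (G v y * G' v y)"
  have bi: "biform (m + m') (n + n') (\<lambda>v y. F v y * G' v y)" "biform (m + m') (n + n') (\<lambda>v y. G v y * F' v y)"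
    "biform (m + m') (n + n') (\<lambda>v y. G v y * G' v y)"
    by (intro biform_mult F F')+
  have K: "biform ((m + m') + (m + m')) ((n + n') + (n + n')) ?K"
    by (intro biform_mult[OF biform_diff] bi)
  have "?K (coords x) (coords y) = 0" if "(x, y) \<in> Z" for x y
  proof (cases "G (coords x) (coords y) = 0 \<or> G' (coords x) (coords y) = 0")
    case False
    have "(x, y) \<in> V" using Z_subset_V that by blast
    then have "F (coords x) (coords y) / G (coords x) (coords y) = F' (coords x) (coords y) / G' (coords x) (coords y)"
      using F(4) F'(4) False unfolding represents_def by metis
    then show ?thesis using False by (simp add: frac_eq_eq mult.commute)
  qed auto
  then have "hat ?K = 0" using Z[OF K] hat_zero_iff[OF K] by blast
  moreover have "hat ?K = (hat F * hat G' - hat G * hat F') * (hat G * hat G')"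
    by (simp add: pullback_mult[OF biform_diff[OF bi(1,2)] bi(3)] pullback_diff[OF bi(1,2)]
        pullback_mult[OF F(1) F'(2)] pullback_mult[OF F(2) F'(1)] pullback_mult[OF F(2) F'(2)])
  ultimately have "hat F * hat G' = hat G * hat F'"
    using hat_nonzero[OF F(2,3)] hat_nonzero[OF F'(2,3)] by simp
  then have "to_fract (hat F) * to_fract (hat G') = to_fract (hat F') * to_fract (hat G)"
    by (metis mult.commute to_fract_mult)
  then show ?thesis using hat_nonzero[OF F(2,3)] hat_nonzero[OF F'(2,3)] by (simp add: frac_eq_eq)
qed

lemma germ_eq:
  assumes "biform m n F" "biform m n G" "G t0 y0 \<noteq> 0" "represents f F G"
  shows "germ f = to_fract (hat F) / to_fract (hat G)"
  unfolding germ_def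
proof (rule some_equality)
  show "\<exists>m n F' G'. biform m n F' \<and> biform m n G' \<and> G' t0 y0 \<noteq> 0 \<and> represents f F' G' \<and>
     to_fract (hat F) / to_fract (hat G) = to_fract (hat F') / to_fract (hat G')"
    using assms by blast
  fix x assume "\<exists>m n F G. biform m n F \<and> biform m n G \<and> G t0 y0 \<noteq> 0 \<and> represents f F G \<and>
     x = to_fract (hat F) / to_fract (hat G)"
  then show "x = to_fract (hat F) / to_fract (hat G)" using represents_unique assms by blast
qed

lemma regular_E:
  assumes "f \<in> regular"
  obtains m n F G where "biform m n F" "biform m n G" "G t0 y0 \<noteq> 0" "represents f F G"
    "germ f = to_fract (hat F) / to_fract (hat G)" "hat G \<noteq> 0"
proof -
  obtain m n F G where *: "biform m n F" "biform m n G" "G t0 y0 \<noteq> 0" "represents f F G"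
    using assms unfolding regular_def by blast
  show thesis by (rule that[OF * germ_eq[OF *] hat_nonzero[OF *(2,3)]])
qed

lemma regular_operations:
  assumes "f \<in> regular" "f' \<in> regular"
  shows "f - f' \<in> regular" "germ (f - f') = germ f - germ f'"
    and "f * f' \<in> regular" "germ (f * f') = germ f * germ f'"
proof -
  obtain m n F G where F: "biform m n F" "biform m n G" "G t0 y0 \<noteq> 0" "represents f F G"
    "germ f = to_fract (hat F) / to_fract (hat G)" "hat G \<noteq> 0"
    using assms(1) by (rule regular_E)
  obtain m' n' F' G' where F': "biform m' n' F'" "biform m' n' G'" "G' t0 y0 \<noteq> 0" "represents f' F' G'"
    "germ f' = to_fract (hat F') / to_fract (hat G')" "hat G' \<noteq> 0"
    using assms(2) by (rule regular_E)
  have bi: "biform (m + m') (n + n') (\<lambda>v y. F v y * G' v y)" "biform (m + m') (n + n') (\<lambda>v y. G v y * F' v y)"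
    "biform (m + m') (n + n') (\<lambda>v y. G v y * G' v y)" "biform (m + m') (n + n') (\<lambda>v y. F v y * F' v y)"
    by (intro biform_mult F F')+
  have hats: "hat (\<lambda>v y. F v y * G' v y - G v y * F' v y) = hat F * hat G' - hat G * hat F'"
    "hat (\<lambda>v y. F v y * F' v y) = hat F * hat F'" "hat (\<lambda>v y. G v y * G' v y) = hat G * hat G'"
    by (simp_all add: pullback_diff[OF bi(1,2)] pullback_mult[OF F(1) F'(2)]
        pullback_mult[OF F(2) F'(1)] pullback_mult[OF F(1) F'(1)] pullback_mult[OF F(2) F'(2)])
  have nz: "G t0 y0 * G' t0 y0 \<noteq> 0" using F(3) F'(3) by simp
  have diff: "represents (f - f') (\<lambda>v y. F v y * G' v y - G v y * F' v y) (\<lambda>v y. G v y * G' v y)"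
    using F(4) F'(4) unfolding represents_def by (simp add: diff_frac_eq mult.commute)
  have mult: "represents (f * f') (\<lambda>v y. F v y * F' v y) (\<lambda>v y. G v y * G' v y)"
    using F(4) F'(4) unfolding represents_def by simp
  show "f - f' \<in> regular" using biform_diff[OF bi(1,2)] bi(3) nz diff unfolding regular_def by blast
  show "f * f' \<in> regular" using bi(3,4) nz mult unfolding regular_def by blast
  show "germ (f - f') = germ f - germ f'"
    using germ_eq[OF biform_diff[OF bi(1,2)] bi(3) nz diff] F(6) F'(6)
    unfolding hats F(5) F'(5) by (simp add: diff_frac_eq mult.commute)
  show "germ (f * f') = germ f * germ f'"
    using germ_eq[OF bi(4,3) nz mult] unfolding hats F(5) F'(5) by simp
qed

lemma const_regular: "(\<lambda>_. c) \<in> regular" "germ (\<lambda>_. c) = to_fract [:c:]"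
proof -
  have rep: "represents (\<lambda>_. c) (\<lambda>_ _. c) (\<lambda>_ _. 1)" unfolding represents_def by simp
  then show "(\<lambda>_. c) \<in> regular"
    unfolding regular_def
    by (intro CollectI exI[of _ 0] exI[of _ "\<lambda>_ _. c"] exI[of _ "\<lambda>_ _. 1"] conjI biform_const) simp_all
  show "germ (\<lambda>_. c) = to_fract [:c:]"
    using germ_eq[OF biform_const biform_const _ rep] by (simp flip: one_pCons)
qed

sublocale regular: unital_subring regular
proof
  show "1 \<in> regular" using const_regular(1)[of 1] by (simp add: one_fun_def)
qed (fact regular_operations)+

lemma germ_add:
  assumes "f \<in> regular" "f' \<in> regular" shows "germ (f + f') = germ f + germ f'"
proof -
  have "germ (f + f' - f') = germ (f + f') - germ f'"
    by (rule regular_operations(2)[OF regular.add_mem[OF assms] assms(2)])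
  then show ?thesis by simp
qed

lemma ring_hom_germ: "ring_hom_ring (ring_on regular) (ring_on germs) germ"
proof (rule ring_hom_ringI)
  show "ring (ring_on regular)" "ring (ring_on germs)"
    by (rule cring.axioms(1)[OF regular.cring_ring_on], rule cring.axioms(1)[OF germs.cring_ring_on])
  show "germ f \<in> carrier (ring_on germs)" if "f \<in> carrier (ring_on regular)" for f
    using that germs_I by (auto elim!: regular_E)
  show "germ \<one>\<^bsub>ring_on regular\<^esub> = \<one>\<^bsub>ring_on germs\<^esub>"
    using const_regular(2)[of 1] by (simp add: one_fun_def flip: one_pCons)
qed (simp_all add: germ_add regular_operations)

lemma germ_surj: "germ ` carrier (ring_on regular) = carrier (ring_on germs)"
proof
  show "germ ` carrier (ring_on regular) \<subseteq> carrier (ring_on germs)"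
    by (rule image_subsetI) (rule ring_hom_closed[OF ring_hom_ring.homh[OF ring_hom_germ]])
  show "carrier (ring_on germs) \<subseteq> germ ` carrier (ring_on regular)"
  proof
    fix x assume "x \<in> carrier (ring_on germs)"
    then have "x \<in> germs" by simp
    then obtain m n F G where F: "biform m n F" "biform m n G" "G t0 y0 \<noteq> 0" "x = to_fract (hat F) / to_fract (hat G)"
      by (rule germs_E)
    define f where "f = (\<lambda>(x, y). F (coords x) (coords y) / G (coords x) (coords y))"
    have rep: "represents f F G" unfolding represents_def f_def by simp
    then have "f \<in> regular" using F unfolding regular_def by blast
    moreover have "germ f = x" using germ_eq[OF F(1-3) rep] F(4) by simp
    ultimately show "x \<in> germ ` carrier (ring_on regular)" by auto
  qed
qed

lemma kernel_germ: "a_kernel (ring_on regular) (ring_on germs) germ = locally_zero_at forms_on_product V P"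
proof -
  have "f \<in> regular \<and> germ f = 0 \<longleftrightarrow> (\<exists>m n G. biform m n G \<and> G t0 y0 \<noteq> 0 \<and> represents f (\<lambda>_ _. 0) G)" for f
  proof
    assume f: "f \<in> regular \<and> germ f = 0"
    then have "f \<in> regular" ..
    then obtain m n F G where F: "biform m n F" "biform m n G" "G t0 y0 \<noteq> 0" "represents f F G"
      "germ f = to_fract (hat F) / to_fract (hat G)" "hat G \<noteq> 0" by (rule regular_E)
    then have "hat F = 0" using f by simp
    then have "represents f (\<lambda>_ _. 0) G"
      using F(1,4) unfolding represents_def mem_V_iff by auto
    then show "\<exists>m n G. biform m n G \<and> G t0 y0 \<noteq> 0 \<and> represents f (\<lambda>_ _. 0) G" using F by blast
  next
    assume "\<exists>m n G. biform m n G \<and> G t0 y0 \<noteq> 0 \<and> represents f (\<lambda>_ _. 0) G"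
    then obtain m n G where G: "biform m n G" "G t0 y0 \<noteq> 0" "represents f (\<lambda>_ _. 0) G" by blast
    have "f \<in> regular" using G biform_zero[of m n] unfolding regular_def by blast
    moreover have "germ f = 0" using germ_eq[OF biform_zero G] by simp
    ultimately show "f \<in> regular \<and> germ f = 0" by blast
  qed
  then show ?thesis unfolding locally_zero_at_eq a_kernel_def' by simp
qed

theorem multiplicity_blowup: "has_multiplicity (local_ring forms_on_product V P) (degree D)"
proof -
  interpret hom: ring_hom_ring "ring_on regular" "ring_on germs" germ by (rule ring_hom_germ)
  obtain n0 where "germ_ring D germs n0" using germ_ring_germs by blast
  then interpret S: germ_ring D germs n0 .
  have loc: "local_ring forms_on_product V P =
      ring_on regular Quot a_kernel (ring_on regular) (ring_on germs) germ"
    unfolding local_ring_def regular_at_eq kernel_germ ..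
  have quot: "cring (local_ring forms_on_product V P)"
    unfolding loc by (intro ideal.quotient_is_cring hom.kernel_is_ideal regular.cring_ring_on)
  have "local_ring forms_on_product V P \<simeq> ring_on germs"
    unfolding loc by (rule hom.FactRing_iso[OF germ_surj])
  then obtain \<phi> where "\<phi> \<in> ring_iso (local_ring forms_on_product V P) (ring_on germs)"
    unfolding is_ring_iso_def by blast
  then have "ring_isomorphism (local_ring forms_on_product V P) (ring_on germs) \<phi>"
    by (intro ring_isomorphism.intro ring_isomorphism_axioms.intro quot germs.cring_ring_on)
  then have "ring_isomorphism (ring_on germs) (local_ring forms_on_product V P)
      (inv_into (carrier (local_ring forms_on_product V P)) \<phi>)"
    by (rule ring_isomorphism.inverse)
  then show ?thesis
    by (rule ring_isomorphism.has_multiplicity_transfer[OF _ S.has_multiplicity_degree])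
qed

end


section \<open>Binary forms and lines through the origin\<close>

lemma eval2_simps [simp]:
  "eval2 0 v = 0" "eval2 1 v = 1" "eval2 (f + f') v = eval2 f v + eval2 f' v"
  "eval2 (f - f') v = eval2 f v - eval2 f' v" "eval2 (- f) v = - eval2 f v"
  "eval2 (f * f') v = eval2 f v * eval2 f' v"
  "eval2 (smult c f) v = poly c (v $ 1) * eval2 f v"
  "eval2 (pCons c f) v = poly c (v $ 1) + v $ 2 * eval2 f v"
  unfolding eval2_def by simp_all

lemma eval2_eq_zero_imp_zero:
  fixes f :: "'k::alg_closed_field poly poly"
  assumes "\<And>v. eval2 f v = 0" shows "f = 0"
proof (rule ccontr)
  assume "f \<noteq> 0"
  then have fin: "finite {p. poly f p = 0}" by (rule poly_roots_finite)
  have "poly f [:y:] = 0" for y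
  proof (rule poly_ext)
    fix x
    show "poly (poly f [:y:]) x = poly 0 x" using assms[of "vector [x, y]"] by (simp add: eval2_def vector_2)
  qed
  then have "range (\<lambda>y. [:y:]) \<subseteq> {p. poly f p = 0}" by blast
  then have "finite (range (\<lambda>y :: 'k. [:y:]))" using fin by (rule finite_subset)
  then have "finite (UNIV :: 'k set)" by (rule finite_imageD) (simp add: inj_def)
  then show False using infinite_UNIV_alg_closed by blast
qed

text \<open>The restriction of a polynomial in two variables to the parametrized line \<open>s \<mapsto> u + s v\<close>.\<close>

definition on_line :: "'k::field ^ 2 \<Rightarrow> 'k ^ 2 \<Rightarrow> 'k poly poly \<Rightarrow> 'k poly" where
  "on_line u v f = (THE p. \<forall>s. poly p s = eval2 f (u + s *s v))"

lemma on_line_eqI: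
  fixes p :: "'k::alg_closed_field poly"
  assumes "\<And>s. poly p s = eval2 f (u + s *s v)" shows "on_line u v f = p"
  unfolding on_line_def by (rule the_equality) (use assms in \<open>auto intro: poly_ext\<close>)

lemma poly_on_line [simp]:
  fixes f :: "'k::alg_closed_field poly poly"
  shows "poly (on_line u v f) s = eval2 f (u + s *s v)"
proof -
  have "\<exists>p. \<forall>s. poly p s = eval2 f (u + s *s v)"
  proof (induction f)
    case 0
    then show ?case by (intro exI[of _ 0]) simp
  next
    case (pCons c f)
    then obtain p where p: "\<forall>s. poly p s = eval2 f (u + s *s v)" by blast
    show ?case
      by (rule exI[of _ "pcompose c [:u $ 1, v $ 1:] + [:u $ 2, v $ 2:] * p"])
        (simp add: p poly_pcompose distrib_right)
  qed
  then show ?thesis using on_line_eqI by metis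
qed

lemma on_line_simps [simp]:
  fixes f :: "'k::alg_closed_field poly poly"
  shows "on_line u v 0 = 0" "on_line u v 1 = 1" "on_line u v (f + f') = on_line u v f + on_line u v f'"
    "on_line u v (f - f') = on_line u v f - on_line u v f'" "on_line u v (- f) = - on_line u v f"
    "on_line u v (f * f') = on_line u v f * on_line u v f'" "on_line u v (smult [:c:] f) = smult c (on_line u v f)"
  by (rule on_line_eqI; simp)+

lemma on_line_power: "on_line u v (f ^ n) = on_line u v f ^ n" for f :: "'k::alg_closed_field poly poly"
  by (induction n) simp_all

lemma on_line_dvd: "f dvd f' \<Longrightarrow> on_line u v f dvd on_line u v f'" for f :: "'k::alg_closed_field poly poly"
  by (auto elim!: dvdE)

subsection \<open>Evaluating forms\<close>

lemma binary_form_eval: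
  assumes f: "binary_form n f"
  shows "eval2 f v = (\<Sum>i\<le>n. coeff (coeff f i) (n - i) * (v $ 1 ^ (n - i) * v $ 2 ^ i))"
proof -
  have c: "coeff f i = monom (coeff (coeff f i) (n - i)) (n - i)" if "i \<le> n" for i
  proof (rule poly_eqI)
    fix j
    have "coeff (coeff f i) j \<noteq> 0 \<Longrightarrow> j = n - i" using f that unfolding binary_form_def by fastforce
    then show "coeff (coeff f i) j = coeff (monom (coeff (coeff f i) (n - i)) (n - i)) j" by auto
  qed
  have "degree f \<le> n"
  proof (rule degree_le, intro allI impI)
    fix i assume "n < i"
    then show "coeff f i = 0" using f unfolding binary_form_def by (intro poly_eqI) fastforce
  qed
  then have "eval2 f v = (\<Sum>i\<le>n. poly (coeff f i) (v $ 1) * v $ 2 ^ i)"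
    unfolding eval2_def by (simp add: poly_eq_sum poly_sum poly_power)
  also have "\<dots> = (\<Sum>i\<le>n. coeff (coeff f i) (n - i) * (v $ 1 ^ (n - i) * v $ 2 ^ i))"
  proof (rule sum.cong[OF refl])
    fix i assume "i \<in> {..n}"
    then have "poly (coeff f i) (v $ 1) = coeff (coeff f i) (n - i) * v $ 1 ^ (n - i)"
      using c[of i] by (metis atMost_iff poly_monom)
    then show "poly (coeff f i) (v $ 1) * v $ 2 ^ i = coeff (coeff f i) (n - i) * (v $ 1 ^ (n - i) * v $ 2 ^ i)"
      by simp
  qed
  finally show ?thesis .
qed

lemma binary_form_homogeneous:
  assumes "binary_form n f" shows "eval2 f (c *s v) = c ^ n * eval2 f v"
  unfolding binary_form_eval[OF assms] sum_distrib_left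
proof (rule sum.cong[OF refl])
  fix i assume "i \<in> {..n}"
  then have "c ^ n = c ^ (n - i) * c ^ i" by (simp flip: power_add)
  then show "coeff (coeff f i) (n - i) * ((c *s v) $ 1 ^ (n - i) * (c *s v) $ 2 ^ i) =
      c ^ n * (coeff (coeff f i) (n - i) * (v $ 1 ^ (n - i) * v $ 2 ^ i))"
    by (simp add: power_mult_distrib)
qed

lemma coeff_mult_top:
  assumes "degree p \<le> m" "degree q \<le> n"
  shows "coeff (p * q) (m + n) = coeff p m * coeff q n"
proof (cases "degree p = m \<and> degree q = n")
  case True
  then show ?thesis using coeff_mult_degree_sum[of p q] by simp
next
  case False
  then have "degree (p * q) < m + n" using degree_mult_le[of p q] assms by linarith
  moreover have "coeff p m = 0 \<or> coeff q n = 0" using False assms by (metis coeff_eq_0 le_neq_implies_less)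
  ultimately show ?thesis by (auto simp: coeff_eq_0)
qed

text \<open>The value at \<open>v\<close>, the point at infinity of the line, is the coefficient in the top degree.\<close>

lemma on_line_form:
  fixes f :: "'k::alg_closed_field poly poly"
  assumes f: "binary_form n f"
  shows "degree (on_line u v f) \<le> n" "coeff (on_line u v f) n = eval2 f v"
proof -
  define p where "p i = [:u $ 1, v $ 1:] ^ (n - i) * [:u $ 2, v $ 2:] ^ i" for i
  have on_line: "on_line u v f = (\<Sum>i\<le>n. smult (coeff (coeff f i) (n - i)) (p i))"
    by (rule on_line_eqI) (simp add: binary_form_eval[OF f] poly_sum p_def poly_power)
  have deg: "degree ([:x, y:] ^ k) \<le> k" for x y :: 'k and k
    using degree_power_le[of "[:x, y:]" k] by (simp split: if_splits)
  have p: "degree (p i) \<le> n \<and> coeff (p i) n = v $ 1 ^ (n - i) * v $ 2 ^ i" if "i \<le> n" for i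
  proof
    have "degree (p i) \<le> (n - i) + i"
      unfolding p_def by (intro order_trans[OF degree_mult_le] add_mono deg)
    then show "degree (p i) \<le> n" using that by simp
    have "coeff (p i) ((n - i) + i) = coeff ([:u $ 1, v $ 1:] ^ (n - i)) (n - i) * coeff ([:u $ 2, v $ 2:] ^ i) i"
      unfolding p_def by (rule coeff_mult_top[OF deg deg])
    then show "coeff (p i) n = v $ 1 ^ (n - i) * v $ 2 ^ i"
      using that by (simp add: coeff_linear_poly_power)
  qed
  show "degree (on_line u v f) \<le> n"
    unfolding on_line using p by (intro degree_sum_le) (auto intro: order_trans[OF degree_smult_le])
  show "coeff (on_line u v f) n = eval2 f v"
    unfolding on_line binary_form_eval[OF f] coeff_sum using p by simp
qed

lemma degree_on_line_form:
  fixes f :: "'k::alg_closed_field poly poly"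
  assumes "binary_form n f" "eval2 f v \<noteq> 0"
  shows "degree (on_line u v f) = n" "on_line u v f \<noteq> 0"
proof -
  show "degree (on_line u v f) = n"
    using on_line_form[OF assms(1), of u v] assms(2) by (metis antisym le_degree)
  show "on_line u v f \<noteq> 0" using on_line_form(2)[OF assms(1), of u v] assms(2) by auto
qed

subsection \<open>Linear factors\<close>

definition line :: "'k::field ^ 2 \<Rightarrow> 'k poly poly" where
  "line v = [:[:0, v $ 2:], [:- v $ 1:]:]"

lemma eval2_line: "eval2 (line v) z = v $ 2 * z $ 1 - v $ 1 * z $ 2"
  unfolding line_def by simp

lemma vec2_eq_iff: "(u :: 'a ^ 2) = v \<longleftrightarrow> u $ 1 = v $ 1 \<and> u $ 2 = v $ 2"
  by (simp add: vec_eq_iff forall_2)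

lemma line_nonzero: "v \<noteq> 0 \<Longrightarrow> line v \<noteq> 0"
  unfolding line_def vec2_eq_iff by auto

lemma poly_poly_eq: "poly (poly f q) x = poly (poly f [:poly q x:]) x"
  by (induction f) simp_all

text \<open>\<open>line v\<close> is the prime that defines the line spanned by \<open>v\<close>.\<close>

lemma line_dvd_iff:
  fixes f :: "'k::alg_closed_field poly poly"
  assumes v: "v \<noteq> 0"
  shows "line v dvd f \<longleftrightarrow> on_line 0 v f = 0"
proof
  assume "line v dvd f"
  then have "on_line 0 v (line v) dvd on_line 0 v f" by (rule on_line_dvd)
  moreover have "on_line 0 v (line v) = 0" by (rule on_line_eqI) (simp add: eval2_line)
  ultimately show "on_line 0 v f = 0" by simp
next
  assume zero: "on_line 0 v f = 0"
  have ev: "eval2 f (s *s v) = 0" for s using poly_on_line[of 0 v f s] unfolding zero by simp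
  show "line v dvd f"
  proof (cases "v $ 1 = 0")
    case False
    define q where "q = [:0, v $ 2 / v $ 1:]"
    have "poly f q = 0"
    proof (rule poly_ext)
      fix x
      have "(x / v $ 1) *s v = vector [x, poly q x]"
        unfolding vec2_eq_iff q_def using False by (simp add: vector_2 mult.commute)
      then have "eval2 f (vector [x, poly q x]) = 0" using ev[of "x / v $ 1"] by simp
      then show "poly (poly f q) x = poly 0 x"
        by (subst poly_poly_eq) (simp add: eval2_def vector_2)
    qed
    then have "[:- q, 1:] dvd f" by (simp add: poly_eq_0_iff_dvd)
    moreover have "[:- q, 1:] = line v * [:[:- inverse (v $ 1):]:]"
      unfolding line_def q_def using False by (simp add: one_pCons divide_inverse)
    ultimately show ?thesis by (metis dvd_trans dvd_triv_left)
  next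
    case True
    then have v2: "v $ 2 \<noteq> 0" using v unfolding vec2_eq_iff by simp
    have "map_poly (\<lambda>p. poly p 0) f = 0"
    proof (rule poly_ext)
      fix x
      have "poly (map_poly (\<lambda>p. poly p 0) f) x = poly (poly f [:x:]) 0"
        by (induction f) (simp_all add: map_poly_pCons)
      also have "\<dots> = eval2 f ((x / v $ 2) *s v)"
        unfolding eval2_def using True v2 by simp
      finally show "poly (map_poly (\<lambda>p. poly p 0) f) x = poly 0 x" using ev by simp
    qed
    then have "poly (coeff f i) 0 = 0" for i
      using coeff_map_poly[of "\<lambda>p. poly p 0" f i] by simp
    then have "[:0, 1:] dvd coeff f i" for i
      using poly_eq_0_iff_dvd[of "coeff f i" 0] by simp
    moreover have "[:0, 1:] = [:0, v $ 2:] * [:inverse (v $ 2):]" using v2 by simp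
    ultimately have "[:0, v $ 2:] dvd coeff f i" for i by (metis dvd_trans dvd_triv_left)
    then show ?thesis unfolding line_def using True by (simp add: const_poly_dvd_iff)
  qed
qed

lemma line_prime:
  fixes f f' :: "'k::alg_closed_field poly poly"
  shows "v \<noteq> 0 \<Longrightarrow> line v dvd f * f' \<Longrightarrow> line v dvd f \<or> line v dvd f'"
  unfolding line_dvd_iff by simp

lemma line_dvd_imp_zero: "line v dvd f \<Longrightarrow> eval2 f v = 0"
  by (auto elim!: dvdE simp: eval2_line)

lemma form_zero_imp_line_dvd:
  fixes f :: "'k::alg_closed_field poly poly"
  assumes "binary_form n f" "v \<noteq> 0" "eval2 f v = 0" shows "line v dvd f"
  unfolding line_dvd_iff[OF assms(2)]
  by (rule on_line_eqI) (simp add: binary_form_homogeneous[OF assms(1)] assms(3))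

text \<open>
  The lowest power of \<open>y\<close> that occurs in a given degree of the quotient survives multiplication by the
  linear form.
\<close>

lemma binary_form_divide_line:
  fixes f :: "'k::field poly poly"
  assumes f: "binary_form n (line v * f)" and v: "v \<noteq> 0" and nz: "coeff (coeff f i) j \<noteq> 0"
  shows "i + j + 1 = n"
proof -
  define k where "k = (LEAST k. k \<le> i + j \<and> coeff (coeff f k) (i + j - k) \<noteq> 0)"
  have k: "k \<le> i + j \<and> coeff (coeff f k) (i + j - k) \<noteq> 0"
    unfolding k_def by (rule LeastI[of _ i]) (use nz in simp)
  define l where "l = i + j - k"
  have c: "coeff (line v * f) 0 = [:0, v $ 2:] * coeff f 0"
    "\<And>m. coeff (line v * f) (Suc m) = [:0, v $ 2:] * coeff f (Suc m) + [:- v $ 1:] * coeff f m"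
    unfolding line_def by (simp_all add: coeff_pCons)
  show ?thesis
  proof (cases "v $ 2 = 0")
    case True
    then have "v $ 1 \<noteq> 0" using v unfolding vec2_eq_iff by simp
    then have "coeff (coeff (line v * f) (Suc k)) l \<noteq> 0" using k True unfolding c l_def by simp
    then have "Suc k + l = n" using f unfolding binary_form_def by blast
    then show ?thesis using k unfolding l_def by simp
  next
    case False
    have "coeff (coeff (line v * f) k) (Suc l) = v $ 2 * coeff (coeff f k) l"
    proof (cases k)
      case (Suc m)
      then have "\<not> (m \<le> i + j \<and> coeff (coeff f m) (i + j - m) \<noteq> 0)"
        using not_less_Least[of m "\<lambda>k. k \<le> i + j \<and> coeff (coeff f k) (i + j - k) \<noteq> 0"] unfolding k_def by simp
      moreover have "i + j - m = Suc l" "m \<le> i + j" using k unfolding l_def Suc by linarith+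
      ultimately show ?thesis unfolding Suc c by simp
    qed (simp add: c)
    then have "coeff (coeff (line v * f) k) (Suc l) \<noteq> 0" using k False unfolding l_def by simp
    then have "k + Suc l = n" using f unfolding binary_form_def by blast
    then show ?thesis using k unfolding l_def by simp
  qed
qed

lemma form_linear_factor:
  fixes f :: "'k::alg_closed_field poly poly"
  assumes f: "binary_form n f" "v \<noteq> 0" "eval2 f v = 0"
  obtains f' where "f = line v * f'" "binary_form (n - 1) f'" "f \<noteq> 0 \<Longrightarrow> 0 < n"
proof -
  obtain f' where f': "f = line v * f'" using form_zero_imp_line_dvd[OF f] by (rule dvdE)
  have deg: "coeff (coeff f' i) j \<noteq> 0 \<Longrightarrow> i + j + 1 = n" for i j
    using binary_form_divide_line[of n v f' i j] f unfolding f' by blast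
  have "binary_form (n - 1) f'" unfolding binary_form_def using deg by fastforce
  moreover have "0 < n" if "f \<noteq> 0"
  proof -
    have "f' \<noteq> 0" using that f' by auto
    then have "coeff (coeff f' (degree f')) (degree (coeff f' (degree f'))) \<noteq> 0" by simp
    then show ?thesis using deg by fastforce
  qed
  ultimately show ?thesis using that f' by blast
qed

lemma form_has_zero:
  fixes f :: "'k::alg_closed_field poly poly"
  assumes f: "binary_form n f" "0 < n" shows "\<exists>v. v \<noteq> 0 \<and> eval2 f v = 0"
proof -
  define u v :: "'k ^ 2" where "u = vector [1, 0]" and "v = vector [0, 1]"
  have nz: "v \<noteq> 0" "u + s *s v \<noteq> 0" for s unfolding vec2_eq_iff u_def v_def by (simp_all add: vector_2)
  show ?thesis
  proof (cases "degree (on_line u v f) = 0")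
    case True
    then have "eval2 f v = 0" using on_line_form(2)[OF f(1), of u v] f(2) by (metis coeff_eq_0)
    then show ?thesis using nz(1) by blast
  next
    case False
    then obtain s where "poly (on_line u v f) s = 0" using alg_closed_imp_poly_has_root by blast
    then show ?thesis using nz(2)[of s] by (intro exI[of _ "u + s *s v"]) simp
  qed
qed

lemma binary_form_0:
  assumes "binary_form 0 f" shows "f = [:[:coeff (coeff f 0) 0:]:]"
proof (rule poly_eqI, rule poly_eqI)
  fix i j
  show "coeff (coeff f i) j = coeff (coeff [:[:coeff (coeff f 0) 0:]:] i) j"
  proof (cases "coeff (coeff f i) j = 0")
    case True
    then show ?thesis by (cases i; cases j) (simp_all add: coeff_pCons)
  next
    case False
    then have "i = 0" "j = 0" using assms unfolding binary_form_def by fastforce+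
    then show ?thesis by simp
  qed
qed

lemma binary_form_const: "binary_form 0 [:[:c:]:]"
  unfolding binary_form_def by (auto simp: coeff_pCons split: nat.splits)

lemma binary_form_add: "binary_form n f \<Longrightarrow> binary_form n f' \<Longrightarrow> binary_form n (f + f')"
  unfolding binary_form_def by (metis add.right_neutral add_0 coeff_add)

lemma binary_form_uminus: "binary_form n f \<Longrightarrow> binary_form n (- f)"
  unfolding binary_form_def by simp

lemma binary_form_scale: "binary_form n f \<Longrightarrow> binary_form n (smult [:c:] f)"
  unfolding binary_form_def by auto

lemma binary_form_line_mult:
  assumes "binary_form n f" shows "binary_form (Suc n) (line v * f)"
  unfolding binary_form_def
proof (intro allI impI)
  fix i j assume *: "coeff (coeff (line v * f) i) j \<noteq> 0"
  have c: "coeff (line v * f) 0 = [:0, v $ 2:] * coeff f 0"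
    "\<And>m. coeff (line v * f) (Suc m) = [:0, v $ 2:] * coeff f (Suc m) + [:- v $ 1:] * coeff f m"
    unfolding line_def by (simp_all add: coeff_pCons)
  have f: "coeff (coeff f i) j \<noteq> 0 \<Longrightarrow> i + j = n" for i j using assms unfolding binary_form_def by blast
  show "i + j = Suc n"
  proof (cases i)
    case 0
    then show ?thesis using * f[of 0 "j - 1"] by (cases j) (auto simp: c)
  next
    case (Suc m)
    show ?thesis
    proof (cases j)
      case 0
      then show ?thesis using * Suc f[of m j] by (simp add: c)
    next
      case (Suc l)
      then have "coeff (coeff f (Suc m)) l \<noteq> 0 \<or> coeff (coeff f m) (Suc l) \<noteq> 0"
        using * \<open>i = Suc m\<close> by (auto simp: c)
      then show ?thesis using f[of "Suc m" l] f[of m "Suc l"] Suc \<open>i = Suc m\<close> by auto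
    qed
  qed
qed

subsection \<open>Greatest common divisors of binary forms\<close>

lemma form_gcd_exists:
  fixes f f' :: "'k::alg_closed_field poly poly"
  assumes "binary_form n f" "f \<noteq> 0" "binary_form n' f'"
  shows "\<exists>D A E k. f = D * A \<and> f' = D * E \<and> binary_form k D \<and> binary_form (n - k) A \<and>
    (\<forall>v. v \<noteq> 0 \<longrightarrow> eval2 A v \<noteq> 0 \<or> eval2 E v \<noteq> 0)"
  using assms
proof (induction n arbitrary: f n' f' rule: less_induct)
  case (less n)
  show ?case
  proof (cases "\<exists>v. v \<noteq> 0 \<and> eval2 f v = 0 \<and> eval2 f' v = 0")
    case False
    have "binary_form 0 (1 :: 'k poly poly)" using binary_form_const[of 1] by (simp flip: one_pCons)
    then show ?thesis using False less.prems
      by (intro exI[of _ 1] exI[of _ f] exI[of _ f'] exI[of _ 0]) auto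
  next
    case True
    then obtain v where v: "v \<noteq> 0" "eval2 f v = 0" "eval2 f' v = 0" by blast
    obtain f1 where f1: "f = line v * f1" "binary_form (n - 1) f1" "0 < n"
      using form_linear_factor[OF less.prems(1) v(1,2)] less.prems(2) by metis
    obtain f1' where f1': "f' = line v * f1'" "binary_form (n' - 1) f1'"
      using form_linear_factor[OF less.prems(3) v(1,3)] by metis
    have "n - 1 < n" "f1 \<noteq> 0" using f1 less.prems(2) by auto
    then obtain D A E k where *: "f1 = D * A" "f1' = D * E" "binary_form k D" "binary_form (n - 1 - k) A"
      "\<forall>v. v \<noteq> 0 \<longrightarrow> eval2 A v \<noteq> 0 \<or> eval2 E v \<noteq> 0"
      using less.IH[of "n - 1" f1 "n' - 1" f1'] f1(2) f1'(2) by blast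
    show ?thesis
      using * f1(3) binary_form_line_mult[OF *(3), of v] unfolding f1(1) f1'(1)
      by (intro exI[of _ "line v * D"] exI[of _ A] exI[of _ E] exI[of _ "Suc k"]) (auto simp: mult.assoc)
  qed
qed

lemma form_divisor_has_line:
  fixes A c :: "'k::alg_closed_field poly poly"
  assumes "binary_form n A" "A \<noteq> 0" "c dvd A"
  shows "c dvd 1 \<or> (\<exists>v. v \<noteq> 0 \<and> line v dvd c)"
  using assms
proof (induction n arbitrary: A)
  case 0
  obtain k where k: "A = [:[:k:]:]" "k \<noteq> 0" using binary_form_0[OF 0(1)] 0(2) by fastforce
  have "A * [:[:inverse k:]:] = 1" unfolding k(1) using k(2) by (simp add: one_pCons)
  then have "A dvd 1" by (metis dvd_triv_left)
  then show ?case using 0(3) dvd_trans by blast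
next
  case (Suc n)
  obtain v where v: "v \<noteq> 0" "eval2 A v = 0" using form_has_zero[OF Suc.prems(1)] by blast
  obtain A' where A': "A = line v * A'" "binary_form n A'"
    using form_linear_factor[OF Suc.prems(1) v] by (metis diff_Suc_1)
  obtain x where x: "A = c * x" using Suc.prems(3) by (rule dvdE)
  then have "line v dvd c * x" using A'(1) by (metis dvd_triv_left)
  then consider "line v dvd c" | "line v dvd x" using line_prime[OF v(1)] by blast
  then show ?case
  proof cases
    case 2
    then obtain x' where "x = line v * x'" by (rule dvdE)
    then have "line v * A' = line v * (c * x')" using x A'(1) by (simp add: ac_simps)
    then have "c dvd A'" using line_nonzero[OF v(1)] by simp
    moreover have "A' \<noteq> 0" using Suc.prems(2) A'(1) by auto
    ultimately show ?thesis using Suc.IH A'(2) by blast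
  qed (use v in blast)
qed

text \<open>
  Unique factorization is needed for forms only, where it comes from the linear factors: a greatest
  common divisor of two forms agrees up to a unit with the product of their common lines.
\<close>

lemma gcd_of_forms:
  fixes f f' :: "'k::alg_closed_field poly poly"
  assumes f: "binary_form n f" "f \<noteq> 0" and f': "binary_form n' f'" and D: "is_gcd D f f'"
  shows "\<exists>A E k. f = D * A \<and> f' = D * E \<and> binary_form k D \<and>
    (\<forall>v. v \<noteq> 0 \<longrightarrow> eval2 A v \<noteq> 0 \<or> eval2 E v \<noteq> 0)"
proof -
  obtain D' A E k where *: "f = D' * A" "f' = D' * E" "binary_form k D'" "binary_form (n - k) A"
    "\<forall>v. v \<noteq> 0 \<longrightarrow> eval2 A v \<noteq> 0 \<or> eval2 E v \<noteq> 0"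
    using form_gcd_exists[OF f f'] by blast
  have nz: "D' \<noteq> 0" "A \<noteq> 0" using f(2) *(1) by auto
  have "D' dvd D" using D *(1,2) unfolding is_gcd_def by simp
  then obtain c where c: "D = D' * c" by (rule dvdE)
  have "D' * c dvd D' * A" "D' * c dvd D' * E" using D unfolding is_gcd_def c *(1,2) by blast+
  then have dvd: "c dvd A" "c dvd E" using nz(1) by simp_all
  have "c dvd 1"
  proof (rule ccontr)
    assume "\<not> c dvd 1"
    then obtain v where "v \<noteq> 0" "line v dvd c" using form_divisor_has_line[OF *(4) nz(2) dvd(1)] by blast
    then show False using *(5) dvd line_dvd_imp_zero dvd_trans by metis
  qed
  then obtain e where "c = [:e:]" "e dvd 1" by (auto simp: is_unit_poly_iff)
  then obtain \<kappa> where \<kappa>: "c = [:[:\<kappa>:]:]" "\<kappa> \<noteq> 0"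
    unfolding is_unit_poly_iff by (metis dvd_0_left_iff zero_neq_one)
  have inv: "[:[:\<kappa>:]:] * [:[:inverse \<kappa>:]:] = 1" using \<kappa>(2) by (simp add: one_pCons)
  have D_eq: "D = smult [:\<kappa>:] D'" unfolding c \<kappa>(1) by simp
  have "D' = D * [:[:inverse \<kappa>:]:]" unfolding c \<kappa>(1) mult.assoc inv by simp
  then have eqs: "f = D * smult [:inverse \<kappa>:] A" "f' = D * smult [:inverse \<kappa>:] E"
    unfolding *(1,2) by simp_all
  have "binary_form k D" unfolding D_eq by (rule binary_form_scale[OF *(3)])
  moreover have "\<forall>v. v \<noteq> 0 \<longrightarrow> eval2 (smult [:inverse \<kappa>:] A) v \<noteq> 0 \<or> eval2 (smult [:inverse \<kappa>:] E) v \<noteq> 0"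
    using *(5) \<kappa>(2) by simp
  ultimately show ?thesis using eqs by blast
qed

lemma total_degree_form:
  assumes "binary_form n f" "f \<noteq> 0" shows "total_degree f = n"
proof -
  have "coeff (coeff f (degree f)) (degree (coeff f (degree f))) \<noteq> 0" using assms(2) by simp
  then have "{i + j | i j. coeff (coeff f i) j \<noteq> 0} = {n}"
    using assms(1) unfolding binary_form_def by blast
  then show ?thesis unfolding total_degree_def by simp
qed

lemma form_constant_iff:
  assumes "binary_form n f" "f \<noteq> 0" shows "(\<exists>c. f = [:[:c:]:]) \<longleftrightarrow> n = 0"
proof
  assume "\<exists>c. f = [:[:c:]:]"
  then obtain c where c: "f = [:[:c:]:]" by blast
  then have "coeff (coeff f 0) 0 \<noteq> 0" using assms(2) by auto
  then show "n = 0" using assms(1) unfolding binary_form_def by fastforce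
next
  assume "n = 0"
  then show "\<exists>c. f = [:[:c:]:]" using binary_form_0 assms(1) by blast
qed


section \<open>Ideals of height two have no common zeros\<close>

lemma ring_of_type_algebra_eq: "ring_of_type_algebra = ring_on (UNIV :: 'a::comm_ring_1 set)"
  unfolding ring_of_type_algebra_def ring_on_def by (simp add: fun_eq_iff)

lemma unital_subring_UNIV: "unital_subring UNIV"
  by unfold_locales simp_all

lemma binary_form_line: "binary_form 1 (line v)"
  using binary_form_line_mult[OF binary_form_const[of 1], of v] by (simp flip: one_pCons)

lemma exists_off_line:
  assumes "v \<noteq> 0" shows "\<exists>z. z \<noteq> 0 \<and> eval2 (line v) z \<noteq> 0"
proof (cases "v $ 1 = 0")
  case True
  then show ?thesis using assms unfolding vec2_eq_iff
    by (intro exI[of _ "vector [1, 0]"]) (simp add: eval2_line vector_2)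
next
  case False
  then show ?thesis unfolding vec2_eq_iff
    by (intro exI[of _ "vector [0, 1]"]) (simp add: eval2_line vector_2)
qed

text \<open>
  The linear form generates a prime of height one: an element of a smaller prime can be divided by the
  linear form without leaving that prime, again and again.
\<close>

lemma prime_below_line:
  fixes I :: "'k::alg_closed_field poly poly set"
  assumes v: "v \<noteq> 0" and I: "primeideal I (ring_on UNIV)" and below: "I \<subset> {f. line v dvd f}"
  shows "I = {0}"
proof -
  interpret full: unital_subring "UNIV :: 'k poly poly set" by (rule unital_subring_UNIV)
  have prime: "\<And>x y. x * y \<in> I \<Longrightarrow> x \<in> I \<or> y \<in> I" and mult: "\<And>x a. x \<in> I \<Longrightarrow> a * x \<in> I" and zero: "0 \<in> I"
    using I unfolding full.primeideal_ring_on_iff full.ideal_ring_on_iff by blast+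
  have line: "line v \<notin> I"
  proof
    assume "line v \<in> I"
    then have "{f. line v dvd f} \<subseteq> I" using mult by (auto elim!: dvdE simp: mult.commute)
    then show False using below by blast
  qed
  have "f = 0" if f: "f \<in> I" for f
  proof (rule ccontr)
    assume "f \<noteq> 0"
    then obtain u where u: "eval2 f u \<noteq> 0" using eval2_eq_zero_imp_zero by blast
    obtain z where z: "eval2 (line v) z \<noteq> 0" using exists_off_line[OF v] by blast
    have powers: "\<exists>q\<in>I. f = line v ^ n * q" for n
    proof (induction n)
      case 0
      then show ?case using f by simp
    next
      case (Suc n)
      then obtain q where q: "q \<in> I" "f = line v ^ n * q" by blast
      obtain q' where q': "q = line v * q'" using q(1) below by (auto elim: dvdE)
      have "q' \<in> I" using prime[of "line v" q'] line q(1) unfolding q' by blast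
      then show ?case using q(2) unfolding q' by (intro bexI[of _ q']) (simp_all add: ac_simps)
    qed
    define n where "n = Suc (degree (on_line u z f))"
    obtain q where q: "f = line v ^ n * q" using powers by blast
    have nz: "on_line u z f \<noteq> 0"
    proof
      assume "on_line u z f = 0"
      then show False using u poly_on_line[of u z f 0] by simp
    qed
    have "on_line u z f = on_line u z (line v) ^ n * on_line u z q" unfolding q by (simp add: on_line_power)
    then have "degree (on_line u z f) = n * degree (on_line u z (line v)) + degree (on_line u z q)"
      using nz by (simp add: degree_mult_eq degree_power_eq[OF degree_on_line_form(2)[OF binary_form_line z]])
    moreover have "degree (on_line u z (line v)) = 1"
      by (rule degree_on_line_form(1)[OF binary_form_line z])
    ultimately show False unfolding n_def by simp
  qed
  then show ?thesis using zero by blast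
qed

lemma line_ideal_prime:
  fixes v :: "'k::alg_closed_field ^ 2"
  assumes v: "v \<noteq> 0" shows "primeideal {f. line v dvd f} (ring_on UNIV)"
proof -
  interpret full: unital_subring "UNIV :: 'k poly poly set" by (rule unital_subring_UNIV)
  have "\<not> line v dvd 1" using line_dvd_imp_zero[of v 1] by auto
  then show ?thesis
    unfolding full.primeideal_ring_on_iff full.ideal_ring_on_iff using line_prime[OF v] by auto
qed

lemma height_two_imp_no_common_zero:
  fixes g :: "'k::alg_closed_field poly poly ^ 'n"
  assumes forms: "\<forall>i. binary_form d (g $ i)"
    and height: "ideal_height ring_of_type_algebra (ideal_of (range (($) g))) = 2"
    and v: "v \<noteq> 0"
  shows "\<exists>i. eval2 (g $ i) v \<noteq> 0"
proof (rule ccontr)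
  interpret full: unital_subring "UNIV :: 'k poly poly set" by (rule unital_subring_UNIV)
  assume "\<not> ?thesis"
  then have dvd: "line v dvd g $ i" for i
    using form_zero_imp_line_dvd[of d "g $ i" v] forms v by blast
  let ?Q = "{f. line v dvd f}"
  have Q: "primeideal ?Q (ring_on UNIV)" by (rule line_ideal_prime[OF v])
  have "range (($) g) \<subseteq> ?Q" using dvd by auto
  then have "ideal_of (range (($) g)) \<subseteq> ?Q"
    unfolding ideal_of_def ring_of_type_algebra_eq
    by (intro ring.genideal_minimal cring.axioms(1) full.cring_ring_on primeideal.axioms(1)[OF Q])
  then have "ideal_height ring_of_type_algebra (ideal_of (range (($) g))) \<le> prime_height (ring_on UNIV) ?Q"
    unfolding ideal_height_def ring_of_type_algebra_eq using Q by (intro Inf_lower) blast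
  also have "\<dots> \<le> enat 1"
    unfolding prime_height_def
  proof (rule Sup_least, clarify)
    fix n and p :: "nat \<Rightarrow> 'k poly poly set"
    assume p: "\<forall>i\<le>n. primeideal (p i) (ring_on UNIV)" "\<forall>i<n. p i \<subset> p (Suc i)" "p n = ?Q"
    show "enat n \<le> enat 1"
    proof (rule ccontr)
      assume "\<not> ?thesis"
      then obtain k where k: "n = Suc (Suc k)" by (metis One_nat_def Suc_leI enat_ord_simps(1) le_Suc_ex not_less_eq_eq plus_1_eq_Suc add_Suc)
      have "p (Suc k) \<subset> ?Q" using p(2,3) k by (metis lessI)
      then have "p (Suc k) = {0}" using prime_below_line[OF v, of "p (Suc k)"] p(1) k by simp
      moreover have "p k \<subset> p (Suc k)" using p(2) k by simp
      moreover have "0 \<in> p k"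
      proof -
        have "primeideal (p k) (ring_on UNIV)" using p(1) k by simp
        then show ?thesis unfolding full.primeideal_ring_on_iff full.ideal_ring_on_iff by blast
      qed
      ultimately show False by auto
    qed
  qed
  finally have "(2 :: enat) \<le> enat 1" unfolding height .
  then show False by (simp add: numeral_eq_enat)
qed

lemma minimal_generators_nonzero:
  fixes g :: "'a::comm_ring_1 ^ 'n"
  assumes "minimal_generators g" shows "g $ i \<noteq> 0"
proof
  interpret full: unital_subring "UNIV :: 'a set" by (rule unital_subring_UNIV)
  assume zero: "g $ i = 0"
  let ?A = "{g $ j | j. j \<noteq> i}"
  have "range (($) g) = insert 0 ?A" using zero by force
  moreover have "ideal_of (insert 0 ?A) = ideal_of ?A"
  proof -
    have "insert 0 ?A \<subseteq> I \<longleftrightarrow> ?A \<subseteq> I" if "ideal I (ring_on UNIV)" for I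
      using that unfolding full.ideal_ring_on_iff by blast
    then show ?thesis unfolding ideal_of_def genideal_def ring_of_type_algebra_eq
      by (intro arg_cong[where f = Inter] Collect_cong conj_cong refl) simp
  qed
  ultimately have "ideal_of ?A = ideal_of (range (($) g))" by simp
  then show False using assms unfolding minimal_generators_def by blast
qed


section \<open>The Hilbert--Burch matrix\<close>

lemma hilbert_burch_relations:
  fixes g :: "'k::field poly poly ^ 3"
  assumes hb: "hilbert_burch_matrix g (vector [vector [P1, Q1], vector [P2, Q2], vector [0, Q3]])"
  shows "P1 * g $ 1 + P2 * g $ 2 = 0"
    and "Q1 * g $ 1 + Q2 * g $ 2 + Q3 * g $ 3 = 0"
    and "r1 * g $ 1 + r2 * g $ 2 + r3 * g $ 3 = 0 \<Longrightarrow>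
      \<exists>c1 c2. r1 = P1 * c1 + Q1 * c2 \<and> r2 = P2 * c1 + Q2 * c2 \<and> r3 = Q3 * c2"
    and "P1 * c1 + Q1 * c2 = 0 \<Longrightarrow> P2 * c1 + Q2 * c2 = 0 \<Longrightarrow> Q3 * c2 = 0 \<Longrightarrow> c1 = 0 \<and> c2 = 0"
proof -
  let ?\<phi> = "vector [vector [P1, Q1], vector [P2, Q2], vector [0, Q3]] :: 'k poly poly ^ 2 ^ 3"
  have bij: "bij_betw (\<lambda>c. ?\<phi> *v c) UNIV {r. (\<Sum>i\<in>UNIV. r $ i * g $ i) = 0}"
    using hb unfolding hilbert_burch_matrix_def by blast
  have comp: "(?\<phi> *v c) $ 1 = P1 * c $ 1 + Q1 * c $ 2" "(?\<phi> *v c) $ 2 = P2 * c $ 1 + Q2 * c $ 2"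
    "(?\<phi> *v c) $ 3 = Q3 * c $ 2" for c :: "'k poly poly ^ 2"
    by (simp_all add: matrix_vector_mult_def sum_2 vector_2 vector_3)
  have rel: "(P1 * c $ 1 + Q1 * c $ 2) * g $ 1 + (P2 * c $ 1 + Q2 * c $ 2) * g $ 2 + Q3 * c $ 2 * g $ 3 = 0"
    for c :: "'k poly poly ^ 2"
  proof -
    have "?\<phi> *v c \<in> {r. (\<Sum>i\<in>UNIV. r $ i * g $ i) = 0}" using bij_betw_apply[OF bij] by blast
    then show ?thesis by (simp add: sum_3 comp)
  qed
  show "P1 * g $ 1 + P2 * g $ 2 = 0" using rel[of "vector [1, 0]"] by (simp add: vector_2)
  show "Q1 * g $ 1 + Q2 * g $ 2 + Q3 * g $ 3 = 0" using rel[of "vector [0, 1]"] by (simp add: vector_2)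
  show "\<exists>c1 c2. r1 = P1 * c1 + Q1 * c2 \<and> r2 = P2 * c1 + Q2 * c2 \<and> r3 = Q3 * c2"
    if "r1 * g $ 1 + r2 * g $ 2 + r3 * g $ 3 = 0"
  proof -
    define r :: "'k poly poly ^ 3" where "r = vector [r1, r2, r3]"
    have "r \<in> {r. (\<Sum>i\<in>UNIV. r $ i * g $ i) = 0}" using that unfolding r_def by (simp add: sum_3 vector_3)
    then obtain c where "r = ?\<phi> *v c" using bij unfolding bij_betw_def by blast
    then have "r $ 1 = P1 * c $ 1 + Q1 * c $ 2" "r $ 2 = P2 * c $ 1 + Q2 * c $ 2" "r $ 3 = Q3 * c $ 2"
      by (simp_all only: comp)
    then show ?thesis unfolding r_def vector_3 by blast
  qed
  show "c1 = 0 \<and> c2 = 0"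
    if "P1 * c1 + Q1 * c2 = 0" "P2 * c1 + Q2 * c2 = 0" "Q3 * c2 = 0"
  proof -
    have "?\<phi> *v (vector [c1, c2]) = ?\<phi> *v 0"
      unfolding vec_eq_iff forall_3 comp using that by (simp add: vector_2)
    then have "vector [c1, c2] = (0 :: 'k poly poly ^ 2)" using bij unfolding bij_betw_def inj_def by blast
    then show ?thesis unfolding vec2_eq_iff by (simp add: vector_2)
  qed
qed

lemma hilbert_burch_Q3_nonzero:
  fixes g :: "'k::field poly poly ^ 3"
  assumes hb: "hilbert_burch_matrix g (vector [vector [P1, Q1], vector [P2, Q2], vector [0, Q3]])"
    and g1: "g $ 1 \<noteq> 0"
  shows "Q3 \<noteq> 0"
proof
  note rel = hilbert_burch_relations[OF hb]
  assume Q3: "Q3 = 0"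
  have "(Q2 * P1 - P2 * Q1) * g $ 1 = Q2 * (P1 * g $ 1 + P2 * g $ 2) - P2 * (Q1 * g $ 1 + Q2 * g $ 2 + Q3 * g $ 3)"
    unfolding Q3 by (simp add: algebra_simps)
  also have "\<dots> = 0" unfolding rel(1,2) by simp
  finally have "Q2 * P1 - P2 * Q1 = 0" using g1 by simp
  then have P2: "P2 = 0" using rel(4)[of Q2 "- P2"] Q3 by (simp add: algebra_simps)
  then have "P1 = 0" using rel(1) g1 by simp
  then show False using rel(4)[of 1 0] P2 by simp
qed

lemma hilbert_burch_P_no_common_zero:
  fixes g :: "'k::alg_closed_field poly poly ^ 3"
  assumes hb: "hilbert_burch_matrix g (vector [vector [P1, Q1], vector [P2, Q2], vector [0, Q3]])"
    and Q3: "Q3 \<noteq> 0" and P: "binary_form \<delta> P1" "binary_form \<delta> P2" and v: "v \<noteq> 0"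
  shows "eval2 P1 v \<noteq> 0 \<or> eval2 P2 v \<noteq> 0"
proof (rule ccontr)
  note rel = hilbert_burch_relations[OF hb]
  assume "\<not> ?thesis"
  then have "line v dvd P1" "line v dvd P2" using form_zero_imp_line_dvd P v by blast+
  then obtain p1 p2 where p: "P1 = line v * p1" "P2 = line v * p2" by (auto elim!: dvdE)
  have "line v * (p1 * g $ 1 + p2 * g $ 2) = P1 * g $ 1 + P2 * g $ 2"
    unfolding p by (simp add: algebra_simps)
  then have "line v * (p1 * g $ 1 + p2 * g $ 2) = 0" unfolding rel(1) .
  then have "p1 * g $ 1 + p2 * g $ 2 + 0 * g $ 3 = 0" using line_nonzero[OF v] by simp
  from rel(3)[OF this] obtain c1 c2 where c: "p1 = P1 * c1 + Q1 * c2" "p2 = P2 * c1 + Q2 * c2" "0 = Q3 * c2"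
    by blast
  have c2: "c2 = 0" using c(3) Q3 by simp
  have "p1 = p1 * (line v * c1)" "p2 = p2 * (line v * c1)"
    using c(1,2) unfolding p c2 by (simp_all add: ac_simps)
  moreover have "line v * c1 \<noteq> 1"
  proof
    assume "line v * c1 = 1"
    then have "line v dvd 1" by (metis dvd_triv_left)
    then show False using line_dvd_imp_zero[of v 1] by simp
  qed
  ultimately have "p1 = 0" "p2 = 0" by simp_all
  then show False using rel(4)[of 1 0] p by simp
qed


section \<open>From the plane curve to a chart\<close>

lemma form_linear_combination:
  assumes "form e F" "form e G" shows "form e (\<lambda>v. a * F v + b * G v)"
proof -
  obtain c c' where c: "\<And>v. F v = (\<Sum>\<alpha> | sum \<alpha> UNIV = e. c \<alpha> * monomial_fun \<alpha> v)"
    "\<And>v. G v = (\<Sum>\<alpha> | sum \<alpha> UNIV = e. c' \<alpha> * monomial_fun \<alpha> v)"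
    using assms unfolding form_def by blast
  show ?thesis unfolding form_def
    by (rule exI[of _ "\<lambda>\<alpha>. a * c \<alpha> + b * c' \<alpha>"])
      (simp add: c sum_distrib_left sum.distrib distrib_right mult.assoc)
qed

definition eval_forms :: "'k::field poly poly ^ 'n \<Rightarrow> 'k ^ 2 \<Rightarrow> 'k ^ 'n" where
  "eval_forms G z = (\<chi> i. eval2 (G $ i) z)"

lemma eval_forms_nth [simp]: "eval_forms G z $ i = eval2 (G $ i) z"
  unfolding eval_forms_def by simp

lemma eval_forms_homogeneous:
  "\<forall>i. binary_form d (G $ i) \<Longrightarrow> eval_forms G (c *s z) = c ^ d *s eval_forms G z"
  by (simp add: vec_eq_iff binary_form_homogeneous)

lemma eval_vec_on_line:
  fixes G :: "'k::alg_closed_field poly poly ^ 'n"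
  shows "eval_vec (\<chi> i. on_line u v (G $ i)) s = eval_forms G (u + s *s v)"
  unfolding eval_vec_def by (simp add: vec_eq_iff)

text \<open>
  The chart \<open>v0 + s v1\<close> of the parameter line misses the point \<open>v1\<close> only. In the chart centred there, a
  pullback that vanishes off the origin vanishes.
\<close>

lemma zero_from_chart:
  fixes G :: "'k::alg_closed_field poly poly ^ 'n::finite" and W :: "'k poly poly ^ 'm::finite"
  assumes G: "\<forall>i. binary_form d (G $ i)" and W: "\<forall>j. binary_form \<delta> (W $ j)"
    and F: "biform m n F"
    and zero: "\<And>s. F (eval_forms G (v0 + s *s v1)) (eval_forms W (v0 + s *s v1)) = 0"
  shows "F (eval_forms G (\<alpha> *s v0 + \<beta> *s v1)) (eval_forms W (\<alpha> *s v0 + \<beta> *s v1)) = 0"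
proof -
  have hom: "F (eval_forms G (c *s z)) (eval_forms W (c *s z)) = 0"
    if "F (eval_forms G z) (eval_forms W z) = 0" for c z
    unfolding eval_forms_homogeneous[OF G] eval_forms_homogeneous[OF W] biform_homogeneous[OF F]
    using that by simp
  show ?thesis
  proof (cases "\<alpha> = 0")
    case False
    then have "\<alpha> *s v0 + \<beta> *s v1 = \<alpha> *s (v0 + (\<beta> / \<alpha>) *s v1)"
      by (simp add: vec_eq_iff distrib_left)
    then show ?thesis using hom zero by metis
  next
    case True
    define p where "p = pullback (\<chi> i. on_line v1 v0 (G $ i)) (\<chi> j. on_line v1 v0 (W $ j)) F"
    have p: "poly p t = F (eval_forms G (v1 + t *s v0)) (eval_forms W (v1 + t *s v0))" for t
      unfolding p_def poly_pullback[OF F] eval_vec_on_line ..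
    have "poly p t = 0" if "t \<notin> {0}" for t
    proof -
      have "v1 + t *s v0 = t *s (v0 + inverse t *s v1)" using that by (simp add: vec_eq_iff distrib_left)
      then show ?thesis unfolding p using hom zero by metis
    qed
    then have "p = 0" by (rule poly_zero_if_cofinite_zero[of "{0}"]) simp_all
    then have "F (eval_forms G v1) (eval_forms W v1) = 0" using p[of 0] by simp
    then have "F (eval_forms G (\<beta> *s v1)) (eval_forms W (\<beta> *s v1)) = 0" by (rule hom)
    then show ?thesis using True by simp
  qed
qed

lemma decompose:
  fixes z v0 v1 :: "'k::field ^ 2"
  assumes "eval2 (line v1) v0 \<noteq> 0"
  shows "\<exists>\<alpha> \<beta>. z = \<alpha> *s v0 + \<beta> *s v1"
proof -
  let ?\<Delta> = "v1 $ 2 * v0 $ 1 - v1 $ 1 * v0 $ 2"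
  have nz: "?\<Delta> \<noteq> 0" using assms unfolding eval2_line .
  define \<alpha> \<beta> where "\<alpha> = v1 $ 2 * z $ 1 - v1 $ 1 * z $ 2" and "\<beta> = v0 $ 1 * z $ 2 - v0 $ 2 * z $ 1"
  have "?\<Delta> * z $ 1 = \<alpha> * v0 $ 1 + \<beta> * v1 $ 1" "?\<Delta> * z $ 2 = \<alpha> * v0 $ 2 + \<beta> * v1 $ 2"
    unfolding \<alpha>_def \<beta>_def by (simp_all add: algebra_simps)
  moreover have "x = (\<alpha> / ?\<Delta>) * y + (\<beta> / ?\<Delta>) * y'" if "?\<Delta> * x = \<alpha> * y + \<beta> * y'" for x y y'
  proof -
    have "x = (?\<Delta> * x) / ?\<Delta>" using nz by simp
    then show ?thesis unfolding that by (simp only: add_divide_distrib times_divide_eq_left)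
  qed
  ultimately have "z $ 1 = (\<alpha> / ?\<Delta>) * v0 $ 1 + (\<beta> / ?\<Delta>) * v1 $ 1"
    "z $ 2 = (\<alpha> / ?\<Delta>) * v0 $ 2 + (\<beta> / ?\<Delta>) * v1 $ 2" by blast+
  then have "z = (\<alpha> / ?\<Delta>) *s v0 + (\<beta> / ?\<Delta>) *s v1" unfolding vec2_eq_iff by simp
  then show ?thesis by blast
qed

lemma curve_map_proj:
  fixes g :: "'k::alg_closed_field poly poly ^ 3"
  assumes g: "\<forall>i. binary_form d (g $ i)" and z: "z \<noteq> 0" "eval_forms g z \<noteq> 0"
  shows "curve_map g (proj z) = proj (eval_forms g z)"
proof -
  obtain c where c: "c \<noteq> 0" "coords (proj z) = c *s z" using proportional_coords_proj[OF z(1)] by blast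
  have "(\<chi> i. eval2 (g $ i) (coords (proj z))) = eval_forms g (c *s z)"
    unfolding c(2) by (simp add: vec_eq_iff)
  also have "\<dots> = c ^ d *s eval_forms g z" by (rule eval_forms_homogeneous[OF g])
  finally have eq: "curve_map g (proj z) = proj (c ^ d *s eval_forms g z)" unfolding curve_map_def by simp
  have "c ^ d *s eval_forms g z \<noteq> 0" using c(1) z(2) by (simp add: vec_eq_iff)
  then have "proj (eval_forms g z) = proj (c ^ d *s eval_forms g z)"
    using proj_eq_iff[OF z(2)] c(1) by (metis power_not_zero)
  then show ?thesis unfolding eq ..
qed


lemma exists_2: "(\<exists>j :: 2. Q j) \<longleftrightarrow> Q 1 \<or> Q 2"
  by (metis exhaust_2)

text \<open>
  The parameter line is written as \<open>v0 + s v1\<close>. At the missing point \<open>v1\<close> neither \<open>g\<^sub>1\<close>, \<open>g\<^sub>3\<close> nor \<open>Q3\<close>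
  vanishes, so these forms keep their degrees in the chart and \<open>v1\<close> is not mapped to the base point.
\<close>

locale curve_chart =
  fixes g :: "'k::alg_closed_field poly poly ^ 3"
    and P1 P2 Q1 Q2 Q3 D A E :: "'k poly poly"
    and a b :: 'k and d dj :: nat and v0 v1 :: "'k ^ 2"
  assumes forms_g: "\<forall>i. binary_form d (g $ i)" and dj_le: "dj \<le> d"
    and forms_P: "binary_form (d - dj) P1" "binary_form (d - dj) P2" and form_Q3: "binary_form dj Q3"
    and rel1: "P1 * g $ 1 + P2 * g $ 2 = 0" and rel2: "Q1 * g $ 1 + Q2 * g $ 2 + Q3 * g $ 3 = 0"
    and g_no_zero: "v \<noteq> 0 \<Longrightarrow> \<exists>i. eval2 (g $ i) v \<noteq> 0"
    and P_no_zero: "v \<noteq> 0 \<Longrightarrow> eval2 P1 v \<noteq> 0 \<or> eval2 P2 v \<noteq> 0"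
    and birational: "birational_onto_image (curve_map g)"
    and point: "(a, b) \<noteq> (0, 0)"
    and D: "Q3 = D * A" "smult [:a:] P1 + smult [:b:] P2 = D * E"
    and no_common: "v \<noteq> 0 \<Longrightarrow> eval2 A v \<noteq> 0 \<or> eval2 E v \<noteq> 0"
    and chart: "eval2 (line v1) v0 \<noteq> 0"
    and at_v1: "eval2 (g $ 1) v1 \<noteq> 0" "eval2 (g $ 3) v1 \<noteq> 0" "eval2 Q3 v1 \<noteq> 0"
begin

abbreviation "S \<equiv> on_line v0 v1"
abbreviation "W \<equiv> vector [P2, - P1] :: 'k poly poly ^ 2"
abbreviation "gs \<equiv> (\<chi> i. S (g $ i)) :: 'k poly ^ 3"
abbreviation "ws \<equiv> (\<chi> j. S (W $ j)) :: 'k poly ^ 2"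
abbreviation "z s \<equiv> v0 + s *s v1"
abbreviation "Z \<equiv> {(proj T, proj (vector [T $ 1, T $ 2])) | T. T \<noteq> 0 \<and> proj T \<in> curve g - {base_point}}
    :: (('k, 3) pspace \<times> ('k, 2) pspace) set"

lemma v1_nonzero: "v1 \<noteq> 0"
  using chart by (auto simp: eval2_line)

lemma z_nonzero: "z s \<noteq> 0"
proof
  assume "z s = 0"
  then have "eval2 (line v1) (z s) = 0" by (simp add: eval2_line)
  moreover have "eval2 (line v1) (z s) = eval2 (line v1) v0" by (simp add: eval2_line algebra_simps)
  ultimately show False using chart by simp
qed

lemma W_simps: "W $ 1 = P2" "W $ 2 = - P1"
  by (simp_all add: vector_2)

lemma ws_simps: "ws $ 1 = S P2" "ws $ 2 = - S P1"
  by (simp_all add: W_simps)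

lemma forms_W: "\<forall>j. binary_form (d - dj) (W $ j)"
  unfolding forall_2 W_simps using forms_P by (simp add: binary_form_uminus)

lemma eval_W: "eval_forms W v $ 1 = eval2 P2 v" "eval_forms W v $ 2 = - eval2 P1 v"
  by (simp_all add: W_simps)

lemma eval_g_nonzero: "v \<noteq> 0 \<Longrightarrow> eval_forms g v \<noteq> 0"
  using g_no_zero[of v] by (auto simp: vec_eq_iff)

lemma eval_W_nonzero: "v \<noteq> 0 \<Longrightarrow> eval_forms W v \<noteq> 0"
  using P_no_zero[of v] unfolding vec2_eq_iff eval_W by auto

lemma eval_g_proportional:
  assumes "v \<noteq> 0" shows "\<exists>c. eval2 (g $ 1) v = c * eval_forms W v $ 1 \<and> eval2 (g $ 2) v = c * eval_forms W v $ 2"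
proof -
  have rel: "eval2 P1 v * eval2 (g $ 1) v = - (eval2 P2 v * eval2 (g $ 2) v)"
    using arg_cong[OF rel1, of "\<lambda>f. eval2 f v"] by (simp add: eq_neg_iff_add_eq_0)
  show ?thesis
  proof (cases "eval2 P2 v = 0")
    case False
    then show ?thesis unfolding eval_W using rel
      by (intro exI[of _ "eval2 (g $ 1) v / eval2 P2 v"]) (simp add: field_simps)
  next
    case True
    then have "eval2 P1 v \<noteq> 0" using P_no_zero[OF assms] by simp
    then show ?thesis unfolding eval_W using rel True
      by (intro exI[of _ "- eval2 (g $ 2) v / eval2 P1 v"]) simp
  qed
qed

lemma exists_h: "\<exists>h. gs $ 1 = h * ws $ 1 \<and> gs $ 2 = h * ws $ 2"
proof -
  have "poly (S P1) s \<noteq> 0 \<or> poly (S P2) s \<noteq> 0" for s using P_no_zero[OF z_nonzero] by simp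
  then obtain x y where xy: "x * S P1 + y * S P2 = 1" using bezout_pair by blast
  have rel: "S P1 * S (g $ 1) + S P2 * S (g $ 2) = 0" using arg_cong[OF rel1, of S] by simp
  define h where "h = y * S (g $ 1) - x * S (g $ 2)"
  have "S (g $ 1) - h * S P2 = S (g $ 1) * (1 - (x * S P1 + y * S P2)) + x * (S P1 * S (g $ 1) + S P2 * S (g $ 2))"
    unfolding h_def by (simp add: algebra_simps)
  then have 1: "S (g $ 1) = h * S P2" unfolding xy rel by simp
  have "S (g $ 2) + h * S P1 = S (g $ 2) * (1 - (x * S P1 + y * S P2)) + y * (S P1 * S (g $ 1) + S P2 * S (g $ 2))"
    unfolding h_def by (simp add: algebra_simps)
  then have 2: "S (g $ 2) = - (h * S P1)" unfolding xy rel by (simp add: eq_neg_iff_add_eq_0)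
  show ?thesis using 1 2 unfolding ws_simps by (intro exI[of _ h]) simp
qed

lemma P2_at_v1: "eval2 P2 v1 \<noteq> 0"
proof
  assume "eval2 P2 v1 = 0"
  moreover have "eval2 P1 v1 * eval2 (g $ 1) v1 + eval2 P2 v1 * eval2 (g $ 2) v1 = 0"
    using arg_cong[OF rel1, of "\<lambda>f. eval2 f v1"] by simp
  ultimately show False using at_v1(1) P_no_zero[OF v1_nonzero] by simp
qed

text \<open>
  The second relation makes the common factor \<open>h\<close> of the first two coordinates a divisor of \<open>Q3\<close>, as \<open>h\<close>
  and \<open>g\<^sub>3\<close> have no common zero; both have degree \<open>dj\<close>.
\<close>

lemma h_associated_Q3:
  assumes h: "gs $ 1 = h * ws $ 1" "gs $ 2 = h * ws $ 2"
  shows "h \<noteq> 0" "degree h = dj" "\<exists>t. t \<noteq> 0 \<and> S Q3 = smult t h"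
proof -
  have deg: "degree (S (g $ 1)) = d" "S (g $ 1) \<noteq> 0" "degree (S P2) = d - dj" "S P2 \<noteq> 0"
    "degree (S Q3) = dj" "S Q3 \<noteq> 0"
    using degree_on_line_form forms_g forms_P form_Q3 at_v1 P2_at_v1 by blast+
  have g1: "S (g $ 1) = h * S P2" "S (g $ 2) = - (h * S P1)" using h unfolding ws_simps by simp_all
  show nz: "h \<noteq> 0" using deg(2) g1 by auto
  have "d = degree h + (d - dj)" using deg(1,3,4) nz unfolding g1(1) by (simp add: degree_mult_eq)
  then show dh: "degree h = dj" using dj_le by simp
  have "poly h s \<noteq> 0 \<or> poly (S (g $ 3)) s \<noteq> 0" for s
  proof (rule ccontr)
    assume "\<not> ?thesis"
    then have "poly (S (g $ 1)) s = 0" "poly (S (g $ 2)) s = 0" "poly (S (g $ 3)) s = 0"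
      unfolding g1 by simp_all
    then have "eval2 (g $ i) (z s) = 0" for i using exhaust_3[of i] by auto
    then show False using g_no_zero[OF z_nonzero] by blast
  qed
  then obtain x y where xy: "x * h + y * S (g $ 3) = 1" using bezout_pair by blast
  have "S Q1 * S (g $ 1) + S Q2 * S (g $ 2) + S Q3 * S (g $ 3) = 0" using arg_cong[OF rel2, of S] by simp
  then have rel: "S Q3 * S (g $ 3) = h * (S Q2 * S P1 - S Q1 * S P2)"
    unfolding g1 by (simp add: algebra_simps eq_neg_iff_add_eq_0)
  have "S Q3 = S Q3 * (x * h + y * S (g $ 3))" unfolding xy by simp
  also have "\<dots> = S Q3 * x * h + y * (S Q3 * S (g $ 3))" by (simp add: algebra_simps)
  also have "\<dots> = h * (S Q3 * x + y * (S Q2 * S P1 - S Q1 * S P2))" unfolding rel by (simp add: algebra_simps)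
  finally obtain t where t: "S Q3 = h * t" by blast
  then have "degree t = 0" "t \<noteq> 0" using deg(5,6) dh nz by (auto simp: degree_mult_eq)
  then obtain t' where "t = [:t':]" "t' \<noteq> 0" by (metis degree_eq_zeroE pCons_0_0)
  then show "\<exists>t. t \<noteq> 0 \<and> S Q3 = smult t h" using t by (intro exI[of _ t']) (simp add: mult.commute)
qed

text \<open>
  \<open>Z\<close> is the image of the lifted parametrization off the zeros of \<open>h\<close>; only finitely many parameters
  of the chart are left out.
\<close>

lemma vanishes_on_Z_iff:
  assumes F: "biform m n F" and h: "gs $ 1 = h * ws $ 1" "gs $ 2 = h * ws $ 2"
  shows "(\<forall>(x, y)\<in>Z. F (coords x) (coords y) = 0) \<longleftrightarrow> (\<forall>s. F (eval_vec gs s) (eval_vec ws s) = 0)"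
proof
  have h0: "h \<noteq> 0" by (rule h_associated_Q3(1)[OF h])
  assume zero: "\<forall>(x, y)\<in>Z. F (coords x) (coords y) = 0"
  have "poly (pullback gs ws F) s = 0" if s: "s \<notin> {s. poly h s = 0}" for s
  proof -
    let ?T = "eval_forms g (z s)"
    have T: "?T $ 1 = poly h s * eval_forms W (z s) $ 1" "?T $ 2 = poly h s * eval_forms W (z s) $ 2"
      using arg_cong[OF h(1), of "\<lambda>p. poly p s"] arg_cong[OF h(2), of "\<lambda>p. poly p s"] by simp_all
    have W: "eval_forms W (z s) \<noteq> 0" by (rule eval_W_nonzero[OF z_nonzero])
    have T0: "?T \<noteq> 0" by (rule eval_g_nonzero[OF z_nonzero])
    have vec: "vector [?T $ 1, ?T $ 2] = poly h s *s eval_forms W (z s)"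
      unfolding vec2_eq_iff T by (simp add: vector_2)
    then have vec0: "vector [?T $ 1, ?T $ 2] \<noteq> (0 :: 'k ^ 2)" using W s by (auto simp: vec_eq_iff)
    have "proj ?T \<noteq> base_point"
    proof
      assume "proj ?T = base_point"
      moreover have t0: "vector [0, 0, 1] \<noteq> (0 :: 'k ^ 3)" by (metis vector_3(3) zero_index zero_neq_one)
      ultimately obtain c where "?T = c *s vector [0, 0, 1]"
        unfolding base_point_def by (metis proj_eq_iff T0)
      then have "?T $ 1 = 0" "?T $ 2 = 0" by (simp_all add: vector_3)
      then show False using vec0 unfolding vec2_eq_iff by (simp add: vector_2)
    qed
    moreover have "proj ?T \<in> curve g"
      unfolding curve_def using curve_map_proj[OF forms_g z_nonzero T0] by (metis rangeI)
    ultimately have "(proj ?T, proj (vector [?T $ 1, ?T $ 2])) \<in> Z" using T0 by blast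
    then have ev: "F (coords (proj ?T)) (coords (proj (vector [?T $ 1, ?T $ 2] :: 'k ^ 2))) = 0" using zero by blast
    obtain c c' where c: "c \<noteq> 0" "coords (proj ?T) = c *s ?T" "c' \<noteq> 0"
      "coords (proj (vector [?T $ 1, ?T $ 2] :: 'k ^ 2)) = c' *s vector [?T $ 1, ?T $ 2]"
      using proportional_coords_proj[OF T0] proportional_coords_proj[OF vec0] by blast
    have "F (c *s ?T) ((c' * poly h s) *s eval_forms W (z s)) = 0"
      using ev unfolding c(2,4) unfolding vec vector_smult_assoc .
    then have "F ?T (eval_forms W (z s)) = 0"
      unfolding biform_homogeneous[OF F] using c(1,3) s by simp
    then show ?thesis unfolding poly_pullback[OF F] eval_vec_on_line .
  qed
  then have "pullback gs ws F = 0"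
    by (rule poly_zero_if_cofinite_zero[OF _ poly_roots_finite[OF h0]])
  then show "\<forall>s. F (eval_vec gs s) (eval_vec ws s) = 0" using poly_pullback[OF F] by (metis poly_0)
next
  assume "\<forall>s. F (eval_vec gs s) (eval_vec ws s) = 0"
  then have zero: "F (eval_forms g (z s)) (eval_forms W (z s)) = 0" for s unfolding eval_vec_on_line by blast
  have all: "F (eval_forms g v) (eval_forms W v) = 0" for v
    using zero_from_chart[OF forms_g forms_W F zero] decompose[OF chart] by metis
  have "F (coords (proj T)) (coords (proj (vector [T $ 1, T $ 2] :: 'k ^ 2))) = 0"
    if T: "T \<noteq> 0" "proj T \<in> curve g" "proj T \<noteq> base_point" for T
  proof -
    obtain q where q: "proj T = curve_map g q" using T(2) unfolding curve_def by blast
    define v where "v = coords q"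
    have v: "v \<noteq> 0" unfolding v_def by (rule coords_nonzero)
    have "proj T = proj (eval_forms g v)"
      using q curve_map_proj[OF forms_g v eval_g_nonzero[OF v]] unfolding v_def proj_coords by simp
    then obtain c where c: "c \<noteq> 0" "T = c *s eval_forms g v"
      using proj_eq_iff[OF eval_g_nonzero[OF v] T(1)] by metis
    obtain e where e: "eval2 (g $ 1) v = e * eval_forms W v $ 1" "eval2 (g $ 2) v = e * eval_forms W v $ 2"
      using eval_g_proportional[OF v] by blast
    have vec: "vector [T $ 1, T $ 2] = (c * e) *s eval_forms W v"
      unfolding vec2_eq_iff c(2) using e by (simp add: vector_2)
    have vec0: "vector [T $ 1, T $ 2] \<noteq> (0 :: 'k ^ 2)"
    proof
      assume "vector [T $ 1, T $ 2] = (0 :: 'k ^ 2)"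
      then have "T $ 1 = 0" "T $ 2 = 0" unfolding vec2_eq_iff by (simp_all add: vector_2)
      then have T': "T = T $ 3 *s vector [0, 0, 1]" by (simp add: vec_eq_iff forall_3 vector_3)
      then have "T $ 3 \<noteq> 0" using T(1) by auto
      moreover have "vector [0, 0, 1] \<noteq> (0 :: 'k ^ 3)" by (metis vector_3(3) zero_index zero_neq_one)
      ultimately have "proj (vector [0, 0, 1]) = proj T" using proj_eq_iff T(1) T' by metis
      then show False using T(3) unfolding base_point_def by simp
    qed
    obtain c1 c2 where c12: "coords (proj T) = c1 *s T"
      "coords (proj (vector [T $ 1, T $ 2] :: 'k ^ 2)) = c2 *s vector [T $ 1, T $ 2]"
      using proportional_coords_proj[OF T(1)] proportional_coords_proj[OF vec0] by blast
    have "coords (proj T) = (c1 * c) *s eval_forms g v" unfolding c12(1) by (subst c(2)) (rule vector_smult_assoc)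
    moreover have "coords (proj (vector [T $ 1, T $ 2] :: 'k ^ 2)) = (c2 * (c * e)) *s eval_forms W v"
      unfolding c12(2) unfolding vec by (rule vector_smult_assoc)
    ultimately show ?thesis using biform_homogeneous[OF F] all by simp
  qed
  then show "\<forall>(x, y)\<in>Z. F (coords x) (coords y) = 0" by auto
qed

text \<open>
  \<open>H0\<close> and \<open>H1\<close> are the coordinates of the rational inverse in the basis \<open>v0, v1\<close>, by Cramer's rule; its
  value at the image of \<open>v0 + s v1\<close> is a multiple of \<open>v0 + s v1\<close>.
\<close>

lemma rational_inverse_in_chart:
  "\<exists>e H0 H1 c. c \<noteq> 0 \<and> form e H0 \<and> form e H1 \<and>
     (\<forall>s. H0 (eval_vec gs s) = poly c s \<and> H1 (eval_vec gs s) = s * poly c s)"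
proof -
  obtain e and H :: "'k ^ 3 \<Rightarrow> 'k ^ 2" where H: "\<And>i. form e (\<lambda>v. H v $ i)"
    "\<exists>x\<in>range (curve_map g). H (coords x) \<noteq> 0"
    "\<And>q. H (coords (curve_map g q)) \<noteq> 0 \<Longrightarrow> proj (H (coords (curve_map g q))) = q"
    using birational unfolding birational_onto_image_def by metis
  have hom: "H (c *s v) = c ^ e *s H v" for c v
  proof -
    have "H (c *s v) $ i = c ^ e * H v $ i" for i
      using biform_homogeneous[OF form_imp_biform[OF H(1)[of i]], of c v] by simp
    then show ?thesis by (simp add: vec_eq_iff)
  qed
  have inverse: "\<exists>c. H (eval_forms g v) = c *s v" if v: "v \<noteq> 0" for v
  proof (cases "H (eval_forms g v) = 0")
    case True
    then show ?thesis by (intro exI[of _ 0]) (simp add: vec_eq_iff)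
  next
    case False
    obtain c where c: "c \<noteq> 0" "coords (proj (eval_forms g v)) = c *s eval_forms g v"
      using proportional_coords_proj[OF eval_g_nonzero[OF v]] by blast
    have eq: "H (coords (curve_map g (proj v))) = c ^ e *s H (eval_forms g v)"
      unfolding curve_map_proj[OF forms_g v eval_g_nonzero[OF v]] c(2) by (rule hom)
    then have nz: "c ^ e *s H (eval_forms g v) \<noteq> 0" using c(1) False by (simp add: vec_eq_iff)
    then have "proj v = proj (c ^ e *s H (eval_forms g v))" using H(3)[of "proj v"] unfolding eq by simp
    then obtain c' where "c ^ e *s H (eval_forms g v) = c' *s v" using proj_eq_iff[OF v nz] by blast
    then have "inverse (c ^ e) *s (c ^ e *s H (eval_forms g v)) = (inverse (c ^ e) * c') *s v"
      by (simp only: vector_smult_assoc)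
    moreover have "inverse (c ^ e) *s (c ^ e *s H (eval_forms g v)) = H (eval_forms g v)"
      using c(1) by (simp add: vector_smult_assoc)
    ultimately show ?thesis by metis
  qed
  define \<Delta> where "\<Delta> = v1 $ 2 * v0 $ 1 - v1 $ 1 * v0 $ 2"
  have \<Delta>: "\<Delta> \<noteq> 0" using chart unfolding eval2_line \<Delta>_def .
  define H0 where "H0 = (\<lambda>v. (v1 $ 2 / \<Delta>) * H v $ 1 + (- v1 $ 1 / \<Delta>) * H v $ 2)"
  define H1 where "H1 = (\<lambda>v. (v0 $ 1 / \<Delta>) * H v $ 2 + (- v0 $ 2 / \<Delta>) * H v $ 1)"
  have forms: "form e H0" "form e H1" unfolding H0_def H1_def by (intro form_linear_combination H(1))+
  have \<gamma>: "\<exists>\<gamma>. H (eval_forms g (z s)) = \<gamma> *s z s \<and> H0 (eval_forms g (z s)) = \<gamma> \<and>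
      H1 (eval_forms g (z s)) = s * \<gamma>" for s
  proof -
    obtain \<gamma> where \<gamma>: "H (eval_forms g (z s)) = \<gamma> *s z s" using inverse[OF z_nonzero] by blast
    have "H0 (eval_forms g (z s)) = (v1 $ 2 * (\<gamma> * (z s) $ 1) - v1 $ 1 * (\<gamma> * (z s) $ 2)) / \<Delta>"
      unfolding H0_def \<gamma> by (simp add: diff_divide_distrib)
    also have "v1 $ 2 * (\<gamma> * (z s) $ 1) - v1 $ 1 * (\<gamma> * (z s) $ 2) = \<gamma> * \<Delta>"
      unfolding \<Delta>_def by (simp add: algebra_simps)
    finally have 0: "H0 (eval_forms g (z s)) = \<gamma>" using \<Delta> by simp
    have "H1 (eval_forms g (z s)) = (v0 $ 1 * (\<gamma> * (z s) $ 2) - v0 $ 2 * (\<gamma> * (z s) $ 1)) / \<Delta>"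
      unfolding H1_def \<gamma> by (simp add: diff_divide_distrib)
    also have "v0 $ 1 * (\<gamma> * (z s) $ 2) - v0 $ 2 * (\<gamma> * (z s) $ 1) = s * \<gamma> * \<Delta>"
      unfolding \<Delta>_def by (simp add: algebra_simps)
    finally have "H1 (eval_forms g (z s)) = s * \<gamma>" using \<Delta> by simp
    then show ?thesis using \<gamma> 0 by blast
  qed
  define c where "c = pullback gs ws (\<lambda>v y. H0 v)"
  have c: "poly c s = H0 (eval_forms g (z s))" for s
    unfolding c_def poly_pullback[OF form_imp_biform[OF forms(1)]] eval_vec_on_line ..
  have "c \<noteq> 0"
  proof
    assume "c = 0"
    then have "H0 (eval_forms g (z s)) = 0" for s using c[of s] by simp
    then have "H (eval_forms g (z s)) $ i = 0" for s i using \<gamma>[of s] by auto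
    then have "H (eval_forms g (\<alpha> *s v0 + \<beta> *s v1)) $ i = 0" for \<alpha> \<beta> i
      using zero_from_chart[OF forms_g forms_W form_imp_biform[OF H(1)[of i]], of v0 v1 \<alpha> \<beta>] by simp
    then have lin: "H (eval_forms g (\<alpha> *s v0 + \<beta> *s v1)) = 0" for \<alpha> \<beta> by (simp add: vec_eq_iff)
    have zero: "H (eval_forms g v) = 0" for v using decompose[OF chart, of v] lin by metis
    obtain q where q: "H (coords (curve_map g q)) \<noteq> 0" using H(2) by blast
    define v where "v = coords q"
    have v: "v \<noteq> 0" unfolding v_def by (rule coords_nonzero)
    have "curve_map g q = proj (eval_forms g v)"
      using curve_map_proj[OF forms_g v eval_g_nonzero[OF v]] unfolding v_def proj_coords .
    then obtain c' where "coords (curve_map g q) = c' *s eval_forms g v"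
      using proportional_coords_proj[OF eval_g_nonzero[OF v]] by metis
    then have "H (coords (curve_map g q)) = c' ^ e *s H (eval_forms g v)" by (simp add: hom)
    then show False using q unfolding zero by (simp add: vec_eq_iff)
  qed
  moreover have "H0 (eval_vec gs s) = poly c s \<and> H1 (eval_vec gs s) = s * poly c s" for s
    unfolding eval_vec_on_line c using \<gamma>[of s] by auto
  ultimately show ?thesis using forms by blast
qed

theorem blowup_chart_exists: "\<exists>h. blowup_chart gs ws h d (d - dj) a b Z (S D)"
proof -
  obtain h where h: "gs $ 1 = h * ws $ 1" "gs $ 2 = h * ws $ 2" using exists_h by blast
  note hQ = h_associated_Q3[OF h]
  obtain t where t: "t \<noteq> 0" "S Q3 = smult t h" using hQ(3) by blast
  have h_eq: "h = smult (inverse t) (S Q3)" unfolding t(2) using t(1) by simp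
  have r_eq: "smult b (ws $ 1) - smult a (ws $ 2) = S D * S E"
    using arg_cong[OF D(2), of S] unfolding ws_simps by (simp add: add.commute)
  have Q3_eq: "S Q3 = S D * S A" using arg_cong[OF D(1), of S] by simp
  have "poly (S A) s \<noteq> 0 \<or> poly (S E) s \<noteq> 0" for s using no_common[OF z_nonzero] by simp
  then obtain x y where xy: "x * S A + y * S E = 1" using bezout_pair by blast
  have "blowup_chart gs ws h d (d - dj) a b Z (S D)"
  proof
    show "gs $ 1 = h * ws $ 1" "gs $ 2 = h * ws $ 2" by (fact h)+
    show "\<exists>i. poly (gs $ i) s \<noteq> 0" for s using g_no_zero[OF z_nonzero] by simp
    show "\<exists>j. poly (ws $ j) s \<noteq> 0" for s
      using P_no_zero[OF z_nonzero, of s] unfolding exists_2 ws_simps by auto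
    show "degree (gs $ i) \<le> d" for i using on_line_form(1)[of d "g $ i" v0 v1] forms_g by simp
    show "degree (gs $ 3) = d" using degree_on_line_form(1)[of d "g $ 3" v1 v0] forms_g at_v1(2) by simp
    show "degree (ws $ j) \<le> d - dj" for j
      using on_line_form(1)[of "d - dj" "W $ j" v0 v1] forms_W by simp
    show "\<exists>j. ws $ j \<noteq> 0 \<and> degree (ws $ j) = d - dj"
      using degree_on_line_form[OF forms_P(2) P2_at_v1, of v0] unfolding exists_2 ws_simps by blast
    show "h \<noteq> 0" "degree h + (d - dj) = d" using hQ(1,2) dj_le by simp_all
    show "\<exists>e H0 H1 c. c \<noteq> 0 \<and> form e H0 \<and> form e H1 \<and>
       (\<forall>s. H0 (eval_vec gs s) = poly c s \<and> H1 (eval_vec gs s) = s * poly c s)"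
      by (rule rational_inverse_in_chart)
    show "(a, b) \<noteq> (0, 0)" by (rule point)
    show "(\<forall>(x, y)\<in>Z. F (coords x) (coords y) = 0) \<longleftrightarrow> (\<forall>s. F (eval_vec gs s) (eval_vec ws s) = 0)"
      if "biform m n F" for m n F by (rule vanishes_on_Z_iff[OF that h])
    show "S D dvd h" unfolding h_eq Q3_eq by (simp add: dvd_smult)
    show "S D dvd smult b (ws $ 1) - smult a (ws $ 2)" unfolding r_eq by simp
    have "S D = S D * (x * S A + y * S E)" unfolding xy by simp
    also have "\<dots> = x * S Q3 + y * (S D * S E)" unfolding Q3_eq by (simp add: algebra_simps)
    also have "x * S Q3 = smult t x * h" unfolding t(2) by simp
    finally show "\<exists>x y. S D = x * h + y * (smult b (ws $ 1) - smult a (ws $ 2))" unfolding r_eq by blast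
  qed
  then show ?thesis by blast
qed

end

lemma exists_chart:
  fixes f :: "'k::alg_closed_field poly poly"
  assumes "f \<noteq> 0" shows "\<exists>v0 v1. eval2 (line v1) v0 \<noteq> 0 \<and> eval2 f v1 \<noteq> 0"
proof -
  \<comment> \<open>The extra factor keeps the point away from the origin.\<close>
  have "f * [:[:0, 1:]:] \<noteq> 0" using assms by simp
  then obtain v1 where "eval2 (f * [:[:0, 1:]:]) v1 \<noteq> 0" using eval2_eq_zero_imp_zero by blast
  then have v1: "eval2 f v1 \<noteq> 0" "v1 \<noteq> 0" by auto
  then show ?thesis using exists_off_line[OF v1(2)] by blast
qed

theorem theorem2p1:
  fixes g :: "'k::alg_closed_field poly poly ^ 3"
    and P1 P2 Q1 Q2 Q3 D :: "'k poly poly"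
    and a b :: 'k
    and d d1 d2 dj :: nat
  assumes forms_g: "\<forall>i. binary_form d (g $ i)"
    and min_gens: "minimal_generators g"
    and height_two: "ideal_height ring_of_type_algebra (ideal_of (range (($) g))) = 2"
    and birational: "birational_onto_image (curve_map g)"
    and degrees: "d1 \<le> d2" "d1 + d2 = d" "dj = d1 \<or> dj = d2"
    and singular: "base_point \<in> curve g" "\<not> regular_local_ring (local_ring forms_on_pspace (curve g) base_point)"
    and multiplicity: "has_multiplicity (local_ring forms_on_pspace (curve g) base_point) dj"
    and hilbert_burch:
      "hilbert_burch_matrix g (vector [vector [P1, Q1], vector [P2, Q2], vector [0, Q3]])"
    and forms_P: "binary_form (d - dj) P1" "binary_form (d - dj) P2"
    and forms_Q: "binary_form dj Q1" "binary_form dj Q2" "binary_form dj Q3"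
    and point: "(a, b) \<noteq> (0, 0)"
    and gcd: "is_gcd D Q3 (smult [:a:] P1 + smult [:b:] P2)"
  shows "((base_point, proj (vector [a, b])) \<in> blowup_at_base_point (curve g) \<longleftrightarrow>
            \<not> (\<exists>c. D = [:[:c:]:])) \<and>
         ((base_point, proj (vector [a, b])) \<in> blowup_at_base_point (curve g) \<longrightarrow>
            has_multiplicity
              (local_ring forms_on_product (blowup_at_base_point (curve g))
                (base_point, proj (vector [a, b])))
              (total_degree D))"
proof -
  note rel = hilbert_burch_relations(1,2)[OF hilbert_burch]
  have g_nz: "g $ i \<noteq> 0" for i by (rule minimal_generators_nonzero[OF min_gens])
  have Q3: "Q3 \<noteq> 0" by (rule hilbert_burch_Q3_nonzero[OF hilbert_burch g_nz])
  have P_no_zero: "eval2 P1 v \<noteq> 0 \<or> eval2 P2 v \<noteq> 0" if "v \<noteq> 0" for v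
    by (rule hilbert_burch_P_no_common_zero[OF hilbert_burch Q3 forms_P that])
  have g_no_zero: "\<exists>i. eval2 (g $ i) v \<noteq> 0" if "v \<noteq> 0" for v
    by (rule height_two_imp_no_common_zero[OF forms_g height_two that])
  have r: "binary_form (d - dj) (smult [:a:] P1 + smult [:b:] P2)"
    by (intro binary_form_add binary_form_scale forms_P)
  obtain A E k where D: "Q3 = D * A" "smult [:a:] P1 + smult [:b:] P2 = D * E" "binary_form k D"
    "\<forall>v. v \<noteq> 0 \<longrightarrow> eval2 A v \<noteq> 0 \<or> eval2 E v \<noteq> 0"
    using gcd_of_forms[OF forms_Q(3) Q3 r gcd] by blast
  have D_nz: "D \<noteq> 0" using Q3 D(1) by auto
  have "g $ 1 * g $ 3 * Q3 \<noteq> 0" using g_nz Q3 by simp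
  then obtain v0 v1 where chart: "eval2 (line v1) v0 \<noteq> 0" "eval2 (g $ 1 * g $ 3 * Q3) v1 \<noteq> 0"
    using exists_chart by blast
  then have at_v1: "eval2 (g $ 1) v1 \<noteq> 0" "eval2 (g $ 3) v1 \<noteq> 0" "eval2 Q3 v1 \<noteq> 0" by auto
  interpret C: curve_chart g P1 P2 Q1 Q2 Q3 D A E a b d dj v0 v1
    by unfold_locales
      (use forms_g degrees forms_P forms_Q rel g_no_zero P_no_zero birational point D chart at_v1 in auto)
  obtain h where "blowup_chart C.gs C.ws h d (d - dj) a b C.Z (C.S D)" using C.blowup_chart_exists by blast
  then interpret B: blowup_chart C.gs C.ws h d "d - dj" a b C.Z "C.S D" .
  have V: "blowup_at_base_point (curve g) = B.V" unfolding blowup_at_base_point_def ..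
  have "eval2 D v1 \<noteq> 0" using at_v1(3) unfolding D(1) by auto
  then have deg: "degree (C.S D) = k" by (rule degree_on_line_form(1)[OF D(3)])
  have const: "(\<exists>c. D = [:[:c:]:]) \<longleftrightarrow> k = 0" by (rule form_constant_iff[OF D(3) D_nz])
  have total: "total_degree D = k" by (rule total_degree_form[OF D(3) D_nz])
  have mem: "(base_point, proj (vector [a, b])) \<in> blowup_at_base_point (curve g) \<longleftrightarrow> k \<noteq> 0"
    unfolding V B.P_in_V_iff_degree deg ..
  have "has_multiplicity (local_ring forms_on_product (blowup_at_base_point (curve g))
      (base_point, proj (vector [a, b]))) (total_degree D)" if "k \<noteq> 0"
  proof -
    interpret point_on_blowup C.gs C.ws h d "d - dj" a b C.Z "C.S D"
      by unfold_locales (use that deg in simp)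
    show ?thesis using multiplicity_blowup unfolding V total deg .
  qed
  then show ?thesis using mem const by blast
qed

end
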